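(* Let $\lambda\in\mathbb{R}$ and $F=\frac{\pi^2q}{3p}$ with $p,q\in\mathbb{N}$. If $E\in\mathbb{R}\setminus\{\frac{\pi^2}{3p}m+\lambda:m\in\mathbb{Z}\}$ and $R$ is the Prüfer radius of a non-trivial real-valued solution $\psi$ of the generalized eigenvalue equation with $g_n\equiv\lambda$, then $\lim_{n\to\infty}\log R(n)$ exists and is finite. Moreover, if $E=\frac{\pi^2}{3p}m+\lambda$ for some $m\in\mathbb{Z}$ such that $\sum_{j=0}^{q-1}e^{-2\pi i\frac{pj^3-jm}{q}}=0$, the same conclusion holds.
   Context: Generalized eigenvalue equation: $-\psi''-Fx\psi=E\psi$ on $\mathbb{R}\setminus\mathbb{Z}$, $\psi$ continuous at each $n\in\mathbb{Z}$, $\lim_{\epsilon\to0^+}(\psi'(n+\epsilon)-\psi'(n-\epsilon))=g_n\psi(n)$. Reference solution $\zeta(x)=(\pi/F^{1/3})^{1/2}(i\,\mathrm{Ai}(-F^{1/3}(x+E/F))+\mathrm{Bi}(-F^{1/3}(x+E/F)))$ (Airy functions), which has no real zeros. Prüfer radius: for $n\ge1$ let $\alpha(n)\in\mathbb{C}$ be the unique number with $\psi(x)=\alpha(n)\zeta(x)+\overline{\alpha(n)}\,\overline{\zeta(x)}$ for $x\in(n-1,n)$, and $R(n)=2|\alpha(n)|$. *)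

theory Defs
  imports "HOL-Analysis.Analysis"
begin

text \<open>Airy functions via their standard Maclaurin series (Abramowitz--Stegun 10.4.2--10.4.3):
  Ai x = c1 f x - c2 g x,  Bi x = sqrt 3 (c1 f x + c2 g x).\<close>

definition airy_f :: "real \<Rightarrow> real" where
  "airy_f x = (\<Sum>k. 3 ^ k * pochhammer (1/3) k * x ^ (3*k) / fact (3*k))"

definition airy_g :: "real \<Rightarrow> real" where
  "airy_g x = (\<Sum>k. 3 ^ k * pochhammer (2/3) k * x ^ (3*k+1) / fact (3*k+1))"

definition airy_c1 :: real where
  "airy_c1 = 1 / (3 powr (2/3) * Gamma (2/3))"

definition airy_c2 :: real where
  "airy_c2 = 1 / (3 powr (1/3) * Gamma (1/3))"

definition Ai :: "real \<Rightarrow> real" where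
  "Ai x = airy_c1 * airy_f x - airy_c2 * airy_g x"

definition Bi :: "real \<Rightarrow> real" where
  "Bi x = sqrt 3 * (airy_c1 * airy_f x + airy_c2 * airy_g x)"

definition zeta :: "real \<Rightarrow> real \<Rightarrow> real \<Rightarrow> complex" where
  "zeta F E x = complex_of_real (sqrt (pi / F powr (1/3))) *
     (\<i> * complex_of_real (Ai (- (F powr (1/3)) * (x + E / F)))
      + complex_of_real (Bi (- (F powr (1/3)) * (x + E / F))))"

definition gen_eig_solution ::
  "real \<Rightarrow> real \<Rightarrow> (int \<Rightarrow> real) \<Rightarrow> (real \<Rightarrow> real) \<Rightarrow> bool" where
  "gen_eig_solution F E g \<psi> \<longleftrightarrow>
     continuous_on UNIV \<psi> \<and>
     (\<forall>x. x \<notin> \<int> \<longrightarrow> \<psi> differentiable (at x) \<and> (deriv \<psi>) differentiable (at x) \<and>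
        - deriv (deriv \<psi>) x - F * x * \<psi> x = E * \<psi> x) \<and>
     (\<forall>n::int. ((\<lambda>\<epsilon>. deriv \<psi> (of_int n + \<epsilon>) - deriv \<psi> (of_int n - \<epsilon>))
                  \<longlongrightarrow> g n * \<psi> (of_int n)) (at_right 0))"

definition pruefer_alpha :: "real \<Rightarrow> real \<Rightarrow> (real \<Rightarrow> real) \<Rightarrow> nat \<Rightarrow> complex" where
  "pruefer_alpha F E \<psi> n = (THE a. \<forall>x \<in> {real n - 1 <..< real n}.
      complex_of_real (\<psi> x) = a * zeta F E x + cnj a * cnj (zeta F E x))"

definition pruefer_R :: "real \<Rightarrow> real \<Rightarrow> (real \<Rightarrow> real) \<Rightarrow> nat \<Rightarrow> real" where
  "pruefer_R F E \<psi> n = 2 * cmod (pruefer_alpha F E \<psi> n)"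

end

theory Submission
  imports Defs "HOL-Complex_Analysis.Complex_Analysis" "HOL-Probability.Probability" "HOL-Real_Asymp.Real_Asymp"
begin

text \<open>Variation of parameters at the integer points gives $\alpha(n+1) = \alpha(n) - \frac{i\lambda}{2}
  (|\zeta(n)|^2 \alpha(n) + \overline{\zeta(n)}^2\, \overline{\alpha(n)})$. The Airy asymptotics (read off from an
  integral representation of $\mathrm{Ai}^2 + \mathrm{Bi}^2$) and a unimodular change of phase turn this into
  $y_{n+1} = (1 + |A_n|^2/2)\, y_n + A_n \overline{y_n} + O(n^{-3/2}) |y_n|$, where
  $A_n = -\frac{i\lambda}{2}\, p_n^{-1} \exp(-\frac{4i}{3F} p_n^3)$ and $p_n = (Fn + E - \lambda)^{1/2}$.
  A substitution $w = y + Q\, \overline{y}$ replaces $A_n$ by $A_n - Q_n + Q_{n+1}$ and preserves the quadratic term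
  up to a telescoping sum, so it is enough to write $A_n$ as the difference of a null sequence, up to errors whose
  effect is summable.

  The phase of $A_n$ is stationary modulo $2\pi$ when $p_n$ is near a multiple $\pi k$. As in the Poisson summation
  formula, the sum of the $A_n$ becomes a sum over $k$ of $\omega_k$ times a slowly varying factor of size
  $k^{-1/2}$, where $\omega_k = \exp(i(\frac{2\pi^3 k^3}{3F} - \frac{2\pi k (E - \lambda)}{F}))$. For
  $F = \pi^2 q/(3p)$ this is quasi-periodic in $k$ with period $q$. Its partial sums are bounded exactly when the
  factor of quasi-periodicity differs from 1 or the sum over one period vanishes, and these are the two cases of the
  theorem.\<close>

section \<open>The amplitude of the resonance integrals\<close>

text \<open>The obstacle is that |A_n| has order n^(-1/2): neither A_n nor |A_n|^2 is summable. The
  growth |A_n|^2/2 of the diagonal has to cancel against the second-order effect of the off-diagonal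
  term, so the substitution must be tracked exactly to second order; a mere estimate would lose a
  logarithm. A second loss threatens in the cubic terms. At a resonance Q has size p^(-1/2), which
  makes |Q|^2 |A| of order 1/n, and its sum converges only because such n are sparse. Poisson
  summation is replaced by a local device. Each oscillatory integrand carries an amplitude for which
  its integral over the unit cell around n equals a cutoff chi times \<open>b n\<close>, up to
  O(p^(-3)). The cutoffs of the two resonances nearest to p(n) add up to 1, so \<open>b n\<close> is
  a sum of increments of two such integrals, and no infinite sum over k appears at a fixed n. Only
  the completed integrals are summed over k, and that sum converges conditionally.\<close>

definition box_moment :: "nat \<Rightarrow> complex \<Rightarrow> complex" where
  "box_moment j z = integral (cbox (-1/2) (1/2)) (\<lambda>s::real. of_real s ^ j * exp (- 2 * \<i> * z * of_real s))"

lemma box_moment_integrand_continuous: "continuous_on A (\<lambda>s::real. of_real s ^ j * exp (- 2 * \<i> * z * of_real s))"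
  by (intro continuous_intros)

lemma has_integral_box_moment:
  "((\<lambda>s::real. of_real s ^ j * exp (- 2 * \<i> * z * of_real s)) has_integral box_moment j z) {-1/2..1/2}"
  unfolding box_moment_def cbox_interval
  by (intro integrable_integral integrable_continuous_interval box_moment_integrand_continuous)

lemma box_moment_has_field_derivative:
  "(box_moment j has_field_derivative (- 2 * \<i> * box_moment (Suc j) z)) (at z)"
proof -
  have eq: "integral (cbox (-1/2) (1/2)) (\<lambda>s::real. of_real s ^ j * (- 2 * \<i> * of_real s * exp (- 2 * \<i> * z * of_real s)))
     = - 2 * \<i> * box_moment (Suc j) z"
    unfolding box_moment_def integral_mult_right[symmetric]
    by (intro integral_cong) (simp add: algebra_simps)
  have "((\<lambda>z. integral (cbox (-1/2) (1/2)) (\<lambda>s::real. of_real s ^ j * exp (- 2 * \<i> * z * of_real s))) has_field_derivative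
      integral (cbox (-1/2) (1/2)) (\<lambda>s::real. of_real s ^ j * (- 2 * \<i> * of_real s * exp (- 2 * \<i> * z * of_real s)))) (at z within UNIV)"
  proof (rule leibniz_rule_field_derivative)
    show "((\<lambda>x. of_real t ^ j * exp (- 2 * \<i> * x * of_real t)) has_field_derivative of_real t ^ j * (- 2 * \<i> * of_real t * exp (- 2 * \<i> * x * of_real t))) (at x within UNIV)" for x and t :: real
      by (auto intro!: derivative_eq_intros)
    show "(\<lambda>s::real. of_real s ^ j * exp (- 2 * \<i> * x * of_real s)) integrable_on cbox (-1/2) (1/2)" for x
      by (intro integrable_continuous box_moment_integrand_continuous)
    show "continuous_on (UNIV \<times> cbox (-1/2) (1/2)) (\<lambda>(x, t::real). of_real t ^ j * (- 2 * \<i> * of_real t * exp (- 2 * \<i> * x * of_real t)))"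
      by (auto simp: split_beta intro!: continuous_intros)
  qed auto
  then show ?thesis unfolding eq by (simp add: box_moment_def[abs_def])
qed

lemma box_moment_holomorphic: "box_moment j holomorphic_on A"
  by (meson box_moment_has_field_derivative DERIV_subset holomorphic_onI field_differentiable_def top_greatest field_differentiable_at_within)

lemma box_moment_0: "z \<noteq> 0 \<Longrightarrow> box_moment 0 z = sin z / z"
proof -
  assume z: "z \<noteq> 0"
  have "((\<lambda>s::real. of_real s ^ 0 * exp (- 2 * \<i> * z * of_real s)) has_integral
      (exp (- 2 * \<i> * z * of_real (1/2)) / (- 2 * \<i> * z) - exp (- 2 * \<i> * z * of_real (-1/2)) / (- 2 * \<i> * z))) {-1/2..1/2}"
    by (rule fundamental_theorem_of_calculus)
       (use z in \<open>auto intro!: derivative_eq_intros has_vector_derivative_real_field simp: field_simps\<close>)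
  then have "box_moment 0 z = exp (- 2 * \<i> * z * of_real (1/2)) / (- 2 * \<i> * z) - exp (- 2 * \<i> * z * of_real (-1/2)) / (- 2 * \<i> * z)"
    using has_integral_box_moment has_integral_unique by blast
  also have "\<dots> = sin z / z"
    using z by (simp add: sin_exp_eq field_simps)
  finally show ?thesis .
qed

lemma box_moment_0_0: "box_moment 0 0 = 1"
  by (simp add: box_moment_def)

lemma box_moment_double: "box_moment 0 z = box_moment 0 (z / 2) * cos (z / 2)"
proof (cases "z = 0")
  case False
  then show ?thesis using sin_double[of "z / 2"] by (simp add: box_moment_0)
qed (simp add: box_moment_0_0)

text \<open>The function sin has no zero in (0, pi/2]: halving the argument moves the zeros of
  \<open>box_moment 0\<close> from +-pi to +-2 pi.\<close>

lemma box_moment_half_nonzero: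
  assumes "\<bar>r\<bar> \<le> pi"
  shows "box_moment 0 (of_real r / 2) \<noteq> 0"
proof (cases "r = 0")
  case False
  have "sin (r / 2) \<noteq> 0"
  proof (cases "r > 0")
    case True then show ?thesis using sin_gt_zero[of "r/2"] assms by simp
  next
    case neg: False
    then show ?thesis using sin_gt_zero[of "-r/2"] assms False by simp
  qed
  then have "sin (of_real r / 2 :: complex) \<noteq> 0" 
    using sin_of_real[of "r/2", where 'a = complex] by (metis of_real_eq_0_iff of_real_divide of_real_numeral)
  then show ?thesis using False by (simp add: box_moment_0)
qed (simp add: box_moment_0_0)

text \<open>An open complex set around [-pi, pi] on which the amplitudes are holomorphic. Bounds for
  all derivatives on the interval then follow from compactness.\<close>

definition kapU :: "complex set" where
  "kapU = {z. box_moment 0 (z / 2) \<noteq> 0}"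

text \<open>The amplitude kap must give kap z * box_moment 0 z = chi z on the real line, where the translates by multiples
  of $\pi$ of chi, restricted to $[-\pi,\pi]$, sum to 1 and kap vanishes to third order at $\pm\pi$. With the half-angle formula for
  box_moment 0, the zeros of box_moment 0 at $\pm\pi$ cancel. The second amplitude kap1 corrects the error of
  order $1/k$ that comes from the curvature of the phase.\<close>

definition kapG :: "complex \<Rightarrow> complex" where
  "kapG z = (3 - 2 * cos (z / 2) ^ 2) / box_moment 0 (z / 2)"

definition kap :: "complex \<Rightarrow> complex" where
  "kap z = cos (z / 2) ^ 3 * kapG z"

definition kap1 :: "complex \<Rightarrow> complex" where
  "kap1 z = - (1/2) * cos (z / 2) * ((cos (z / 2) * deriv kapG z - 3/2 * sin (z / 2) * kapG z) * box_moment 1 z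
     - \<i> * cos (z / 2) * kapG z * box_moment 2 z) / box_moment 0 (z / 2)"

definition chi :: "real \<Rightarrow> real" where
  "chi r = cos (r / 2) ^ 4 * (3 - 2 * cos (r / 2) ^ 2)"

lemma open_kapU: "open kapU"
proof -
  have "continuous_on UNIV (\<lambda>z::complex. box_moment 0 (z / 2))"
    by (intro continuous_on_compose2[OF holomorphic_on_imp_continuous_on[OF box_moment_holomorphic[of 0 UNIV]]] continuous_intros) auto
  then have "open ((\<lambda>z. box_moment 0 (z / 2)) -` (- {0}))"
    by (intro open_vimage) auto
  moreover have "(\<lambda>z. box_moment 0 (z / 2)) -` (- {0}) = kapU" by (auto simp: kapU_def)
  ultimately show ?thesis by simp
qed

lemma real_subset_kapU: "of_real ` {-pi..pi} \<subseteq> kapU"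
  using box_moment_half_nonzero by (auto simp: kapU_def)

lemma box_moment_half_holomorphic [holomorphic_intros]: "(\<lambda>z. box_moment j (z / 2)) holomorphic_on A"
proof -
  have "(\<lambda>z. z / 2) holomorphic_on A" by (intro holomorphic_intros) auto
  from holomorphic_on_compose[OF this box_moment_holomorphic[of j]] show ?thesis by (simp add: o_def)
qed

lemma kapG_holomorphic [holomorphic_intros]: "kapG holomorphic_on kapU"
  unfolding kapG_def[abs_def] by (intro holomorphic_intros) (auto simp: kapU_def)

lemma kap_holomorphic: "kap holomorphic_on kapU"
  unfolding kap_def[abs_def] by (intro holomorphic_intros) auto

lemma kap1_holomorphic: "kap1 holomorphic_on kapU"
  unfolding kap1_def[abs_def]
  by (intro holomorphic_intros box_moment_holomorphic open_kapU) (auto simp: kapU_def)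

lemma kap_box_moment: "z \<in> kapU \<Longrightarrow> kap z * box_moment 0 z = cos (z / 2) ^ 4 * (3 - 2 * cos (z / 2) ^ 2)"
  unfolding kap_def kapG_def box_moment_double[of z] by (simp add: kapU_def power_numeral_reduce)

lemma kap_chi:
  assumes "\<bar>r\<bar> \<le> pi" shows "kap (of_real r) * box_moment 0 (of_real r) = of_real (chi r)"
proof -
  have "cos (of_real r / 2 :: complex) = of_real (cos (r / 2))"
    by (metis cos_of_real of_real_divide of_real_numeral)
  then show ?thesis
    using kap_box_moment[of "of_real r"] subsetD[OF real_subset_kapU, of "of_real r"] assms
    by (auto simp: chi_def abs_le_iff)
qed

lemma deriv_kap:
  assumes "z \<in> kapU"
  shows "deriv kap z = cos (z / 2) ^ 2 * (cos (z / 2) * deriv kapG z - 3/2 * sin (z / 2) * kapG z)"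
proof -
  have "(kapG has_field_derivative deriv kapG z) (at z)"
    using holomorphic_derivI[OF kapG_holomorphic open_kapU assms] .
  then have "(kap has_field_derivative cos (z / 2) ^ 2 * (cos (z / 2) * deriv kapG z - 3/2 * sin (z / 2) * kapG z)) (at z)"
    unfolding kap_def[abs_def]
    by (auto intro!: derivative_eq_intros simp: algebra_simps power_numeral_reduce)
  then show ?thesis by (rule DERIV_imp_deriv)
qed

text \<open>The right-hand side collects the first-order effects over a unit cell: the drift of
  \<open>kap\<close> comes with the first moment, the quadratic term of the phase with the second.
  Both terms carry a factor cos^2; one cosine cancels the zero of \<open>box_moment 0\<close>, the
  other keeps \<open>kap1\<close> zero at +-pi.\<close>

lemma kap1_box_moment:
  assumes "z \<in> kapU"
  shows "kap1 z * box_moment 0 z = - (1/2) * (deriv kap z * box_moment 1 z - \<i> * kap z * box_moment 2 z)"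
proof -
  have nz: "box_moment 0 (z / 2) \<noteq> 0" using assms by (simp add: kapU_def)
  show ?thesis
    unfolding deriv_kap[OF assms] kap1_def box_moment_double[of z] kap_def using nz
    by (simp add: field_simps power2_eq_square power3_eq_cube)
qed

lemma cos_half_pi: "cos (of_real pi / 2 :: complex) = 0" "cos (- of_real pi / 2 :: complex) = 0"
  by (metis cos_of_real cos_pi_half of_real_0 of_real_divide of_real_numeral)
     (metis cos_minus cos_of_real cos_pi_half of_real_0 of_real_divide of_real_numeral minus_divide_left)

lemma kap_pi: "kap (of_real pi) = 0" "kap (of_real (- pi)) = 0"
  "kap1 (of_real pi) = 0" "kap1 (of_real (- pi)) = 0"
  using cos_half_pi by (simp_all add: kap_def kap1_def)

text \<open>With s = cos^2 (r/2), \<open>chi\<close> is the smoothstep h(s) = s^2 (3 - 2 s), which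
  satisfies h(s) + h(1 - s) = 1; shifting r by pi exchanges s and 1 - s. The double zero of h at 0
  is a fourfold zero of \<open>chi\<close> at +-pi.\<close>

lemma chi_partition: "chi r + chi (r + pi) = 1"
proof -
  have "cos ((r + pi) / 2) = - sin (r / 2)"
    by (simp add: add_divide_distrib cos_add)
  then have "chi r + chi (r + pi) = cos (r/2)^4 * (3 - 2 * cos (r/2)^2) + sin (r/2)^4 * (3 - 2 * sin (r/2)^2)"
    by (simp add: chi_def)
  also have "sin (r/2)^4 = (1 - cos (r/2)^2)^2" 
    by (simp add: sin_squared_eq[symmetric] flip: power_mult)
  also have "sin (r/2)^2 = 1 - cos (r/2)^2" by (rule sin_squared_eq)
  finally show ?thesis by (simp add: power2_eq_square power4_eq_xxxx algebra_simps)
qed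

lemma holomorphic_real_bound:
  assumes "f holomorphic_on kapU"
  obtains M where "M > 0" "\<And>r. \<bar>r\<bar> \<le> pi \<Longrightarrow> cmod (f (of_real r)) \<le> M"
    "\<And>r. \<bar>r\<bar> \<le> pi \<Longrightarrow> cmod (deriv f (of_real r)) \<le> M"
    "\<And>r. \<bar>r\<bar> \<le> pi \<Longrightarrow> cmod (deriv (deriv f) (of_real r)) \<le> M"
proof -
  have B: "\<exists>M. \<forall>r. \<bar>r\<bar> \<le> pi \<longrightarrow> cmod (g (of_real r)) \<le> M" if "g holomorphic_on kapU" for g
  proof -
    have "compact (g ` of_real ` {-pi..pi})"
      by (intro compact_continuous_image continuous_on_subset[OF holomorphic_on_imp_continuous_on[OF that] real_subset_kapU]
           continuous_intros compact_Icc)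
    then have "bounded (g ` of_real ` {-pi..pi})" by (rule compact_imp_bounded)
    then show ?thesis unfolding bounded_iff by (fastforce simp: abs_le_iff)
  qed
  have h: "deriv f holomorphic_on kapU" "deriv (deriv f) holomorphic_on kapU"
    using assms by (auto intro!: holomorphic_deriv open_kapU)
  obtain M0 M1 M2 where "\<forall>r. \<bar>r\<bar> \<le> pi \<longrightarrow> cmod (f (of_real r)) \<le> M0"
    "\<forall>r. \<bar>r\<bar> \<le> pi \<longrightarrow> cmod (deriv f (of_real r)) \<le> M1" "\<forall>r. \<bar>r\<bar> \<le> pi \<longrightarrow> cmod (deriv (deriv f) (of_real r)) \<le> M2"
    using B[OF assms] B[OF h(1)] B[OF h(2)] by blast
  then show ?thesis
    by (intro that[of "\<bar>M0\<bar> + \<bar>M1\<bar> + \<bar>M2\<bar> + 1"]) (auto intro: order_trans)+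
qed

lemma holomorphic_has_vector_derivative:
  assumes "f holomorphic_on kapU" "\<bar>r\<bar> \<le> pi"
  shows "((\<lambda>r. f (of_real r)) has_vector_derivative deriv f (of_real r)) (at r within A)"
proof -
  have "of_real r \<in> kapU" using real_subset_kapU assms(2) by (auto simp: abs_le_iff)
  then have "(f has_field_derivative deriv f (of_real r)) (at (of_real r))"
    using assms(1) holomorphic_derivI open_kapU by blast
  then show ?thesis by (rule has_vector_derivative_real_field)
qed

lemma cexp_has_vector_derivative:
  assumes "(\<phi> has_real_derivative d) (at r within A)"
  shows "((\<lambda>r. exp (- \<i> * complex_of_real (\<phi> r))) has_vector_derivative (- \<i> * of_real d * exp (- \<i> * of_real (\<phi> r)))) (at r within A)"
proof -
  have 1: "((\<lambda>r. complex_of_real (\<phi> r)) has_vector_derivative of_real d) (at r within A)"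
    using assms by (rule has_vector_derivative_of_real)
  have 2: "((\<lambda>z. exp (- \<i> * z)) has_field_derivative (- \<i> * exp (- \<i> * of_real (\<phi> r)))) (at (of_real (\<phi> r)) within (\<lambda>r. complex_of_real (\<phi> r)) ` A)"
    by (auto intro!: derivative_eq_intros)
  show ?thesis
    using field_vector_diff_chain_within[OF 1 2] by (simp add: o_def mult_ac)
qed

section \<open>Oscillatory integrals\<close>

locale osc =
  fixes F :: real
  assumes F_pos: "F > 0"
begin

text \<open>With $\rho = P - \pi k$, the phase of Eo is, up to a constant, the phase $-\frac{4}{3F}P^3 + \frac{2\pi k}{F} P^2$
  of the $k$-th Poisson term in the variable $P = (Fx + e)^{1/2}$; it is stationary at $P = \pi k$.\<close>

definition Eo :: "nat \<Rightarrow> real \<Rightarrow> complex" where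
  "Eo k r = exp (- \<i> * of_real ((2 * pi * real k * r\<^sup>2 + 4 * r ^ 3 / 3) / F))"

lemma cmod_Eo: "cmod (Eo k r) = 1"
  unfolding Eo_def by (simp add: norm_exp_eq_Re)

lemma Eo_has_vector_derivative:
  "(Eo k has_vector_derivative (- (4 * \<i> / of_real F) * of_real (r * (pi * real k + r)) * Eo k r)) (at r within A)"
proof -
  have d: "((\<lambda>r. (2 * pi * real k * r\<^sup>2 + 4 * r ^ 3 / 3) / F) has_real_derivative (2 * pi * real k * (2 * r) + 4 * (3 * r\<^sup>2) / 3) / F) (at r within A)"
    by (intro DERIV_cdivide DERIV_add DERIV_cmult) (auto intro!: derivative_eq_intros)
  have e: "(2 * pi * real k * (2 * r) + 4 * (3 * r\<^sup>2) / 3) / F = 4 / F * (r * (pi * real k + r))"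
    by (simp add: power2_eq_square add_divide_distrib algebra_simps)
  have f: "- \<i> * (of_real (4 / F) * Y) * X = - (4 * \<i> / of_real F) * Y * X" for X Y :: complex
    by simp
  show ?thesis
    unfolding Eo_def[abs_def]
    by (rule has_vector_derivative_eq_rhs[OF cexp_has_vector_derivative[OF d]])
       (simp only: e of_real_mult[of "4 / F"] f)
qed

text \<open>Integration by parts away from the stationary point r = 0, dividing by the derivative of
  the phase. The statement is about an arbitrary primitive \<open>Pr\<close>, so the proof compares
  derivatives only.\<close>

lemma osc_far:
  assumes k: "2 \<le> k" and ab: "a \<le> b" "-pi \<le> a" "b \<le> pi" and m: "0 < m" "m \<le> a \<or> b \<le> -m"
    and w: "\<And>r. \<bar>r\<bar> \<le> pi \<Longrightarrow> (w has_vector_derivative w' r) (at r within {-pi..pi})"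
    and M: "\<And>r. \<bar>r\<bar> \<le> pi \<Longrightarrow> cmod (w r) \<le> M" "\<And>r. \<bar>r\<bar> \<le> pi \<Longrightarrow> cmod (w' r) \<le> M"
    and Pr: "\<And>r. \<bar>r\<bar> \<le> pi \<Longrightarrow> (Pr has_vector_derivative (w r * Eo k r)) (at r within {-pi..pi})"
  shows "cmod (Pr b - Pr a) \<le> 3 * F * M / (real k * m)"
proof (cases "a = b")
  case True
  have "0 \<le> M" by (rule order_trans[OF norm_ge_zero M(1)[of 0]]) simp
  then show ?thesis using True F_pos m k by simp
next
  case False
  have M0: "0 \<le> M" by (rule order_trans[OF norm_ge_zero M(1)[of 0]]) simp
  have k2: "real k \<ge> 2" using k by simp
  have rng: "\<bar>r\<bar> \<le> pi" "m \<le> \<bar>r\<bar>" if "r \<in> {a..b}" for r using that ab m by auto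
  define g where "g r = r * (pi * real k + r)" for r
  have pk: "pi * real k / 2 \<le> pi * real k + r" if "\<bar>r\<bar> \<le> pi" for r
  proof -
    have "pi * 2 \<le> pi * real k" using k2 by (intro mult_left_mono) auto
    then show ?thesis using that by linarith
  qed
  have g_low: "\<bar>r\<bar> * (pi * real k / 2) \<le> \<bar>g r\<bar>" if "r \<in> {a..b}" for r
    unfolding g_def abs_mult using pk[OF rng(1)[OF that]]
    by (intro mult_left_mono) linarith+
  have g_nz: "g r \<noteq> 0" if "r \<in> {a..b}" for r
  proof -
    have "0 < \<bar>r\<bar> * (pi * real k / 2)" using rng(2)[OF that] m k2 by auto
    then show ?thesis using g_low[OF that] by auto
  qed
  \<comment> \<open>The boundary term of the integration by parts: its derivative is the integrand
    plus the remainder \<open>R\<close>.\<close>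
  define B where "B r = (\<i> * of_real F / 4) * (w r / of_real (g r)) * Eo k r" for r
  define R where "R r = (\<i> * of_real F / 4) * (w' r / of_real (g r) - w r * of_real (pi * real k + 2 * r) / (of_real (g r))\<^sup>2) * Eo k r" for r
  have gder: "((\<lambda>r. complex_of_real (g r)) has_vector_derivative of_real (pi * real k + 2 * r)) (at r within A)" for r A
    unfolding g_def by (rule has_vector_derivative_of_real) (auto intro!: derivative_eq_intros)
  have Bder: "(B has_vector_derivative (R r + w r * Eo k r)) (at r within {a..b})" if r: "r \<in> {a..b}" for r
  proof -
    have wd: "(w has_vector_derivative w' r) (at r within {a..b})"
      using has_vector_derivative_within_subset[OF w[OF rng(1)[OF r]], of "{a..b}"] ab by auto
    have gr: "(g has_real_derivative (pi * real k + 2 * r)) (at r within {a..b})"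
      unfolding g_def[abs_def] by (auto intro!: derivative_eq_intros)
    have "((\<lambda>r. inverse (g r)) has_real_derivative - ((pi * real k + 2 * r) / (g r)\<^sup>2)) (at r within {a..b})"
      using g_nz[OF r] by (auto intro!: derivative_eq_intros gr simp: power2_eq_square field_simps)
    then have "((\<lambda>r. complex_of_real (inverse (g r))) has_vector_derivative of_real (- ((pi * real k + 2 * r) / (g r)\<^sup>2))) (at r within {a..b})"
      by (rule has_vector_derivative_of_real)
    then have gi: "((\<lambda>r. inverse (complex_of_real (g r))) has_vector_derivative - (of_real (pi * real k + 2 * r) / (of_real (g r))\<^sup>2)) (at r within {a..b})"
      by simp
    show ?thesis
      unfolding B_def[abs_def]
      apply (rule has_vector_derivative_eq_rhs)
       apply (rule has_vector_derivative_mult[OF _ Eo_has_vector_derivative])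
       apply (rule has_vector_derivative_mult_right)
       apply (simp only: divide_inverse)
       apply (rule has_vector_derivative_mult[OF wd gi])
      unfolding g_def[symmetric] R_def using g_nz[OF r] F_pos
      by (simp add: field_simps power2_eq_square)
  qed
  have Rb: "cmod (R r) \<le> 5 * F * M / (4 * real k) * (1 / r\<^sup>2)" if r: "r \<in> {a..b}" for r
  proof -
    have r0: "0 < \<bar>r\<bar>" using rng(2)[OF r] m by linarith
    have rp: "\<bar>r\<bar> \<le> pi" by (rule rng(1)[OF r])
    have gl: "0 < \<bar>r\<bar> * (pi * real k / 2)" using r0 k2 by simp
    have 1: "cmod (w' r / of_real (g r)) \<le> M / (\<bar>r\<bar> * (pi * real k / 2))"
      unfolding norm_divide norm_of_real using M(2)[OF rp] g_low[OF r] gl by (intro frac_le M0) auto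
    have 2: "M / (\<bar>r\<bar> * (pi * real k / 2)) \<le> 2 * M / (real k * r\<^sup>2)"
    proof -
      have "M / (\<bar>r\<bar> * (pi * real k / 2)) = 2 * M * \<bar>r\<bar> / (pi * real k * r\<^sup>2)"
        using r0 k2 by (simp add: field_simps power2_eq_square)
      also have "\<dots> \<le> 2 * M * pi / (pi * real k * r\<^sup>2)"
        using rp M0 by (intro divide_right_mono mult_left_mono) auto
      finally show ?thesis by simp
    qed
    have pp: "\<bar>pi * real k + 2 * r\<bar> \<le> 2 * pi * real k"
    proof -
      have "pi * 2 \<le> pi * real k" using k2 by (intro mult_left_mono) auto
      then show ?thesis using rp by linarith
    qed
    have "cmod (w r * of_real (pi * real k + 2 * r) / (of_real (g r))\<^sup>2) = cmod (w r) * \<bar>pi * real k + 2 * r\<bar> / \<bar>g r\<bar>\<^sup>2"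
      by (simp only: norm_divide norm_mult norm_of_real norm_power)
    also have "\<dots> \<le> M * (2 * pi * real k) / (\<bar>r\<bar> * (pi * real k / 2))\<^sup>2"
      using M(1)[OF rp] g_low[OF r] gl pp M0 k by (intro frac_le mult_mono power_mono) auto
    also have "\<dots> = 8 * M / (pi * real k * r\<^sup>2)" using r0 k2 by (simp add: field_simps power2_eq_square)
    also have "\<dots> \<le> 8 * M / (3 * real k * r\<^sup>2)"
      using M0 k2 r0 pi_gt3 by (intro divide_left_mono mult_right_mono) auto
    also have "\<dots> \<le> 3 * M / (real k * r\<^sup>2)" using M0 k2 r0 by (simp add: field_simps)
    finally have 3: "cmod (w r * of_real (pi * real k + 2 * r) / (of_real (g r))\<^sup>2) \<le> 3 * M / (real k * r\<^sup>2)" .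
    have "cmod (R r) = F / 4 * cmod (w' r / of_real (g r) - w r * of_real (pi * real k + 2 * r) / (of_real (g r))\<^sup>2)"
      unfolding R_def using F_pos by (simp add: norm_mult norm_divide cmod_Eo)
    also have "\<dots> \<le> F / 4 * (2 * M / (real k * r\<^sup>2) + 3 * M / (real k * r\<^sup>2))"
      using F_pos 1 2 3 by (intro mult_left_mono order_trans[OF norm_triangle_ineq4]) linarith+
    also have "\<dots> = 5 * F * M / (4 * real k) * (1 / r\<^sup>2)" using k2 r0 by (simp add: field_simps)
    finally show ?thesis .
  qed
  \<comment> \<open>A primitive of the bound on \<open>R\<close>. The mean value inequality against
    it replaces the integration of 1/r^2.\<close>
  define \<phi> where "\<phi> r = - (5 * F * M / (4 * real k)) / r" for r
  have alt: "a < b" using False ab by simp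
  have r0: "r \<noteq> 0" if "r \<in> {a..b}" for r using rng(2)[OF that] m by auto
  have Prd: "(Pr has_vector_derivative (w r * Eo k r)) (at r within {a..b})" if "r \<in> {a..b}" for r
    using has_vector_derivative_within_subset[OF Pr[OF rng(1)[OF that]], of "{a..b}"] ab by auto
  have D: "((\<lambda>r. Pr r - B r) has_vector_derivative - R r) (at r within {a..b})" if "r \<in> {a..b}" for r
    by (rule has_vector_derivative_eq_rhs[OF has_vector_derivative_diff[OF Prd[OF that] Bder[OF that]]]) simp
  have pd: "(\<phi> has_vector_derivative (5 * F * M / (4 * real k) * (1 / r\<^sup>2))) (at r within {a..b})" if "r \<in> {a..b}" for r
    unfolding \<phi>_def[abs_def] has_real_derivative_iff_has_vector_derivative[symmetric] using r0[OF that]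
    by (auto intro!: derivative_eq_intros simp: power2_eq_square)
  have "norm ((Pr b - B b) - (Pr a - B a)) \<le> \<phi> b - \<phi> a"
  proof (rule differentiable_bound_general[OF alt])
    show "continuous_on {a..b} (\<lambda>r. Pr r - B r)"
      by (rule continuous_on_vector_derivative[OF D])
    show "continuous_on {a..b} \<phi>"
      by (rule continuous_on_vector_derivative[OF pd])
    fix r assume r: "a < r" "r < b"
    then have at: "at r within {a..b} = at r" by (simp add: at_within_Icc_at)
    show "((\<lambda>r. Pr r - B r) has_vector_derivative - R r) (at r)" using D[of r] r at by simp
    show "(\<phi> has_vector_derivative (5 * F * M / (4 * real k) * (1 / r\<^sup>2))) (at r)" using pd[of r] r at by simp
    show "norm (- R r) \<le> 5 * F * M / (4 * real k) * (1 / r\<^sup>2)" using Rb[of r] r by simp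
  qed
  also have "\<phi> b - \<phi> a \<le> 5 * F * M / (4 * real k) / m"
  proof -
    define c where "c = 5 * F * M / (4 * real k)"
    have c0: "0 \<le> c" unfolding c_def using F_pos M0 by simp
    have e: "\<phi> b - \<phi> a = c / a - c / b" unfolding \<phi>_def c_def by simp
    show ?thesis
    proof (cases "m \<le> a")
      case True
      then have "c / a \<le> c / m" "0 \<le> c / b" using c0 m ab by (auto intro!: divide_left_mono)
      then show ?thesis unfolding e c_def[symmetric] by linarith
    next
      case False
      then have "b \<le> - m" using m by auto
      then have "- c / b \<le> c / m" "c / a \<le> 0" using c0 m ab
        mult_left_mono[of b "- m" c]
        by (auto simp: divide_nonneg_nonpos divide_nonneg_neg field_simps)
      then show ?thesis unfolding e c_def[symmetric] by simp
    qed
  qed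
  finally have 1: "cmod ((Pr b - B b) - (Pr a - B a)) \<le> 5 * F * M / (4 * real k) / m" .
  have Bb: "cmod (B r) \<le> F * M / (real k * m) / 2" if r: "r \<in> {a..b}" for r
  proof -
    have "cmod (B r) = F / 4 * (cmod (w r) / \<bar>g r\<bar>)"
      unfolding B_def using F_pos by (simp add: norm_mult norm_divide cmod_Eo)
    also have "\<dots> \<le> F / 4 * (M / (m * (real k / 1)))"
    proof (intro mult_left_mono frac_le)
      have "m * (real k / 1) \<le> \<bar>r\<bar> * (pi * real k / 2)"
        using rng(2)[OF r] m k2 pi_gt3 by (intro mult_mono) auto
      then show "m * (real k / 1) \<le> \<bar>g r\<bar>" using g_low[OF r] by linarith
    qed (use M(1)[OF rng(1)[OF r]] F_pos M0 m k2 in auto)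
    also have "\<dots> \<le> F * M / (real k * m) / 2" using F_pos M0 m k2 by (simp add: field_simps)
    finally show ?thesis .
  qed
  have "cmod (Pr b - Pr a) \<le> cmod ((Pr b - B b) - (Pr a - B a)) + cmod (B b) + cmod (B a)"
    using norm_triangle_ineq[of "(Pr b - B b) - (Pr a - B a)" "B b - B a"] norm_triangle_ineq4[of "B b" "B a"]
    by (simp add: algebra_simps)
  also have "\<dots> \<le> 5 * F * M / (4 * real k) / m + F * M / (real k * m) / 2 + F * M / (real k * m) / 2"
    using 1 Bb[of a] Bb[of b] ab by (intro add_mono) auto
  also have "\<dots> \<le> 3 * F * M / (real k * m)"
    using F_pos M0 m k2 by (simp add: field_simps)
  finally show ?thesis .
qed

text \<open>Van der Corput's splitting at |r| = 1 / sqrt k: inside, the length of the interval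
  bounds the integral; outside, \<open>osc_far\<close> applies, and both bounds have order 1 / sqrt
  k.\<close>

lemma osc_near:
  assumes k: "2 \<le> k" and ab: "a \<in> {-pi..pi}" "b \<in> {-pi..pi}"
    and w: "\<And>r. \<bar>r\<bar> \<le> pi \<Longrightarrow> (w has_vector_derivative w' r) (at r within {-pi..pi})"
    and M: "\<And>r. \<bar>r\<bar> \<le> pi \<Longrightarrow> cmod (w r) \<le> M" "\<And>r. \<bar>r\<bar> \<le> pi \<Longrightarrow> cmod (w' r) \<le> M"
    and Pr: "\<And>r. \<bar>r\<bar> \<le> pi \<Longrightarrow> (Pr has_vector_derivative (w r * Eo k r)) (at r within {-pi..pi})"
  shows "cmod (Pr b - Pr a) \<le> (6 * F + 2) * M / sqrt (real k)"
proof -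
  have M0: "0 \<le> M" by (rule order_trans[OF norm_ge_zero M(1)[of 0]]) simp
  define d where "d = 1 / sqrt (real k)"
  have sk: "sqrt (real k) > 0" using k by simp
  have d0: "0 < d" using sk by (simp add: d_def)
  have kd: "real k * d = sqrt (real k)" using k by (simp add: d_def real_div_sqrt)
  have lip: "cmod (Pr x - Pr y) \<le> M * \<bar>x - y\<bar>" if "x \<in> {-pi..pi}" "y \<in> {-pi..pi}" for x y
  proof -
    have "norm (Pr x - Pr y) \<le> M * norm (x - y)"
    proof (rule differentiable_bound[of "{-pi..pi}" Pr "\<lambda>r h. h *\<^sub>R (w r * Eo k r)"])
      fix r assume r: "r \<in> {-pi..pi}"
      then have r': "\<bar>r\<bar> \<le> pi" by auto
      show "(Pr has_derivative (\<lambda>h. h *\<^sub>R (w r * Eo k r))) (at r within {-pi..pi})"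
        using Pr[OF r'] by (simp add: has_vector_derivative_def)
      show "onorm (\<lambda>h. h *\<^sub>R (w r * Eo k r)) \<le> M"
        using M(1)[OF r'] by (intro onorm_le) (auto simp: norm_mult cmod_Eo mult.commute[of M] intro: mult_left_mono)
    qed (use that in auto)
    then show ?thesis by simp
  qed
  have z: "cmod (Pr x - Pr 0) \<le> (3 * F + 1) * M / sqrt (real k)" if x: "x \<in> {-pi..pi}" for x
  proof (cases "\<bar>x\<bar> \<le> d")
    case True
    have "cmod (Pr x - Pr 0) \<le> M * \<bar>x\<bar>" using lip[of x 0] x by simp
    also have "\<dots> \<le> M * d" using True M0 by (intro mult_left_mono)
    also have "\<dots> \<le> (3 * F + 1) * M / sqrt (real k)" using F_pos M0 sk by (simp add: d_def field_simps)
    finally show ?thesis .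
  next
    case False
    define x0 where "x0 = (if x > 0 then d else -d)"
    have x0: "x0 \<in> {-pi..pi}" "\<bar>x0\<bar> = d" using False x d0 by (auto simp: x0_def)
    have "cmod (Pr x - Pr x0) \<le> 3 * F * M / (real k * d)"
    proof (cases "x > 0")
      case True
      show ?thesis
        by (rule osc_far[OF k _ _ _ d0 _ w M Pr]) (use True False x d0 in \<open>auto simp: x0_def\<close>)
    next
      case F: False
      have "cmod (Pr x0 - Pr x) \<le> 3 * F * M / (real k * d)"
        by (rule osc_far[OF k _ _ _ d0 _ w M Pr]) (use F False x d0 in \<open>auto simp: x0_def\<close>)
      then show ?thesis by (simp add: norm_minus_commute)
    qed
    moreover have "cmod (Pr x0 - Pr 0) \<le> M * d" using lip[of x0 0] x0 by simp
    ultimately have "cmod (Pr x - Pr 0) \<le> 3 * F * M / (real k * d) + M * d"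
      using norm_triangle_ineq[of "Pr x - Pr x0" "Pr x0 - Pr 0"] by simp
    also have "\<dots> = (3 * F + 1) * M / sqrt (real k)"
      unfolding kd by (simp add: d_def add_divide_distrib algebra_simps)
    finally show ?thesis .
  qed
  have "cmod (Pr b - Pr a) \<le> cmod (Pr b - Pr 0) + cmod (Pr a - Pr 0)"
    using norm_triangle_ineq4[of "Pr b - Pr 0" "Pr a - Pr 0"] by simp
  also have "\<dots> \<le> (3 * F + 1) * M / sqrt (real k) + (3 * F + 1) * M / sqrt (real k)"
    by (intro add_mono z ab)
  finally show ?thesis by (simp add: field_simps)
qed

end

section \<open>Gauge transformations of the recursion\<close>

text \<open>The quadratic term survives by completing a square. From A + Q' = Q + J one gets |A|^2/2
  + Re (Q' cnj A) + |Q'|^2/2 = |Q|^2/2 + Re (J cnj Q) + |J|^2/2, so the real part of the new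
  diagonal is |J|^2/2 plus a difference of squares that telescopes in n. The imaginary part
  \<open>c\<close> does not affect the modulus to first order.\<close>

lemma gauge_step:
  fixes y y' A Q Q' J \<epsilon> :: complex and c \<delta> :: real
  assumes y': "y' = (1 + of_real ((cmod A)\<^sup>2 / 2 + \<delta>) + \<i> * of_real c) * y + A * cnj y + \<epsilon>"
    and A: "A = Q - Q' + J"
  defines "w \<equiv> y + Q * cnj y" and "w' \<equiv> y' + Q' * cnj y'"
    and "\<delta>' \<equiv> \<delta> + ((cmod Q)\<^sup>2 - (cmod Q')\<^sup>2) / 2"
    and "c' \<equiv> c + Im (Q' * cnj A - J * cnj Q)"
  shows "w' = (1 + of_real ((cmod J)\<^sup>2 / 2 + \<delta>') + \<i> * of_real c') * w + J * cnj w +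
     ((J * of_real ((cmod Q)\<^sup>2) - Q * (of_real ((cmod A)\<^sup>2 / 2 + \<delta>) + Q' * cnj A + \<i> * of_real c)
       + Q' * (of_real ((cmod A)\<^sup>2 / 2 + \<delta>) - \<i> * of_real c)) * cnj y + \<epsilon> + Q' * cnj \<epsilon>)"
proof -
  define B where "B = of_real ((cmod A)\<^sup>2 / 2 + \<delta>) + Q' * cnj A + \<i> * of_real c"
  have sq: "complex_of_real ((cmod z)\<^sup>2) = z * cnj z" for z
    by (metis complex_norm_square of_real_power)
  \<comment> \<open>\<open>B\<close> is the diagonal before rewriting in terms of \<open>w\<close>;
    replacing \<open>J * cnj y\<close> by \<open>J * cnj w\<close> subtracts
    \<open>J * cnj Q\<close>.\<close>
  have BJ: "B - J * cnj Q = of_real ((cmod J)\<^sup>2 / 2 + \<delta>') + \<i> * of_real c'"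
  proof (rule complex_eqI)
    show "Re (B - J * cnj Q) = Re (of_real ((cmod J)\<^sup>2 / 2 + \<delta>') + \<i> * of_real c')"
      unfolding B_def \<delta>'_def A cmod_power2 by (simp add: power2_eq_square field_simps)
    show "Im (B - J * cnj Q) = Im (of_real ((cmod J)\<^sup>2 / 2 + \<delta>') + \<i> * of_real c')"
      unfolding B_def c'_def by (simp add: field_simps)
  qed
  have "w' = w + J * cnj y + B * y + Q' * (of_real ((cmod A)\<^sup>2 / 2 + \<delta>) - \<i> * of_real c) * cnj y + \<epsilon> + Q' * cnj \<epsilon>"
    unfolding w'_def w_def y' B_def by (simp add: A algebra_simps)
  also have "J * cnj y = J * cnj w - J * cnj Q * w + J * of_real ((cmod Q)\<^sup>2) * cnj y"
    unfolding w_def sq by (simp add: algebra_simps)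
  also have "B * y = B * w - B * Q * cnj y" unfolding w_def by (simp add: algebra_simps)
  finally have "w' = (1 + (B - J * cnj Q)) * w + J * cnj w + ((J * of_real ((cmod Q)\<^sup>2) - Q * B
       + Q' * (of_real ((cmod A)\<^sup>2 / 2 + \<delta>) - \<i> * of_real c)) * cnj y + \<epsilon> + Q' * cnj \<epsilon>)"
    by (simp add: algebra_simps)
  then show ?thesis unfolding BJ unfolding B_def by (simp add: add.assoc)
qed

text \<open>As |Q| <= 1/2, |y| is at most 2 |w|, so errors relative to y become errors relative to
  w. Apart from the old error, every remainder is cubic in the small quantities when
  \<open>\<delta>\<close> and \<open>c\<close> count as quadratic.\<close>

lemma gauge_step_bound:
  fixes y A Q Q' J \<epsilon> :: complex and c \<delta> q e :: real
  assumes "cmod Q \<le> q" "cmod Q' \<le> q" "q \<le> 1/2" "cmod \<epsilon> \<le> e * cmod y"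
  shows "cmod ((J * of_real ((cmod Q)\<^sup>2) - Q * (of_real ((cmod A)\<^sup>2 / 2 + \<delta>) + Q' * cnj A + \<i> * of_real c)
       + Q' * (of_real ((cmod A)\<^sup>2 / 2 + \<delta>) - \<i> * of_real c)) * cnj y + \<epsilon> + Q' * cnj \<epsilon>)
    \<le> (2 * (q\<^sup>2 * cmod J + q * (cmod A)\<^sup>2 + 2 * q * \<bar>\<delta>\<bar> + q\<^sup>2 * cmod A + 2 * q * \<bar>c\<bar>) + 3 * e) * cmod (y + Q * cnj y)"
proof -
  have q0: "0 \<le> q" using assms(1) norm_ge_zero order_trans by blast
  have yw: "cmod y \<le> 2 * cmod (y + Q * cnj y)"
  proof -
    have "cmod (Q * cnj y) \<le> 1/2 * cmod y"
      unfolding norm_mult complex_mod_cnj using assms(1,3) by (intro mult_right_mono) auto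
    moreover have "cmod y \<le> cmod (y + Q * cnj y) + cmod (Q * cnj y)"
      by (metis add_diff_cancel_right' norm_triangle_ineq4)
    ultimately show ?thesis by linarith
  qed
  define X where "X = q\<^sup>2 * cmod J + q * (cmod A)\<^sup>2 + 2 * q * \<bar>\<delta>\<bar> + q\<^sup>2 * cmod A + 2 * q * \<bar>c\<bar>"
  have a1: "cmod (of_real ((cmod A)\<^sup>2 / 2 + \<delta>) :: complex) \<le> (cmod A)\<^sup>2 / 2 + \<bar>\<delta>\<bar>"
    unfolding norm_of_real by (rule order_trans[OF abs_triangle_ineq]) simp
  have c1: "cmod (\<i> * of_real c) = \<bar>c\<bar>" by (simp add: norm_mult)
  have n1: "cmod (J * of_real ((cmod Q)\<^sup>2)) \<le> q\<^sup>2 * cmod J"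
    using assms(1) by (simp add: norm_mult norm_power mult.commute mult_left_mono power_mono)
  have qa: "cmod (Q' * cnj A) \<le> q * cmod A"
    using assms(2) by (simp add: norm_mult mult_right_mono)
  have n2: "cmod (Q * (of_real ((cmod A)\<^sup>2 / 2 + \<delta>) + Q' * cnj A + \<i> * of_real c)) \<le> q * ((cmod A)\<^sup>2 / 2 + \<bar>\<delta>\<bar> + q * cmod A + \<bar>c\<bar>)"
    unfolding norm_mult[of Q]
    by (intro mult_mono assms q0 norm_ge_zero order_trans[OF norm_triangle_ineq] add_mono a1 qa)
       (simp add: c1)
  have n3: "cmod (Q' * (of_real ((cmod A)\<^sup>2 / 2 + \<delta>) - \<i> * of_real c)) \<le> q * ((cmod A)\<^sup>2 / 2 + \<bar>\<delta>\<bar> + \<bar>c\<bar>)"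
    unfolding norm_mult[of Q']
    by (intro mult_mono assms q0 norm_ge_zero order_trans[OF norm_triangle_ineq4] add_mono a1)
       (simp add: c1)
  have n4: "cmod (\<epsilon> + Q' * cnj \<epsilon>) \<le> 3/2 * (e * cmod y)"
  proof -
    have "cmod (Q' * cnj \<epsilon>) \<le> 1/2 * cmod \<epsilon>"
      unfolding norm_mult complex_mod_cnj using assms(2,3) by (intro mult_right_mono) auto
    then have "cmod (\<epsilon> + Q' * cnj \<epsilon>) \<le> 3/2 * cmod \<epsilon>" 
      using norm_triangle_ineq[of \<epsilon> "Q' * cnj \<epsilon>"] by linarith
    then show ?thesis using assms(4) by linarith
  qed
  have n5: "cmod (J * of_real ((cmod Q)\<^sup>2) - Q * (of_real ((cmod A)\<^sup>2 / 2 + \<delta>) + Q' * cnj A + \<i> * of_real c)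
       + Q' * (of_real ((cmod A)\<^sup>2 / 2 + \<delta>) - \<i> * of_real c)) \<le> X"
    (is "cmod (?a - ?b + ?d) \<le> _")
  proof -
    have "cmod (?a - ?b + ?d) \<le> cmod ?a + cmod ?b + cmod ?d"
      using norm_triangle_ineq[of "?a - ?b" ?d] norm_triangle_ineq4[of ?a ?b] by linarith
    also have "\<dots> \<le> X" using n1 n2 n3 unfolding X_def by (simp add: algebra_simps power2_eq_square)
    finally show ?thesis .
  qed
  have X0: "0 \<le> X" unfolding X_def using q0 by simp
  have "cmod ((J * of_real ((cmod Q)\<^sup>2) - Q * (of_real ((cmod A)\<^sup>2 / 2 + \<delta>) + Q' * cnj A + \<i> * of_real c)
       + Q' * (of_real ((cmod A)\<^sup>2 / 2 + \<delta>) - \<i> * of_real c)) * cnj y + (\<epsilon> + Q' * cnj \<epsilon>))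
     \<le> X * cmod y + 3/2 * (e * cmod y)"
    apply (rule order_trans[OF norm_triangle_ineq])
    apply (rule add_mono)
    unfolding norm_mult complex_mod_cnj
     apply (rule mult_right_mono)
    using n5 apply (simp add: norm_mult)
     apply simp
    using n4 by (simp add: norm_mult)
  also have "\<dots> = (X + 3/2 * e) * cmod y" by (simp add: algebra_simps)
  also have "\<dots> \<le> (X + 3/2 * e) * (2 * cmod (y + Q * cnj y))"
  proof (cases "y = 0")
    case False
    have "0 \<le> e * cmod y" using assms(4) norm_ge_zero[of \<epsilon>] by linarith
    then have "0 \<le> e" using False by (simp add: zero_le_mult_iff)
    then show ?thesis using yw X0 by (intro mult_left_mono) auto
  qed simp
  finally show ?thesis unfolding X_def by (simp add: algebra_simps)
qed

text \<open>Since ln |1 + W| = Re (ln (1 + W)), the increment of the logarithm differs from Re W by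
  at most 2 |W|^2. Hence \<open>c\<close> enters only through its square, and the sum of
  \<open>\<Delta>\<close> may converge conditionally.\<close>

lemma ln_norm_convergent:
  fixes z \<epsilon> :: "nat \<Rightarrow> complex" and \<Delta> c e :: "nat \<Rightarrow> real"
  assumes step: "\<And>n. z (Suc n) = (1 + of_real (\<Delta> n) + \<i> * of_real (c n)) * z n + \<epsilon> n"
    and eps: "\<And>n. cmod (\<epsilon> n) \<le> e n * cmod (z n)"
    and sum: "summable e" "summable \<Delta>" "summable (\<lambda>n. (\<Delta> n)\<^sup>2)" "summable (\<lambda>n. (c n)\<^sup>2)"
    and nz: "\<And>n. z n \<noteq> 0"
  shows "convergent (\<lambda>n. ln (cmod (z n)))"
proof -
  define \<eta> where "\<eta> n = \<epsilon> n / z n" for n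
  define W where "W n = of_real (\<Delta> n) + \<i> * of_real (c n) + \<eta> n" for n
  have zW: "z (Suc n) = (1 + W n) * z n" for n
    using nz[of n] step[of n] by (simp add: W_def \<eta>_def field_simps)
  have eta: "cmod (\<eta> n) \<le> e n" for n
    using eps[of n] nz[of n] by (simp add: \<eta>_def norm_divide divide_le_eq)
  have e0: "e \<longlonglongrightarrow> 0" "\<Delta> \<longlonglongrightarrow> 0" "(\<lambda>n. (c n)\<^sup>2) \<longlonglongrightarrow> 0"
    by (fact sum[THEN summable_LIMSEQ_zero])+
  have e_nn: "0 \<le> e n" for n using eta[of n] norm_ge_zero order_trans by blast
  have c0: "c \<longlonglongrightarrow> 0" 
  proof -
    have "(\<lambda>n. sqrt ((c n)\<^sup>2)) \<longlonglongrightarrow> sqrt 0" by (intro tendsto_real_sqrt e0)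
    then show ?thesis by (simp add: tendsto_rabs_zero_iff)
  qed
  have eta0: "\<eta> \<longlonglongrightarrow> 0" by (rule Lim_null_comparison[OF _ e0(1)]) (use eta in auto)
  have W0: "W \<longlonglongrightarrow> 0"
    unfolding W_def using tendsto_add[OF tendsto_add[OF tendsto_of_real[OF e0(2)] tendsto_mult_right[OF tendsto_of_real[OF c0], of \<i>]] eta0] by (simp add: mult.commute)
  then have "eventually (\<lambda>n. cmod (W n) < 1/2) sequentially"
    using tendstoD[OF W0, of "1/2"] by simp
  moreover have "eventually (\<lambda>n. e n < 1) sequentially" using e0(1) by (simp add: order_tendstoD)
  ultimately have "eventually (\<lambda>n. cmod (W n) < 1/2 \<and> e n < 1) sequentially"
    by (rule eventually_conj)
  then obtain N where N: "\<And>n. n \<ge> N \<Longrightarrow> cmod (W n) < 1/2 \<and> e n < 1"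
    unfolding eventually_sequentially by blast
  define d where "d n = ln (cmod (z (Suc n))) - ln (cmod (z n))" for n
  have W1: "1 + W n \<noteq> 0" for n using zW[of n] nz[of "Suc n"] by auto
  have dW: "d n = ln (cmod (1 + W n))" for n
    using zW[of n] nz[of n] W1[of n] by (simp add: d_def norm_mult ln_mult)
  have "summable (\<lambda>n. d n - \<Delta> n)"
  proof (rule summable_comparison_test)
    show "summable (\<lambda>n. 7 * e n + 6 * (\<Delta> n)\<^sup>2 + 6 * (c n)\<^sup>2)"
      by (intro summable_add summable_mult sum)
    show "\<exists>N. \<forall>n\<ge>N. norm (d n - \<Delta> n) \<le> 7 * e n + 6 * (\<Delta> n)\<^sup>2 + 6 * (c n)\<^sup>2"
    proof (intro exI allI impI)
      fix n assume n: "N \<le> n"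
      have w: "cmod (W n) < 1/2" "e n < 1" using N n by auto
      have "cmod (ln (1 + W n) - W n) \<le> (cmod (W n))\<^sup>2 / (1 - cmod (W n))"
        using w by (intro Ln_approx_linear) auto
      also have "\<dots> \<le> 2 * (cmod (W n))\<^sup>2"
      proof -
        have "(cmod (W n))\<^sup>2 / (1 - cmod (W n)) \<le> (cmod (W n))\<^sup>2 / (1/2)"
          using w by (intro divide_left_mono) auto
        then show ?thesis by simp
      qed
      finally have L: "\<bar>Re (ln (1 + W n) - W n)\<bar> \<le> 2 * (cmod (W n))\<^sup>2"
        using abs_Re_le_cmod order_trans by blast
      have "Re (ln (1 + W n)) = d n" using W1 dW by (simp add: Re_Ln)
      moreover have "Re (W n) = \<Delta> n + Re (\<eta> n)" by (simp add: W_def)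
      ultimately have 1: "\<bar>d n - \<Delta> n\<bar> \<le> 2 * (cmod (W n))\<^sup>2 + e n"
        using L abs_Re_le_cmod[of "\<eta> n"] eta[of n] by simp
      have "cmod (W n) \<le> \<bar>\<Delta> n\<bar> + \<bar>c n\<bar> + e n"
        unfolding W_def using eta[of n]
        by (intro order_trans[OF norm_triangle_ineq] add_mono order_trans[OF norm_triangle_ineq])
           (auto simp: norm_mult)
      then have "(cmod (W n))\<^sup>2 \<le> (\<bar>\<Delta> n\<bar> + \<bar>c n\<bar> + e n)\<^sup>2" by (intro power_mono) auto
      also have "\<dots> \<le> 3 * ((\<Delta> n)\<^sup>2 + (c n)\<^sup>2 + (e n)\<^sup>2)"
      proof -
        have "0 \<le> (\<bar>\<Delta> n\<bar> - \<bar>c n\<bar>)\<^sup>2 + (\<bar>\<Delta> n\<bar> - e n)\<^sup>2 + (\<bar>c n\<bar> - e n)\<^sup>2" by simp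
        then show ?thesis by (simp add: power2_eq_square algebra_simps)
      qed
      also have "(e n)\<^sup>2 \<le> e n" using w e_nn[of n] by (simp add: power2_eq_square mult_left_le)
      finally show "norm (d n - \<Delta> n) \<le> 7 * e n + 6 * (\<Delta> n)\<^sup>2 + 6 * (c n)\<^sup>2"
        using 1 by simp
    qed
  qed
  then have "summable (\<lambda>n. (d n - \<Delta> n) + \<Delta> n)" by (rule summable_add[OF _ sum(2)])
  then have "summable d" by simp
  then have "convergent (\<lambda>n. \<Sum>i<n. d i)" by (simp add: summable_iff_convergent)
  moreover have "(\<Sum>i<n. d i) = ln (cmod (z n)) - ln (cmod (z 0))" for n
    by (induction n) (auto simp: d_def)
  ultimately have "convergent (\<lambda>n. ln (cmod (z n)) - ln (cmod (z 0)))" by simp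
  from convergent_add[OF this convergent_const, of "ln (cmod (z 0))"] show ?thesis by simp
qed


text \<open>Two substitutions are made: the first one, with Q, leaves the coefficients J, which need not be summable in
  square; the second one, with P, removes J.\<close>

theorem gauge_convergence:
  fixes y A Q J P \<epsilon> :: "nat \<Rightarrow> complex" and q r s e :: "nat \<Rightarrow> real"
  assumes step: "\<And>n. y (Suc n) = (1 + of_real ((cmod (A n))\<^sup>2 / 2)) * y n + A n * cnj (y n) + \<epsilon> n"
    and eps: "\<And>n. cmod (\<epsilon> n) \<le> e n * cmod (y n)"
    and A: "\<And>n. A n = Q n - Q (Suc n) + J n" and J: "\<And>n. J n = P n - P (Suc n)"
    and q: "\<And>n. cmod (Q n) \<le> q n" "\<And>n. cmod (Q (Suc n)) \<le> q n" "\<And>n. q n \<le> 1/2"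
    and r: "\<And>n. cmod (P n) \<le> r n" "\<And>n. cmod (P (Suc n)) \<le> r n" "\<And>n. r n \<le> 1/2"
    and lim: "Q \<longlonglongrightarrow> 0" "P \<longlonglongrightarrow> 0"
    and s: "\<And>n. (q n)\<^sup>2 * cmod (A n) \<le> s n" "\<And>n. q n * (cmod (A n))\<^sup>2 \<le> s n"
      "\<And>n. (q n)\<^sup>2 * cmod (J n) \<le> s n" "\<And>n. r n * (cmod (J n))\<^sup>2 \<le> s n"
      "\<And>n. (r n)\<^sup>2 * cmod (J n) \<le> s n" "\<And>n. r n * q n * cmod (A n) \<le> s n"
      "\<And>n. r n * q n * cmod (J n) \<le> s n" "\<And>n. e n \<le> s n"
    and sum: "summable s"
    and nz: "\<And>n. y n \<noteq> 0"
  shows "convergent (\<lambda>n. ln (cmod (y n)))"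
proof -
  define w where "w n = y n + Q n * cnj (y n)" for n
  define \<delta> where "\<delta> n = ((cmod (Q n))\<^sup>2 - (cmod (Q (Suc n)))\<^sup>2) / 2" for n
  define c where "c n = Im (Q (Suc n) * cnj (A n) - J n * cnj (Q n))" for n
  define \<epsilon>1 where "\<epsilon>1 n = (J n * of_real ((cmod (Q n))\<^sup>2) - Q n * (of_real ((cmod (A n))\<^sup>2 / 2 + 0) + Q (Suc n) * cnj (A n) + \<i> * of_real 0)
       + Q (Suc n) * (of_real ((cmod (A n))\<^sup>2 / 2 + 0) - \<i> * of_real 0)) * cnj (y n) + \<epsilon> n + Q (Suc n) * cnj (\<epsilon> n)" for n
  have q0: "0 \<le> q n" for n using q(1) norm_ge_zero order_trans by blast
  have r0: "0 \<le> r n" for n using r(1) norm_ge_zero order_trans by blast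
  have s0: "0 \<le> s n" for n
    by (rule order_trans[OF _ s(1)]) simp
  have w_step: "w (Suc n) = (1 + of_real ((cmod (J n))\<^sup>2 / 2 + \<delta> n) + \<i> * of_real (c n)) * w n + J n * cnj (w n) + \<epsilon>1 n" for n
    using gauge_step[of "y (Suc n)" "A n" 0 0 "y n" "\<epsilon> n" "Q n" "Q (Suc n)" "J n"] step[of n] A[of n]
    by (simp add: w_def \<delta>_def c_def \<epsilon>1_def)
  have w_eps: "cmod (\<epsilon>1 n) \<le> 9 * s n * cmod (w n)" for n
  proof -
    have "cmod (\<epsilon>1 n) \<le> (2 * ((q n)\<^sup>2 * cmod (J n) + q n * (cmod (A n))\<^sup>2 + 2 * q n * \<bar>0\<bar> + (q n)\<^sup>2 * cmod (A n) + 2 * q n * \<bar>0\<bar>) + 3 * e n) * cmod (w n)"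
      unfolding \<epsilon>1_def w_def by (rule gauge_step_bound[OF q(1,2,3) eps])
    also have "\<dots> \<le> 9 * s n * cmod (w n)"
      using s(1,2,3,8)[of n] by (intro mult_right_mono) auto
    finally show ?thesis .
  qed
  define z where "z n = w n + P n * cnj (w n)" for n
  define \<delta>2 where "\<delta>2 n = \<delta> n + ((cmod (P n))\<^sup>2 - (cmod (P (Suc n)))\<^sup>2) / 2" for n
  define c2 where "c2 n = c n + Im (P (Suc n) * cnj (J n) - 0 * cnj (P n))" for n
  define \<epsilon>2 where "\<epsilon>2 n = (0 * of_real ((cmod (P n))\<^sup>2) - P n * (of_real ((cmod (J n))\<^sup>2 / 2 + \<delta> n) + P (Suc n) * cnj (J n) + \<i> * of_real (c n))
       + P (Suc n) * (of_real ((cmod (J n))\<^sup>2 / 2 + \<delta> n) - \<i> * of_real (c n))) * cnj (w n) + \<epsilon>1 n + P (Suc n) * cnj (\<epsilon>1 n)" for n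
  have z_step: "z (Suc n) = (1 + of_real (\<delta>2 n) + \<i> * of_real (c2 n)) * z n + \<epsilon>2 n" for n
    using gauge_step[of "w (Suc n)" "J n" "\<delta> n" "c n" "w n" "\<epsilon>1 n" "P n" "P (Suc n)" 0] w_step[of n] J[of n]
    by (simp add: z_def \<delta>2_def c2_def \<epsilon>2_def)
  have QQ: "cmod (Q n - Q (Suc n)) \<le> cmod (A n) + cmod (J n)" for n
    using A[of n] norm_triangle_ineq4[of "A n" "J n"] by simp
  have sqd: "\<bar>((cmod u)\<^sup>2 - (cmod v)\<^sup>2) / 2\<bar> \<le> t * cmod (u - v)" if "cmod u \<le> t" "cmod v \<le> t" for u v :: complex and t
  proof -
    have "\<bar>((cmod u)\<^sup>2 - (cmod v)\<^sup>2) / 2\<bar> = \<bar>cmod u - cmod v\<bar> * ((cmod u + cmod v) / 2)"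
      by (simp add: power2_eq_square square_diff_square_factored abs_mult)
    also have "\<dots> \<le> cmod (u - v) * t"
      using that by (intro mult_mono norm_triangle_ineq3) auto
    finally show ?thesis by (simp add: mult.commute)
  qed
  have d_bd: "\<bar>\<delta> n\<bar> \<le> q n * (cmod (A n) + cmod (J n))" for n
    unfolding \<delta>_def using sqd[OF q(1)[of n] q(2)[of n]] mult_left_mono[OF QQ[of n] q0[of n]] by linarith
  have c_bd: "\<bar>c n\<bar> \<le> q n * (cmod (A n) + cmod (J n))" for n
  proof -
    have "\<bar>c n\<bar> \<le> cmod (Q (Suc n) * cnj (A n)) + cmod (J n * cnj (Q n))"
      unfolding c_def by (intro order_trans[OF abs_Im_le_cmod] norm_triangle_ineq4)
    also have "\<dots> \<le> q n * cmod (A n) + q n * cmod (J n)"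
      using q(1,2)[of n] by (simp add: norm_mult mult_right_mono add_mono mult.commute[of "cmod (J n)"])
    finally show ?thesis by (simp add: algebra_simps)
  qed
  have P_bd: "\<bar>((cmod (P n))\<^sup>2 - (cmod (P (Suc n)))\<^sup>2) / 2\<bar> \<le> r n * cmod (J n)" for n
    using sqd[OF r(1)[of n] r(2)[of n]] J[of n] by simp
  have d2_bd: "\<bar>\<delta>2 n\<bar> \<le> q n * (cmod (A n) + cmod (J n)) + r n * cmod (J n)" for n
    unfolding \<delta>2_def using d_bd[of n] P_bd[of n] by linarith
  have c2_bd: "\<bar>c2 n\<bar> \<le> q n * (cmod (A n) + cmod (J n)) + r n * cmod (J n)" for n
  proof -
    have "\<bar>Im (P (Suc n) * cnj (J n))\<bar> \<le> r n * cmod (J n)"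
      using r(2)[of n] by (intro order_trans[OF abs_Im_le_cmod]) (simp add: norm_mult mult_right_mono)
    then show ?thesis unfolding c2_def using c_bd[of n] by simp
  qed
  have J1: "cmod (J n) \<le> 1" for n
    using norm_triangle_ineq4[of "P n" "P (Suc n)"] r(1,2,3)[of n] J[of n] by simp
  have z_eps: "cmod (\<epsilon>2 n) \<le> 50 * s n * cmod (z n)" for n
  proof -
    have "cmod (\<epsilon>2 n) \<le> (2 * ((r n)\<^sup>2 * cmod 0 + r n * (cmod (J n))\<^sup>2 + 2 * r n * \<bar>\<delta> n\<bar> + (r n)\<^sup>2 * cmod (J n) + 2 * r n * \<bar>c n\<bar>) + 3 * (9 * s n)) * cmod (z n)"
      unfolding \<epsilon>2_def z_def by (rule gauge_step_bound[OF r(1,2,3) w_eps])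
    also have "\<dots> \<le> 50 * s n * cmod (z n)"
    proof (rule mult_right_mono)
      have "r n * \<bar>\<delta> n\<bar> \<le> 2 * s n" "r n * \<bar>c n\<bar> \<le> 2 * s n"
        using mult_left_mono[OF d_bd[of n] r0[of n]] mult_left_mono[OF c_bd[of n] r0[of n]] s(6,7)[of n]
        by (simp_all add: algebra_simps)
      then show "2 * ((r n)\<^sup>2 * cmod 0 + r n * (cmod (J n))\<^sup>2 + 2 * r n * \<bar>\<delta> n\<bar> + (r n)\<^sup>2 * cmod (J n) + 2 * r n * \<bar>c n\<bar>) + 3 * (9 * s n) \<le> 50 * s n"
        using s(4,5)[of n] s0[of n] by (simp add: mult.assoc)
    qed simp
    finally show ?thesis .
  qed
  \<comment> \<open>\<open>\<delta>2 n\<close> is \<open>D n - D (Suc n)\<close>; it is summable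
    through cancellation, not through its size.\<close>
  define D where "D n = (cmod (Q n))\<^sup>2 / 2 + (cmod (P n))\<^sup>2 / 2" for n
  have "D \<longlonglongrightarrow> 0"
    unfolding D_def using lim by (auto intro!: tendsto_eq_intros)
  then have "summable (\<lambda>n. - (D (Suc n) - D n))"
    by (intro summable_minus) (rule telescope_summable)
  then have sum_d: "summable \<delta>2"
    by (rule back_subst[of summable]) (auto simp: fun_eq_iff \<delta>2_def \<delta>_def D_def field_simps)
  \<comment> \<open>The quantities \<open>\<delta>2\<close> and \<open>c2\<close> are of second
    order. Their squares are of fourth order and fall below the cubic bound
    \<open>s\<close>.\<close>
  have sq_le: "x\<^sup>2 \<le> 12 * s n" if x: "\<bar>x\<bar> \<le> q n * (cmod (A n) + cmod (J n)) + r n * cmod (J n)" for x n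
  proof -
    have "x\<^sup>2 \<le> (q n * cmod (A n) + q n * cmod (J n) + r n * cmod (J n))\<^sup>2"
      using x power_mono[of "\<bar>x\<bar>" _ 2] by (simp add: algebra_simps)
    also have "\<dots> \<le> 3 * ((q n * cmod (A n))\<^sup>2 + (q n * cmod (J n))\<^sup>2 + (r n * cmod (J n))\<^sup>2)"
    proof -
      have "(a + b + d)\<^sup>2 \<le> 3 * (a\<^sup>2 + b\<^sup>2 + d\<^sup>2)" for a b d :: real
      proof -
        have "0 \<le> (a - b)\<^sup>2 + (a - d)\<^sup>2 + (b - d)\<^sup>2" by simp
        then show ?thesis by (simp add: power2_eq_square algebra_simps)
      qed
      then show ?thesis .
    qed
    also have "(q n * cmod (A n))\<^sup>2 \<le> q n * (cmod (A n))\<^sup>2"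
      unfolding power_mult_distrib using q0[of n] q(3)[of n]
      by (intro mult_right_mono) (auto simp: power2_eq_square mult_left_le)
    also have "(q n * cmod (J n))\<^sup>2 \<le> (q n)\<^sup>2 * cmod (J n)"
      unfolding power_mult_distrib using J1[of n]
      by (intro mult_left_mono) (auto simp: power2_eq_square mult_left_le)
    also have "(r n * cmod (J n))\<^sup>2 \<le> (r n)\<^sup>2 * cmod (J n)"
      unfolding power_mult_distrib using J1[of n]
      by (intro mult_left_mono) (auto simp: power2_eq_square mult_left_le)
    finally show ?thesis using s(2,3,5)[of n] s0[of n] by simp
  qed
  have sq_sum: "summable (\<lambda>n. (x n)\<^sup>2)" if "\<And>n. \<bar>x n\<bar> \<le> q n * (cmod (A n) + cmod (J n)) + r n * cmod (J n)" for x
    by (rule summable_comparison_test[OF _ summable_mult[OF sum, of 12]]) (use sq_le[OF that] in auto)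
  have norm_gauge: "cmod u * (1 - t) \<le> cmod (u + X * cnj u) \<and> cmod (u + X * cnj u) \<le> cmod u * (1 + t)" if "cmod X \<le> t" for u X t
  proof -
    have "cmod (X * cnj u) \<le> t * cmod u" using that by (simp add: norm_mult mult_right_mono)
    then show ?thesis
      using norm_triangle_ineq[of u "X * cnj u"] norm_diff_ineq[of u "X * cnj u"] by (auto simp: algebra_simps)
  qed
  have w_nz: "w n \<noteq> 0" for n
    using norm_gauge[OF q(1)[of n], of "y n"] q(3)[of n] nz[of n]
    by (auto simp: w_def mult_le_0_iff)
  have z_nz: "z n \<noteq> 0" for n
    using norm_gauge[OF r(1)[of n], of "w n"] r(3)[of n] w_nz[of n]
    by (auto simp: z_def mult_le_0_iff)
  have conv: "convergent (\<lambda>n. ln (cmod (z n)))"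
    by (rule ln_norm_convergent[where z = z and \<epsilon> = \<epsilon>2 and \<Delta> = \<delta>2 and c = c2 and e = "\<lambda>n. 50 * s n", OF z_step z_eps
          summable_mult[OF sum] sum_d sq_sum[OF d2_bd] sq_sum[OF c2_bd] z_nz])
  have ratio: "(\<lambda>n. ln (cmod (u n + X n * cnj (u n))) - ln (cmod (u n))) \<longlonglongrightarrow> 0"
    if "X \<longlonglongrightarrow> 0" "\<And>n. u n \<noteq> 0" "\<And>n. u n + X n * cnj (u n) \<noteq> 0" for X u :: "nat \<Rightarrow> complex"
  proof -
    have "(\<lambda>n. X n * (cnj (u n) / u n)) \<longlonglongrightarrow> 0"
      by (rule Lim_null_comparison[OF _ tendsto_norm_zero[OF that(1)]])
         (use that(2) in \<open>auto simp: norm_mult norm_divide\<close>)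
    then have "(\<lambda>n. ln (cmod (1 + X n * (cnj (u n) / u n)))) \<longlonglongrightarrow> ln (cmod (1 + 0))"
      by (intro tendsto_ln tendsto_norm tendsto_add tendsto_const) auto
    moreover have "ln (cmod (1 + X n * (cnj (u n) / u n))) = ln (cmod (u n + X n * cnj (u n))) - ln (cmod (u n))" for n
    proof -
      have "1 + X n * (cnj (u n) / u n) = (u n + X n * cnj (u n)) / u n"
        using that(2)[of n] by (simp add: field_simps)
      then show ?thesis using that(2,3)[of n] by (simp add: norm_divide ln_div)
    qed
    ultimately show ?thesis by simp
  qed
  have "(\<lambda>n. ln (cmod (z n)) - ln (cmod (w n))) \<longlonglongrightarrow> 0"
    using ratio[OF lim(2) w_nz z_nz[unfolded z_def]] by (simp only: z_def)
  then have cz: "convergent (\<lambda>n. ln (cmod (z n)) - ln (cmod (w n)))" by (rule convergentI)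
  have "(\<lambda>n. ln (cmod (w n)) - ln (cmod (y n))) \<longlonglongrightarrow> 0"
    using ratio[OF lim(1) nz w_nz[unfolded w_def]] by (simp only: w_def)
  then have cw: "convergent (\<lambda>n. ln (cmod (w n)) - ln (cmod (y n)))" by (rule convergentI)
  have "convergent (\<lambda>n. ln (cmod (z n)) - (ln (cmod (z n)) - ln (cmod (w n))) - (ln (cmod (w n)) - ln (cmod (y n))))"
    by (rule convergent_diff[OF convergent_diff[OF conv cz] cw])
  moreover have "ln (cmod (z n)) - (ln (cmod (z n)) - ln (cmod (w n))) - (ln (cmod (w n)) - ln (cmod (y n)))
     = ln (cmod (y n))" for n by linarith
  ultimately show ?thesis by (simp only:)
qed

section \<open>Resonance integrals with slowly varying amplitudes\<close>

context osc
begin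

lemma shift_bounds:
  assumes "2 \<le> k" "\<bar>r\<bar> \<le> pi"
  shows "real k \<le> pi * real k + r" "0 < pi * real k + r"
proof -
  have "pi * 2 \<le> pi * real k" using assms by (intro mult_left_mono) auto
  moreover have "3 * real k \<le> pi * real k" using pi_gt3 by (intro mult_right_mono) auto
  ultimately show "real k \<le> pi * real k + r" using assms by linarith
  then show "0 < pi * real k + r" using assms by linarith
qed

lemma weight_derivative:
  assumes f: "f holomorphic_on kapU" and k: "2 \<le> k" and r: "\<bar>r\<bar> \<le> pi"
  shows "((\<lambda>r. f (of_real r) / of_real (pi * real k + r) ^ j) has_vector_derivative
      (deriv f (of_real r) / of_real (pi * real k + r) ^ j - of_nat j * f (of_real r) / of_real (pi * real k + r) ^ Suc j)) (at r within A)"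
proof -
  have p: "0 < pi * real k + r" by (rule shift_bounds[OF k r])
  have "((\<lambda>r. inverse ((pi * real k + r) ^ j)) has_real_derivative - (real j / (pi * real k + r) ^ Suc j)) (at r within A)"
  proof (cases j)
    case (Suc n)
    have "((\<lambda>r. (pi * real k + r) ^ Suc n) has_real_derivative (real (Suc n) * (pi * real k + r) ^ n)) (at r within A)"
      by (rule DERIV_cong[OF DERIV_power[where D = 1]]) (auto intro!: derivative_eq_intros)
    moreover have "(pi * real k + r) ^ Suc n \<noteq> 0" using p by simp
    ultimately show ?thesis
      unfolding Suc by (rule DERIV_cong[OF DERIV_inverse_fun]) (use p in \<open>simp add: divide_simps del: of_nat_Suc\<close>)
  qed simp
  then have "((\<lambda>r. complex_of_real (inverse ((pi * real k + r) ^ j))) has_vector_derivative of_real (- (real j / (pi * real k + r) ^ Suc j))) (at r within A)"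
    by (rule has_vector_derivative_of_real)
  from has_vector_derivative_mult[OF holomorphic_has_vector_derivative[OF f r, of A] this]
  show ?thesis by (simp add: divide_inverse algebra_simps del: power_Suc)
qed

lemma weight_bounds:
  assumes M: "\<And>r. \<bar>r\<bar> \<le> pi \<Longrightarrow> cmod (f (of_real r)) \<le> M" "\<And>r. \<bar>r\<bar> \<le> pi \<Longrightarrow> cmod (deriv f (of_real r)) \<le> M"
    and k: "2 \<le> k" and r: "\<bar>r\<bar> \<le> pi"
  shows "cmod (f (of_real r) / of_real (pi * real k + r) ^ j) \<le> M / real k ^ j"
    and "cmod (deriv f (of_real r) / of_real (pi * real k + r) ^ j - of_nat j * f (of_real r) / of_real (pi * real k + r) ^ Suc j)
      \<le> (1 + real j) * M / real k ^ j"
proof -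
  have p: "real k \<le> pi * real k + r" "0 < pi * real k + r" by (rule shift_bounds[OF k r])+
  have M0: "0 \<le> M" by (rule order_trans[OF norm_ge_zero M(1)[OF r]])
  have b: "cmod (g / of_real (pi * real k + r) ^ i) \<le> M / real k ^ i" if "cmod g \<le> M" for g i
    unfolding norm_divide norm_power norm_of_real using p k that M0
    by (intro frac_le power_mono) auto
  show "cmod (f (of_real r) / of_real (pi * real k + r) ^ j) \<le> M / real k ^ j" by (rule b[OF M(1)[OF r]])
  have "cmod (deriv f (of_real r) / of_real (pi * real k + r) ^ j - of_nat j * f (of_real r) / of_real (pi * real k + r) ^ Suc j)
    \<le> cmod (deriv f (of_real r) / of_real (pi * real k + r) ^ j) + real j * cmod (f (of_real r) / of_real (pi * real k + r) ^ Suc j)"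
    by (rule order_trans[OF norm_triangle_ineq4]) (simp add: norm_mult norm_divide)
  also have "\<dots> \<le> M / real k ^ j + real j * (M / real k ^ Suc j)"
    by (intro add_mono mult_left_mono b M r) auto
  also have "\<dots> \<le> M / real k ^ j + real j * (M / real k ^ j)"
    using k M0 by (intro add_left_mono mult_left_mono divide_left_mono) (auto simp: mult_le_cancel_right1)
  finally show "cmod (deriv f (of_real r) / of_real (pi * real k + r) ^ j - of_nat j * f (of_real r) / of_real (pi * real k + r) ^ Suc j)
      \<le> (1 + real j) * M / real k ^ j" by (simp add: field_simps add_divide_distrib)
qed

lemma Eo_continuous: "continuous_on A (Eo k)"
  unfolding Eo_def[abs_def] by (intro continuous_intros) (use F_pos in auto)

lemma weight_continuous:
  assumes f: "f holomorphic_on kapU" and k: "2 \<le> k"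
  shows "continuous_on {-pi..pi} (\<lambda>r. f (of_real r) / of_real (pi * real k + r) ^ j * Eo k r)"
  by (intro continuous_on_mult Eo_continuous continuous_on_vector_derivative[OF weight_derivative[OF f k]]) auto

lemma weight_integrable:
  assumes f: "f holomorphic_on kapU" and k: "2 \<le> k"
  shows "(\<lambda>r. f (of_real r) / of_real (pi * real k + r) ^ j * Eo k r) integrable_on {-pi..pi}"
  by (rule integrable_continuous_interval[OF weight_continuous[OF f k]])

text \<open>The weight 1/(pi k + r)^j and its derivative are both O(k^(-j)) on the window, so it
  only multiplies the bound of \<open>osc_near\<close> by k^(-j).\<close>

lemma osc_weight:
  assumes f: "f holomorphic_on kapU"
  obtains C where "C > 0" "\<And>k. 2 \<le> k \<Longrightarrow> cmod (integral {-pi..pi} (\<lambda>r. f (of_real r) / of_real (pi * real k + r) ^ j * Eo k r)) \<le> C / (real k ^ j * sqrt (real k))"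
proof -
  obtain M where M: "M > 0" "\<And>r. \<bar>r\<bar> \<le> pi \<Longrightarrow> cmod (f (of_real r)) \<le> M"
    "\<And>r. \<bar>r\<bar> \<le> pi \<Longrightarrow> cmod (deriv f (of_real r)) \<le> M"
    using holomorphic_real_bound[OF f] by metis
  show ?thesis
  proof (rule that)
    show "0 < (6 * F + 2) * ((1 + real j) * M)" using F_pos M(1) by simp
    fix k :: nat assume k: "2 \<le> k"
    define w where "w r = f (of_real r) / of_real (pi * real k + r) ^ j" for r :: real
    define Pr where "Pr x = integral {-pi..x} (\<lambda>r. w r * Eo k r)" for x
    have c: "continuous_on {-pi..pi} (\<lambda>r. w r * Eo k r)" unfolding w_def by (rule weight_continuous[OF f k])
    have "cmod (Pr pi - Pr (-pi)) \<le> (6 * F + 2) * ((1 + real j) * M / real k ^ j) / sqrt (real k)"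
    proof (rule osc_near[OF k, where w = w])
      fix r :: real assume r: "\<bar>r\<bar> \<le> pi"
      show "(w has_vector_derivative (deriv f (of_real r) / of_real (pi * real k + r) ^ j - of_nat j * f (of_real r) / of_real (pi * real k + r) ^ Suc j)) (at r within {-pi..pi})"
        unfolding w_def[abs_def] by (rule weight_derivative[OF f k r])
      have "cmod (w r) \<le> M / real k ^ j" unfolding w_def by (rule weight_bounds(1)[OF M(2,3) k r])
      also have "\<dots> \<le> (1 + real j) * M / real k ^ j" using M(1) by (intro divide_right_mono) auto
      finally show "cmod (w r) \<le> (1 + real j) * M / real k ^ j" .
      show "cmod (deriv f (of_real r) / of_real (pi * real k + r) ^ j - of_nat j * f (of_real r) / of_real (pi * real k + r) ^ Suc j) \<le> (1 + real j) * M / real k ^ j"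
        by (rule weight_bounds(2)[OF M(2,3) k r])
      show "(Pr has_vector_derivative w r * Eo k r) (at r within {-pi..pi})"
        unfolding Pr_def[abs_def] by (rule integral_has_vector_derivative[OF c]) (use r in auto)
    qed auto
    then show "cmod (integral {-pi..pi} (\<lambda>r. f (of_real r) / of_real (pi * real k + r) ^ j * Eo k r)) \<le> (6 * F + 2) * ((1 + real j) * M) / (real k ^ j * sqrt (real k))"
      by (simp add: Pr_def w_def)
  qed
qed

text \<open>Here pi k + r is the value of p at the point r, so this is the expansion kap + F kap1 /
  p of the amplitude.\<close>

definition W :: "nat \<Rightarrow> real \<Rightarrow> complex" where
  "W k r = kap (of_real r) + of_real F * kap1 (of_real r) / of_real (pi * real k + r)"

definition Pr :: "nat \<Rightarrow> real \<Rightarrow> complex" where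
  "Pr k x = integral {-pi..x} (\<lambda>r. W k r * Eo k r)"

lemma W_bounds:
  obtains M W' where "M > 0"
    "\<And>k r. 2 \<le> k \<Longrightarrow> \<bar>r\<bar> \<le> pi \<Longrightarrow> (W k has_vector_derivative W' k r) (at r within {-pi..pi})"
    "\<And>k r. 2 \<le> k \<Longrightarrow> \<bar>r\<bar> \<le> pi \<Longrightarrow> cmod (W k r) \<le> M"
    "\<And>k r. 2 \<le> k \<Longrightarrow> \<bar>r\<bar> \<le> pi \<Longrightarrow> cmod (W' k r) \<le> M"
proof -
  obtain M0 where M0: "M0 > 0" "\<And>r. \<bar>r\<bar> \<le> pi \<Longrightarrow> cmod (kap (of_real r)) \<le> M0"
    "\<And>r. \<bar>r\<bar> \<le> pi \<Longrightarrow> cmod (deriv kap (of_real r)) \<le> M0"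
    using holomorphic_real_bound[OF kap_holomorphic] by metis
  obtain M1 where M1: "M1 > 0" "\<And>r. \<bar>r\<bar> \<le> pi \<Longrightarrow> cmod (kap1 (of_real r)) \<le> M1"
    "\<And>r. \<bar>r\<bar> \<le> pi \<Longrightarrow> cmod (deriv kap1 (of_real r)) \<le> M1"
    using holomorphic_real_bound[OF kap1_holomorphic] by metis
  define W' where "W' k r = deriv kap (of_real r) + of_real F * (deriv kap1 (of_real r) / of_real (pi * real k + r) ^ 1 - of_nat 1 * kap1 (of_real r) / of_real (pi * real k + r) ^ Suc 1)" for k r
  have nF: "cmod (of_real F * X) = F * cmod X" for X using F_pos by (simp add: norm_mult)
  have kinv: "M1 / real k ^ 1 \<le> M1" "(1 + real 1) * M1 / real k ^ 1 \<le> 2 * M1" if "2 \<le> k" for k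
    using that M1(1) by (auto simp: field_simps)
  show ?thesis
  proof (rule that[of "M0 + F * (2 * M1)" W'])
    show "0 < M0 + F * (2 * M1)" using M0 M1 F_pos by (simp add: add_pos_pos)
    fix k :: nat and r :: real assume k: "2 \<le> k" and r: "\<bar>r\<bar> \<le> pi"
    have eq: "W k = (\<lambda>r. kap (of_real r) + of_real F * (kap1 (of_real r) / of_real (pi * real k + r) ^ 1))"
      by (simp add: W_def fun_eq_iff)
    show "(W k has_vector_derivative W' k r) (at r within {-pi..pi})"
      unfolding eq W'_def
      by (intro has_vector_derivative_add has_vector_derivative_mult_right weight_derivative
          holomorphic_has_vector_derivative kap_holomorphic kap1_holomorphic k r)
    have "cmod (W k r) \<le> M0 + F * (M1 / real k ^ 1)"
      unfolding eq
      by (rule order_trans[OF norm_triangle_ineq add_mono[OF M0(2)[OF r]]], unfold nF)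
         (rule mult_left_mono[OF weight_bounds(1)[OF M1(2,3) k r] less_imp_le[OF F_pos]])
    also have "\<dots> \<le> M0 + F * (2 * M1)" 
      using kinv(1)[OF k] M1 F_pos by (intro add_left_mono mult_left_mono) linarith+
    finally show "cmod (W k r) \<le> M0 + F * (2 * M1)" .
    have "cmod (W' k r) \<le> M0 + F * ((1 + real 1) * M1 / real k ^ 1)"
      unfolding W'_def
      by (rule order_trans[OF norm_triangle_ineq add_mono[OF M0(3)[OF r]]], unfold nF)
         (rule mult_left_mono[OF weight_bounds(2)[OF M1(2,3) k r] less_imp_le[OF F_pos]])
    also have "\<dots> \<le> M0 + F * (2 * M1)" 
      using kinv(2)[OF k] F_pos by (intro add_left_mono mult_left_mono) linarith+
    finally show "cmod (W' k r) \<le> M0 + F * (2 * M1)" .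
  qed
qed

lemma Pr_has_vector_derivative:
  assumes k: "2 \<le> k" and r: "\<bar>r\<bar> \<le> pi"
  shows "(Pr k has_vector_derivative W k r * Eo k r) (at r within {-pi..pi})"
proof -
  obtain W' where W': "\<And>k r. 2 \<le> k \<Longrightarrow> \<bar>r\<bar> \<le> pi \<Longrightarrow> (W k has_vector_derivative W' k r) (at r within {-pi..pi})"
    using W_bounds by metis
  have "continuous_on {-pi..pi} (\<lambda>r. W k r * Eo k r)"
    by (intro continuous_on_mult Eo_continuous continuous_on_vector_derivative[OF W'[OF k]]) auto
  then show ?thesis unfolding Pr_def[abs_def] by (rule integral_has_vector_derivative) (use r in auto)
qed

lemma Pr_bounds:
  obtains C where "C > 0"
    "\<And>k a b. 2 \<le> k \<Longrightarrow> a \<in> {-pi..pi} \<Longrightarrow> b \<in> {-pi..pi} \<Longrightarrow> cmod (Pr k b - Pr k a) \<le> C / sqrt (real k)"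
    "\<And>k a b m. 2 \<le> k \<Longrightarrow> a \<le> b \<Longrightarrow> -pi \<le> a \<Longrightarrow> b \<le> pi \<Longrightarrow> 0 < m \<Longrightarrow> m \<le> a \<or> b \<le> -m \<Longrightarrow> cmod (Pr k b - Pr k a) \<le> C / (real k * m)"
    "\<And>k a b. 2 \<le> k \<Longrightarrow> a \<in> {-pi..pi} \<Longrightarrow> b \<in> {-pi..pi} \<Longrightarrow> cmod (Pr k b - Pr k a) \<le> C * \<bar>b - a\<bar>"
proof -
  obtain M W' where M: "M > 0"
    "\<And>k r. 2 \<le> k \<Longrightarrow> \<bar>r\<bar> \<le> pi \<Longrightarrow> (W k has_vector_derivative W' k r) (at r within {-pi..pi})"
    "\<And>k r. 2 \<le> k \<Longrightarrow> \<bar>r\<bar> \<le> pi \<Longrightarrow> cmod (W k r) \<le> M"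
    "\<And>k r. 2 \<le> k \<Longrightarrow> \<bar>r\<bar> \<le> pi \<Longrightarrow> cmod (W' k r) \<le> M"
    using W_bounds by metis
  define C where "C = (6 * F + 2) * M"
  show ?thesis
  proof (rule that[of C])
    show "C > 0" using F_pos M(1) by (simp add: C_def)
    show "cmod (Pr k b - Pr k a) \<le> C / sqrt (real k)" if "2 \<le> k" "a \<in> {-pi..pi}" "b \<in> {-pi..pi}" for k a b
      unfolding C_def by (rule osc_near[OF that M(2,3,4)[OF that(1)] Pr_has_vector_derivative[OF that(1)]])
    show "cmod (Pr k b - Pr k a) \<le> C / (real k * m)" 
      if "2 \<le> k" "a \<le> b" "-pi \<le> a" "b \<le> pi" "0 < m" "m \<le> a \<or> b \<le> -m" for k a b m
    proof -
      have "cmod (Pr k b - Pr k a) \<le> 3 * F * M / (real k * m)"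
        by (rule osc_far[OF that M(2,3,4)[OF that(1)] Pr_has_vector_derivative[OF that(1)]])
      also have "\<dots> \<le> C / (real k * m)"
        unfolding C_def using F_pos M(1) that by (intro divide_right_mono mult_right_mono) auto
      finally show ?thesis .
    qed
    show "cmod (Pr k b - Pr k a) \<le> C * \<bar>b - a\<bar>" if k: "2 \<le> k" and ab: "a \<in> {-pi..pi}" "b \<in> {-pi..pi}" for k a b
    proof -
      have "norm (Pr k b - Pr k a) \<le> C * norm (b - a)"
      proof (rule differentiable_bound[of "{-pi..pi}" "Pr k" "\<lambda>r h. h *\<^sub>R (W k r * Eo k r)"])
        fix r assume r: "r \<in> {-pi..pi}"
        then have r': "\<bar>r\<bar> \<le> pi" by auto
        show "(Pr k has_derivative (\<lambda>h. h *\<^sub>R (W k r * Eo k r))) (at r within {-pi..pi})"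
          using Pr_has_vector_derivative[OF k r'] by (simp add: has_vector_derivative_def)
        have "M \<le> C" unfolding C_def using F_pos M(1) by (simp add: mult_le_cancel_right1)
        then have "cmod (W k r) \<le> C" using M(3)[OF k r'] by linarith
        then show "onorm (\<lambda>h. h *\<^sub>R (W k r * Eo k r)) \<le> C"
          by (intro onorm_le) (auto simp: norm_mult cmod_Eo mult.commute[of C] intro: mult_left_mono)
      qed (use ab in auto)
      then show ?thesis by simp
    qed
  qed
qed

text \<open>The integral over the whole window of the k-th resonance.\<close>

definition Jv :: "nat \<Rightarrow> complex" where
  "Jv k = Pr k pi"

lemma Jv_bound:
  obtains C where "C > 0" "\<And>k. 2 \<le> k \<Longrightarrow> cmod (Jv k) \<le> C / sqrt (real k)"
proof -
  obtain C where C: "C > 0"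
    "\<And>k a b. 2 \<le> k \<Longrightarrow> a \<in> {-pi..pi} \<Longrightarrow> b \<in> {-pi..pi} \<Longrightarrow> cmod (Pr k b - Pr k a) \<le> C / sqrt (real k)"
    using Pr_bounds by metis
  have "Pr k (-pi) = 0" for k by (simp add: Pr_def)
  then show ?thesis using C(2)[of _ "-pi" pi] C(1) that[of C] by (simp add: Jv_def)
qed

lemma Eo_Suc: "Eo (Suc k) r = Eo k r * exp (- (2 * pi * \<i> / of_real F) * (of_real r)\<^sup>2)"
proof -
  have e: "(2 * pi * real (Suc k) * r\<^sup>2 + 4 * r ^ 3 / 3) / F = (2 * pi * real k * r\<^sup>2 + 4 * r ^ 3 / 3) / F + 2 * pi / F * r\<^sup>2"
    by (simp add: algebra_simps add_divide_distrib)
  show ?thesis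
    unfolding Eo_def e of_real_add ring_distribs exp_add
    by (rule arg_cong2[of _ _ _ _ "(*)"]) (simp_all add: mult_ac)
qed

text \<open>Passing from k to k + 1 multiplies the oscillating factor by exp (-2 pi i r^2 / F), so
  the leading part of the difference has an integrand that vanishes at the stationary point.
  Integration by parts then works across r = 0 and gains a factor 1/k over \<open>Jv_bound\<close>.
  The result gives \<open>Jv\<close> the bounded variation that Abel summation needs.\<close>

lemma Jv_diff_bound:
  obtains C where "C > 0" "\<And>k. 2 \<le> k \<Longrightarrow> cmod (Jv k - Jv (Suc k)) \<le> C / (real k * sqrt (real k))"
proof -
  define f where "f z = 1 - exp (- (2 * pi * \<i> / of_real F) * z\<^sup>2)" for z :: complex
  \<comment> \<open>The quotient f(z)/z with its removable singularity filled; it is holomorphic, so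
    \<open>N\<close> can be differentiated through r = 0.\<close>
  define \<eta> where "\<eta> z = (if z = 0 then deriv f 0 else (f z - f 0) / (z - 0))" for z
  have fh: "f holomorphic_on UNIV" unfolding f_def[abs_def] by (intro holomorphic_intros)
  have "\<eta> holomorphic_on UNIV" unfolding \<eta>_def[abs_def] by (rule pole_lemma_open[OF fh]) simp
  then have eh: "\<eta> holomorphic_on kapU" by (rule holomorphic_on_subset) simp
  have f0: "f 0 = 0" by (simp add: f_def)
  have ze: "z * \<eta> z = f z" for z using f0 by (simp add: \<eta>_def)
  define N where "N z = kap z * \<eta> z" for z
  have Nh: "N holomorphic_on kapU" unfolding N_def[abs_def] by (intro holomorphic_on_mult kap_holomorphic eh)
  have N'h: "deriv N holomorphic_on kapU" by (rule holomorphic_deriv[OF Nh open_kapU])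
  obtain C1 where C1: "C1 > 0" "\<And>k. 2 \<le> k \<Longrightarrow> cmod (integral {-pi..pi} (\<lambda>r. deriv N (of_real r) / of_real (pi * real k + r) ^ 1 * Eo k r)) \<le> C1 / (real k ^ 1 * sqrt (real k))"
    by (rule osc_weight[OF N'h, of 1]) (rule that)
  obtain C2 where C2: "C2 > 0" "\<And>k. 2 \<le> k \<Longrightarrow> cmod (integral {-pi..pi} (\<lambda>r. N (of_real r) / of_real (pi * real k + r) ^ 2 * Eo k r)) \<le> C2 / (real k ^ 2 * sqrt (real k))"
    by (rule osc_weight[OF Nh, of 2]) (rule that)
  obtain C3 where C3: "C3 > 0" "\<And>k. 2 \<le> k \<Longrightarrow> cmod (integral {-pi..pi} (\<lambda>r. kap1 (of_real r) / of_real (pi * real k + r) ^ 1 * Eo k r)) \<le> C3 / (real k ^ 1 * sqrt (real k))"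
    by (rule osc_weight[OF kap1_holomorphic, of 1]) (rule that)
  show ?thesis
  proof (rule that)
    show "0 < F / 4 * (C1 + C2) + F * (2 * C3)" using F_pos C1 C2 C3 by (simp add: add_pos_pos)
    fix k :: nat assume k: "2 \<le> k"
    then have k': "2 \<le> Suc k" by simp
    define I1 where "I1 = integral {-pi..pi} (\<lambda>r. deriv N (of_real r) / of_real (pi * real k + r) ^ 1 * Eo k r)"
    define I2 where "I2 = integral {-pi..pi} (\<lambda>r. N (of_real r) / of_real (pi * real k + r) ^ 2 * Eo k r)"
    define I3 where "I3 k = integral {-pi..pi} (\<lambda>r. kap1 (of_real r) / of_real (pi * real k + r) ^ 1 * Eo k r)" for k
    define I0 where "I0 k = integral {-pi..pi} (\<lambda>r. kap (of_real r) / of_real (pi * real k + r) ^ 0 * Eo k r)" for k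
    have J: "Jv k = I0 k + of_real F * I3 k" if k: "2 \<le> k" for k
    proof -
      have "((\<lambda>r. kap (of_real r) / of_real (pi * real k + r) ^ 0 * Eo k r + of_real F * (kap1 (of_real r) / of_real (pi * real k + r) ^ 1 * Eo k r)) has_integral
          (I0 k + of_real F * I3 k)) {-pi..pi}"
        unfolding I0_def I3_def
        by (intro has_integral_add has_integral_mult_right integrable_integral weight_integrable k kap_holomorphic kap1_holomorphic)
      then have "((\<lambda>r. W k r * Eo k r) has_integral (I0 k + of_real F * I3 k)) {-pi..pi}"
        by (rule has_integral_eq[rotated]) (simp add: W_def algebra_simps)
      then show ?thesis by (simp add: Jv_def Pr_def integral_unique)
    qed
    have I0: "I0 k - I0 (Suc k) = - (\<i> * of_real F / 4) * (I1 - I2)"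
    proof -
      have d: "((\<lambda>r. \<i> * of_real F / 4 * (N (of_real r) / of_real (pi * real k + r) ^ 1) * Eo k r) has_vector_derivative
          (\<i> * of_real F / 4 * (deriv N (of_real r) / of_real (pi * real k + r) ^ 1 * Eo k r - N (of_real r) / of_real (pi * real k + r) ^ 2 * Eo k r)
            + (kap (of_real r) / of_real (pi * real k + r) ^ 0 * Eo k r - kap (of_real r) / of_real (pi * real (Suc k) + r) ^ 0 * Eo (Suc k) r))) (at r within {-pi..pi})"
        if r: "\<bar>r\<bar> \<le> pi" for r
      proof (rule has_vector_derivative_eq_rhs[OF has_vector_derivative_mult[OF has_vector_derivative_mult_right[OF weight_derivative[OF Nh k r]] Eo_has_vector_derivative]])
        define X where "X = complex_of_real (pi * real k + r)"
        have X: "X \<noteq> 0" unfolding X_def using shift_bounds(2)[OF k r] by (simp only: of_real_eq_0_iff)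
        have "kap (of_real r) * (1 - exp (- (2 * pi * \<i> / of_real F) * (of_real r)\<^sup>2)) = of_real r * N (of_real r)"
          using ze[of "of_real r"] by (simp add: N_def f_def mult_ac)
        then have Z: "kap (of_real r) * exp (- (2 * pi * \<i> / of_real F) * (of_real r)\<^sup>2) = kap (of_real r) - of_real r * N (of_real r)"
          by (simp add: algebra_simps)
        show "\<i> * of_real F / 4 * (N (of_real r) / of_real (pi * real k + r) ^ 1) * (- (4 * \<i> / of_real F) * of_real (r * (pi * real k + r)) * Eo k r) +
            \<i> * of_real F / 4 * (deriv N (of_real r) / of_real (pi * real k + r) ^ 1 - of_nat 1 * N (of_real r) / of_real (pi * real k + r) ^ Suc 1) * Eo k r =
            \<i> * of_real F / 4 * (deriv N (of_real r) / of_real (pi * real k + r) ^ 1 * Eo k r - N (of_real r) / of_real (pi * real k + r) ^ 2 * Eo k r)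
            + (kap (of_real r) / of_real (pi * real k + r) ^ 0 * Eo k r - kap (of_real r) / of_real (pi * real (Suc k) + r) ^ 0 * Eo (Suc k) r)"
        proof -
          have "kap (of_real r) * Eo (Suc k) r = Eo k r * (kap (of_real r) - of_real r * N (of_real r))"
            unfolding Eo_Suc Z[symmetric] by (simp add: mult_ac)
          moreover have "\<i> * of_real F / 4 * (N (of_real r) / X) * (- (4 * \<i> / of_real F) * (of_real r * X) * Eo k r) = of_real r * N (of_real r) * Eo k r"
            using X F_pos by (simp add: field_simps)
          ultimately show ?thesis
            unfolding of_real_mult[of r] X_def[symmetric]
            by (simp add: algebra_simps power2_eq_square)
        qed
      qed
      have fi1: "((\<lambda>r. \<i> * of_real F / 4 * (deriv N (of_real r) / of_real (pi * real k + r) ^ 1 * Eo k r - N (of_real r) / of_real (pi * real k + r) ^ 2 * Eo k r)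
            + (kap (of_real r) / of_real (pi * real k + r) ^ 0 * Eo k r - kap (of_real r) / of_real (pi * real (Suc k) + r) ^ 0 * Eo (Suc k) r)) has_integral
           (\<i> * of_real F / 4 * (N (of_real pi) / of_real (pi * real k + pi) ^ 1) * Eo k pi
            - \<i> * of_real F / 4 * (N (of_real (-pi)) / of_real (pi * real k + - pi) ^ 1) * Eo k (-pi))) {-pi..pi}"
        by (rule fundamental_theorem_of_calculus) (use d in auto)
      \<comment> \<open>The zeros of \<open>kap\<close> at both ends of the window remove the
        boundary terms.\<close>
      have N0: "N (of_real pi) = 0" "N (of_real (-pi)) = 0" using kap_pi by (simp_all add: N_def)
      have fi2: "((\<lambda>r. \<i> * of_real F / 4 * (deriv N (of_real r) / of_real (pi * real k + r) ^ 1 * Eo k r - N (of_real r) / of_real (pi * real k + r) ^ 2 * Eo k r)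
            + (kap (of_real r) / of_real (pi * real k + r) ^ 0 * Eo k r - kap (of_real r) / of_real (pi * real (Suc k) + r) ^ 0 * Eo (Suc k) r)) has_integral
            (\<i> * of_real F / 4 * (I1 - I2) + (I0 k - I0 (Suc k)))) {-pi..pi}"
        unfolding I0_def I1_def I2_def
        by (intro has_integral_add has_integral_diff has_integral_mult_right integrable_integral weight_integrable k k' kap_holomorphic Nh N'h)
      have "\<i> * of_real F / 4 * (I1 - I2) + (I0 k - I0 (Suc k)) = 0"
        using has_integral_unique[OF fi2 fi1] unfolding N0 by simp
      then show ?thesis by (simp add: eq_neg_iff_add_eq_0 algebra_simps)
    qed
    have s: "sqrt (real k) > 0" "real k > 0" using k by auto
    have 1: "cmod I1 \<le> C1 / (real k * sqrt (real k))" using C1(2)[OF k] by (simp add: I1_def)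
    have 2: "cmod I2 \<le> C2 / (real k * sqrt (real k))"
    proof -
      have "cmod I2 \<le> C2 / (real k ^ 2 * sqrt (real k))" using C2(2)[OF k] by (simp add: I2_def)
      also have "\<dots> \<le> C2 / (real k * sqrt (real k))"
        using k C2(1) by (intro divide_left_mono mult_right_mono) (auto simp: power2_eq_square)
      finally show ?thesis .
    qed
    have 3: "cmod (I3 k) \<le> C3 / (real k * sqrt (real k))" using C3(2)[OF k] by (simp add: I3_def)
    have 4: "cmod (I3 (Suc k)) \<le> C3 / (real k * sqrt (real k))"
    proof -
      have "cmod (I3 (Suc k)) \<le> C3 / (real (Suc k) * sqrt (real (Suc k)))" using C3(2)[OF k'] by (simp add: I3_def)
      also have "\<dots> \<le> C3 / (real k * sqrt (real k))"
        using k C3(1) by (intro divide_left_mono mult_mono) auto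
      finally show ?thesis .
    qed
    have "Jv k - Jv (Suc k) = - (\<i> * of_real F / 4) * (I1 - I2) + of_real F * (I3 k - I3 (Suc k))"
      unfolding J[OF k] J[OF k'] I0[symmetric] by (simp add: algebra_simps)
    then have "cmod (Jv k - Jv (Suc k)) \<le> cmod (- (\<i> * of_real F / 4) * (I1 - I2)) + cmod (of_real F * (I3 k - I3 (Suc k)))"
      by (simp only: norm_triangle_ineq)
    also have "\<dots> = F / 4 * cmod (I1 - I2) + F * cmod (I3 k - I3 (Suc k))"
      using F_pos by (simp add: norm_mult norm_divide)
    also have "\<dots> \<le> F / 4 * (cmod I1 + cmod I2) + F * (cmod (I3 k) + cmod (I3 (Suc k)))"
      using F_pos by (intro add_mono mult_left_mono norm_triangle_ineq4) auto
    also have "\<dots> \<le> F / 4 * (C1 / (real k * sqrt (real k)) + C2 / (real k * sqrt (real k))) + F * (C3 / (real k * sqrt (real k)) + C3 / (real k * sqrt (real k)))"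
      using F_pos 1 2 3 4 by (intro add_mono mult_left_mono) auto
    also have "\<dots> = (F / 4 * (C1 + C2) + F * (2 * C3)) / (real k * sqrt (real k))"
      by (simp add: add_divide_distrib algebra_simps)
    finally show "cmod (Jv k - Jv (Suc k)) \<le> (F / 4 * (C1 + C2) + F * (2 * C3)) / (real k * sqrt (real k))" .
  qed
qed

end

lemma exp_minus_i_approx:
  "cmod (exp (- \<i> * of_real y) - 1) \<le> \<bar>y\<bar>"
  "cmod (exp (- \<i> * of_real y) - (1 - \<i> * of_real y)) \<le> y\<^sup>2 / 2"
  using iexp_approx1[of "-y" 0] iexp_approx1[of "-y" 1] by (simp_all add: numeral_2_eq_2 power2_eq_square)

text \<open>Three expansions in 1/P are multiplied out. The factor B is already of size 1/P, so
  every remainder, and the cross term of s/P with X/P, lands in O(P^(-3)).\<close>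

lemma product_approx:
  fixes A A0 D X \<kappa> a d :: complex and B b P K s :: real
  assumes P: "1 \<le> P" and K: "1 \<le> K" and A0: "cmod A = 1" "cmod A0 = 1"
    and A: "A = A0 * (1 - \<i> * of_real (s / P) + a)" and B: "B = 1 / P + b" and D: "D = \<kappa> + X / of_real P + d"
    and bds: "cmod a \<le> K / P\<^sup>2" "\<bar>b\<bar> \<le> K / P ^ 3" "cmod d \<le> K / P\<^sup>2" "cmod D \<le> K" "cmod X \<le> K" "cmod \<kappa> \<le> K" "\<bar>s\<bar> \<le> K"
  shows "cmod (A * of_real B * D - A0 / of_real P * (\<kappa> + (X - \<i> * of_real s * \<kappa>) / of_real P)) \<le> 5 * K\<^sup>2 / P ^ 3"
proof -
  have P0: "P \<noteq> 0" "0 < P" using P by auto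
  have K0: "0 \<le> K" "K \<le> K\<^sup>2" using K by (auto simp: power2_eq_square)
  have eq: "A * of_real B * D - A0 / of_real P * (\<kappa> + (X - \<i> * of_real s * \<kappa>) / of_real P)
    = A * of_real b * D + A / of_real P * d + A0 / of_real P * (a * (\<kappa> + X / of_real P))
      + A0 / of_real P * (- \<i> * of_real s * X / of_real P ^ 2)"
  proof -
    have "A * of_real B * D = A * of_real b * D + A / of_real P * d + A / of_real P * (\<kappa> + X / of_real P)"
      unfolding B using P0 by (simp add: D algebra_simps add_divide_distrib)
    also have "A / of_real P * (\<kappa> + X / of_real P) = A0 / of_real P * (a * (\<kappa> + X / of_real P))
        + A0 / of_real P * ((1 - \<i> * of_real (s / P)) * (\<kappa> + X / of_real P))"
      unfolding A ring_distribs times_divide_eq_left add_divide_distrib by (simp add: algebra_simps diff_divide_distrib)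
    also have "(1 - \<i> * of_real (s / P)) * (\<kappa> + X / of_real P) = (\<kappa> + (X - \<i> * of_real s * \<kappa>) / of_real P) + (- \<i> * of_real s * X / of_real P ^ 2)"
      using P0 by (simp add: field_simps power2_eq_square)
    finally show ?thesis by (simp add: algebra_simps)
  qed
  have 1: "cmod (A * of_real b * D) \<le> K\<^sup>2 / P ^ 3"
  proof -
    have "cmod (A * of_real b * D) = \<bar>b\<bar> * cmod D" by (simp add: norm_mult A0)
    also have "\<dots> \<le> (K / P ^ 3) * K" using bds P0 K0 by (intro mult_mono) auto
    finally show ?thesis by (simp add: power2_eq_square)
  qed
  have 2: "cmod (A / of_real P * d) \<le> K\<^sup>2 / P ^ 3"
  proof -
    have "cmod (A / of_real P * d) = cmod d / P" using P0 by (simp add: norm_mult norm_divide A0)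
    also have "\<dots> \<le> (K / P\<^sup>2) / P" using bds P0 by (intro divide_right_mono) auto
    also have "\<dots> \<le> K\<^sup>2 / P ^ 3" using K0 P0 by (simp add: power2_eq_square power3_eq_cube divide_right_mono)
    finally show ?thesis .
  qed
  have kX: "cmod (\<kappa> + X / of_real P) \<le> 2 * K"
  proof -
    have "cmod (X / of_real P) \<le> K / 1" unfolding norm_divide norm_of_real using bds P by (intro frac_le) auto
    then show ?thesis using norm_triangle_ineq[of \<kappa> "X / of_real P"] bds by linarith
  qed
  have 3: "cmod (A0 / of_real P * (a * (\<kappa> + X / of_real P))) \<le> 2 * K\<^sup>2 / P ^ 3"
  proof -
    have "cmod (A0 / of_real P * (a * (\<kappa> + X / of_real P))) = cmod a * cmod (\<kappa> + X / of_real P) / P"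
      using P0 by (simp add: norm_mult norm_divide A0)
    also have "\<dots> \<le> (K / P\<^sup>2) * (2 * K) / P" using bds kX P0 K0 by (intro divide_right_mono mult_mono) auto
    finally show ?thesis by (simp add: power2_eq_square power3_eq_cube mult_ac)
  qed
  have 4: "cmod (A0 / of_real P * (- \<i> * of_real s * X / of_real P ^ 2)) \<le> K\<^sup>2 / P ^ 3"
  proof -
    have "cmod (A0 / of_real P * (- \<i> * of_real s * X / of_real P ^ 2)) = \<bar>s\<bar> * cmod X / P ^ 3"
      using P0 by (simp add: norm_mult norm_divide norm_power A0 power2_eq_square power3_eq_cube)
    also have "\<dots> \<le> K * K / P ^ 3" using bds P0 K0 by (intro divide_right_mono mult_mono) auto
    finally show ?thesis by (simp add: power2_eq_square)
  qed
  have tri: "cmod (u + v + w + z) \<le> cmod u + cmod v + cmod w + cmod z" for u v w z :: complex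
    using norm_triangle_ineq[of "u + v + w" z] norm_triangle_ineq[of "u + v" w] norm_triangle_ineq[of u v] by linarith
  have "K\<^sup>2 / P ^ 3 + K\<^sup>2 / P ^ 3 + 2 * K\<^sup>2 / P ^ 3 + K\<^sup>2 / P ^ 3 = 5 * K\<^sup>2 / P ^ 3"
    by (simp add: add_divide_distrib[symmetric])
  then show ?thesis unfolding eq using order_trans[OF tri add_mono[OF add_mono[OF add_mono[OF 1 2] 3] 4]] by simp
qed

section \<open>Summation over the resonances\<close>

locale osc_sum = osc +
  fixes e :: real
begin

definition p :: "real \<Rightarrow> real" where "p x = sqrt (F * x + e)"

text \<open>A_n without its constant factor; e will be E - lam.\<close>

definition b :: "nat \<Rightarrow> complex" where
  "b n = exp (- \<i> * of_real (4 / (3 * F) * p n ^ 3)) / of_real (p n)"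

text \<open>The k-th Poisson term at its stationary point p = pi k: there -4/(3F) p^3 + 2 pi k (p^2
  - e)/F has cubic part (-4/3 + 2) pi^3 k^3 / F.\<close>

definition om :: "nat \<Rightarrow> complex" where
  "om k = exp (\<i> * of_real (2 * pi ^ 3 * real k ^ 3 / (3 * F) - 2 * pi * real k * e / F))"

lemma cmod_om: "cmod (om k) = 1" by (simp add: om_def norm_exp_eq_Re)

text \<open>The expansion of the k-th Poisson phase about p = pi k is exact. It produces 2 pi k (n +
  t), and exp (2 pi i k n) = 1 removes n; this is where it matters that the point interactions sit
  at integers.\<close>

lemma om_Eo:
  assumes "F * (real n + t) + e > 0"
  shows "om k * Eo k (p (real n + t) - pi * real k) = exp (- \<i> * of_real (4 / (3 * F) * p (real n + t) ^ 3 - 2 * pi * real k * t))"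
proof -
  define q where "q = p (real n + t)"
  have q2: "q\<^sup>2 = F * (real n + t) + e" using assms by (simp add: q_def p_def)
  have one: "exp (\<i> * of_real (2 * pi * (real k * real n))) = 1"
  proof -
    have "exp ((2 * real (k * n) * pi) * \<i>) = (1::complex)" by (rule exp_integer_2pi) simp
    then show ?thesis by (simp add: mult_ac)
  qed
  have id: "2 * pi ^ 3 * real k ^ 3 / (3 * F) - 2 * pi * real k * e / F - (2 * pi * real k * (q - pi * real k)\<^sup>2 + 4 * (q - pi * real k) ^ 3 / 3) / F
     = - (4 / (3 * F) * q ^ 3 - 2 * pi * real k * t) + 2 * pi * (real k * real n)"
  proof -
    have "2 * pi ^ 3 * real k ^ 3 / (3 * F) - 2 * pi * real k * e / F - (2 * pi * real k * (q - pi * real k)\<^sup>2 + 4 * (q - pi * real k) ^ 3 / 3) / F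
       = - (4 / (3 * F) * q ^ 3) + 2 * pi * real k * (q\<^sup>2 - e) / F"
      using F_pos by (simp add: field_simps power2_eq_square power3_eq_cube)
    also have "(q\<^sup>2 - e) = F * (real n + t)" using q2 by simp
    also have "2 * pi * real k * (F * (real n + t)) / F = 2 * pi * real k * (real n + t)" using F_pos by simp
    finally show ?thesis by (simp add: algebra_simps)
  qed
  have ie: "exp (\<i> * of_real A) * exp (- \<i> * of_real B) = exp (\<i> * of_real (A - B))"
    and ie2: "exp (\<i> * of_real (- A + B)) = exp (- \<i> * of_real A) * exp (\<i> * of_real B)" for A B :: real
    by (simp_all add: exp_add[symmetric] algebra_simps)
  have "om k * Eo k (q - pi * real k) = exp (\<i> * of_real (2 * pi ^ 3 * real k ^ 3 / (3 * F) - 2 * pi * real k * e / F - (2 * pi * real k * (q - pi * real k)\<^sup>2 + 4 * (q - pi * real k) ^ 3 / 3) / F))"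
    unfolding om_def Eo_def ie ..
  also have "\<dots> = exp (- \<i> * of_real (4 / (3 * F) * q ^ 3 - 2 * pi * real k * t)) * exp (\<i> * of_real (2 * pi * (real k * real n)))"
    unfolding id ie2 ..
  finally show ?thesis unfolding one q_def by simp
qed

lemma p_pos: "F * x + e > 0 \<Longrightarrow> p x > 0"
  by (simp add: p_def)

lemma p_has_derivative:
  assumes "F * x + e > 0"
  shows "(p has_real_derivative F / (2 * p x)) (at x within A)"
  unfolding p_def[abs_def] using assms
  by (auto intro!: derivative_eq_intros simp: field_simps)

text \<open>Everything follows from (q - P)(q + P) = F t for q = p(x + t). The condition 4 F <= P^2
  keeps q above P/2, so denominators are comparable to P.\<close>

lemma p_expansion:
  assumes P: "1 \<le> P" "4 * F \<le> P\<^sup>2" "P = p x" and t: "\<bar>t\<bar> \<le> 1/2"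
  shows "F * (x + t) + e > 0" "P / 2 \<le> p (x + t)" "\<bar>p (x + t) - P\<bar> \<le> F / P"
    "\<bar>p (x + t) - P - F * t / (2 * P)\<bar> \<le> F\<^sup>2 / P ^ 3" "\<bar>1 / p (x + t) - 1 / P\<bar> \<le> 2 * F / P ^ 3"
proof -
  have P0: "0 < P" using P by simp
  have pos: "0 < F * x + e" using P by (simp add: p_def)
  then have P2: "P\<^sup>2 = F * x + e" using P by (simp add: p_def)
  have Ft: "\<bar>F * t\<bar> \<le> F / 2" using t F_pos by (simp add: abs_mult)
  have low: "P\<^sup>2 / 4 \<le> F * (x + t) + e" using P2 P(2) Ft zero_le_power2[of P] by (simp add: algebra_simps)
  moreover have "0 < P\<^sup>2 / 4" using P0 by simp
  ultimately show pos': "F * (x + t) + e > 0" by linarith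
  define q where "q = p (x + t)"
  have q2: "q\<^sup>2 = F * (x + t) + e" and q0: "0 < q" using pos' p_pos[of "x + t"] by (simp_all add: q_def p_def)
  show qP: "P / 2 \<le> p (x + t)" unfolding q_def[symmetric]
    by (rule power2_le_imp_le) (use q2 low q0 in \<open>simp_all add: power_divide\<close>)
  have d: "(q - P) * (q + P) = F * t" using q2 P2 by (simp add: algebra_simps power2_eq_square)
  have e1: "q - P = F * t / (q + P)" using d q0 P0 by (simp add: field_simps)
  have b1: "\<bar>q - P\<bar> \<le> (F / 2) / P"
    unfolding e1 abs_divide using Ft q0 P0 by (intro frac_le) auto
  then show "\<bar>p (x + t) - P\<bar> \<le> F / P" unfolding q_def[symmetric]
    using F_pos P0 by (simp add: field_simps)
  have "q - P - F * t / (2 * P) = - (F * t * (q - P)) / (2 * P * (q + P))"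
  proof -
    have "(q - P) * (q + P) * (q - P) / (2 * P * (q + P)) = (q - P) * (q - P) / (2 * P)" using q0 P0 by simp
    moreover have "q - P - (q - P) * (q + P) / (2 * P) = - ((q - P) * (q - P) / (2 * P))"
      using P0 by (simp add: field_simps)
    ultimately show ?thesis unfolding d[symmetric] by simp
  qed
  also have "\<bar>\<dots>\<bar> = \<bar>F * t\<bar> * \<bar>q - P\<bar> / (2 * P * (q + P))" using q0 P0 by (simp add: abs_mult)
  also have "\<dots> \<le> F / 2 * ((F / 2) / P) / (2 * P * P)"
    using Ft b1 q0 P0 F_pos by (intro frac_le mult_mono) auto
  also have "\<dots> \<le> F\<^sup>2 / P ^ 3" using F_pos P0 by (simp add: field_simps power2_eq_square power3_eq_cube)
  finally show "\<bar>p (x + t) - P - F * t / (2 * P)\<bar> \<le> F\<^sup>2 / P ^ 3" unfolding q_def .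
  have "\<bar>1 / q - 1 / P\<bar> = \<bar>q - P\<bar> / (q * P)" using q0 P0 by (simp add: field_simps abs_minus_commute)
  also have "\<dots> \<le> ((F / 2) / P) / (P / 2 * P)"
    using b1 qP[folded q_def] q0 P0 F_pos by (intro frac_le mult_mono) auto
  also have "\<dots> \<le> 2 * F / P ^ 3" using F_pos P0 by (simp add: field_simps power2_eq_square power3_eq_cube)
  finally show "\<bar>1 / p (x + t) - 1 / P\<bar> \<le> 2 * F / P ^ 3" unfolding q_def .
qed

text \<open>The derivative in t of the difference of the two phases is twice the error of the linear
  expansion of \<open>p\<close>, so the cubic phase inherits that error.\<close>

lemma phase_expansion:
  assumes P: "1 \<le> P" "4 * F \<le> P\<^sup>2" "P = p x" and t: "\<bar>t\<bar> \<le> 1/2"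
  shows "\<bar>(4 / (3 * F) * p (x + t) ^ 3 - 2 * pi * real k * t) - (4 / (3 * F) * P ^ 3 + 2 * (P - pi * real k) * t + F * t\<^sup>2 / (2 * P))\<bar> \<le> F\<^sup>2 / P ^ 3"
proof -
  define \<theta> where "\<theta> t = 4 / (3 * F) * p (x + t) ^ 3 - 2 * P * t - F * t\<^sup>2 / (2 * P)" for t
  have P0: "0 < P" using P by simp
  have der: "(\<theta> has_real_derivative (2 * (p (x + t) - P - F * t / (2 * P)))) (at t within A)" if t: "\<bar>t\<bar> \<le> 1/2" for t A
  proof -
    have pos: "F * (x + t) + e > 0" by (rule p_expansion(1)[OF P t])
    have s: "((\<lambda>t. p (x + t)) has_real_derivative F / (2 * p (x + t)) * 1) (at t within A)"
      by (rule DERIV_chain2[where f = p and g = "\<lambda>t. x + t", OF p_has_derivative[OF pos]]) (auto intro!: derivative_eq_intros)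
    have "(\<theta> has_real_derivative (4 / (3 * F) * (3 * (F / (2 * p (x + t)) * 1 * p (x + t) ^ 2)) - 2 * P * 1 - F * (2 * t) / (2 * P))) (at t within A)"
      unfolding \<theta>_def[abs_def]
      by (rule DERIV_cong, (rule derivative_intros s)+) (use P0 in \<open>auto simp: numeral_2_eq_2\<close>)
    then show ?thesis
      by (rule DERIV_cong) (use p_pos[OF pos] F_pos P0 in \<open>simp add: field_simps power2_eq_square\<close>)
  qed
  have "norm (\<theta> t - \<theta> 0) \<le> 2 * (F\<^sup>2 / P ^ 3) * norm (t - 0)"
  proof (rule field_differentiable_bound[of "{-1/2..1/2}" \<theta> "\<lambda>t. 2 * (p (x + t) - P - F * t / (2 * P))"])
    fix s :: real assume "s \<in> {-1/2..1/2}"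
    then have s: "\<bar>s\<bar> \<le> 1/2" by auto
    show "(\<theta> has_field_derivative 2 * (p (x + s) - P - F * s / (2 * P))) (at s within {-1/2..1/2})" by (rule der[OF s])
    show "norm (2 * (p (x + s) - P - F * s / (2 * P))) \<le> 2 * (F\<^sup>2 / P ^ 3)"
      using p_expansion(4)[OF P s] by simp
  qed (use t in auto)
  also have "\<dots> \<le> 2 * (F\<^sup>2 / P ^ 3) * (1/2)" using t P0 by (intro mult_left_mono) auto
  finally have "\<bar>\<theta> t - \<theta> 0\<bar> \<le> F\<^sup>2 / P ^ 3" by simp
  moreover have "\<theta> t - \<theta> 0 = (4 / (3 * F) * p (x + t) ^ 3 - 2 * pi * real k * t) - (4 / (3 * F) * P ^ 3 + 2 * (P - pi * real k) * t + F * t\<^sup>2 / (2 * P))"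
    using P by (simp add: \<theta>_def algebra_simps)
  ultimately show ?thesis by simp
qed

lemma Taylor_kapU:
  assumes f: "f holomorphic_on kapU" and M: "\<And>r. \<bar>r\<bar> \<le> pi \<Longrightarrow> cmod (deriv f (of_real r)) \<le> M"
     "\<And>r. \<bar>r\<bar> \<le> pi \<Longrightarrow> cmod (deriv (deriv f) (of_real r)) \<le> M"
    and r: "\<bar>r\<bar> \<le> pi" "\<bar>s\<bar> \<le> pi"
  shows "cmod (f (of_real s) - f (of_real r)) \<le> M * \<bar>s - r\<bar>"
    and "cmod (f (of_real s) - f (of_real r) - deriv f (of_real r) * of_real (s - r)) \<le> M * (s - r)\<^sup>2"
proof -
  define S where "S = complex_of_real ` {-pi..pi}"
  have conv: "convex S" unfolding S_def
    by (intro convex_linear_image) (auto intro!: linearI simp: scaleR_conv_of_real)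
  have der: "(((deriv ^^ i) f) has_field_derivative (deriv ^^ Suc i) f z) (at z within S)" if "z \<in> S" for i z
  proof -
    have "z \<in> kapU" using that real_subset_kapU by (auto simp: S_def)
    then show ?thesis
      using holomorphic_derivI[OF holomorphic_higher_deriv[OF f open_kapU] open_kapU] by simp
  qed
  have mem: "of_real r \<in> S" "of_real s \<in> S" using r by (auto simp: S_def abs_le_iff)
  have "cmod ((deriv ^^ 0) f (of_real s) - (\<Sum>i\<le>0. (deriv ^^ i) f (of_real r) * (of_real s - of_real r) ^ i / fact i)) \<le> M * cmod (of_real s - of_real r) ^ Suc 0 / fact 0"
    by (rule field_Taylor[where f = "\<lambda>i. (deriv ^^ i) f", OF conv der _ mem]) (use M(1) in \<open>auto simp: S_def\<close>)
  then show "cmod (f (of_real s) - f (of_real r)) \<le> M * \<bar>s - r\<bar>"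
    by (simp flip: of_real_diff)
  have "cmod ((deriv ^^ 0) f (of_real s) - (\<Sum>i\<le>1. (deriv ^^ i) f (of_real r) * (of_real s - of_real r) ^ i / fact i)) \<le> M * cmod (of_real s - of_real r) ^ Suc 1 / fact 1"
    by (rule field_Taylor[where f = "\<lambda>i. (deriv ^^ i) f", OF conv der _ mem]) (use M(2) in \<open>auto simp: S_def\<close>)
  then show "cmod (f (of_real s) - f (of_real r) - deriv f (of_real r) * of_real (s - r)) \<le> M * (s - r)\<^sup>2"
    by (simp add: diff_diff_eq power2_eq_square flip: of_real_diff)
qed

text \<open>In the variable t with r = p(n + t) - pi k the increment of \<open>Pr k\<close> is an
  integral over |t| <= 1/2. The phase is linear of slope 2 r up to F t^2/(2P), so box moments
  appear. The amplitudes are chosen so that the leading term is chi times \<open>b n\<close> and the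
  term of order P^(-2) vanishes; what remains is O(P^(-3)), of order n^(-3/2).\<close>

lemma local_step:
  obtains C where "C > 0" "\<And>n k. 2 \<le> k \<Longrightarrow> 1 \<le> p (real n) \<Longrightarrow> 4 * F \<le> (p (real n))\<^sup>2 \<Longrightarrow>
     (\<And>t. \<bar>t\<bar> \<le> 1/2 \<Longrightarrow> \<bar>p (real n + t) - pi * real k\<bar> \<le> pi) \<Longrightarrow>
     cmod (om k * of_real (2 / F) * (Pr k (p (real n + 1/2) - pi * real k) - Pr k (p (real n - 1/2) - pi * real k))
       - of_real (chi (p (real n) - pi * real k)) * b n) \<le> C / p (real n) ^ 3"
proof -
  obtain M0 where M0: "M0 > 0" "\<And>r. \<bar>r\<bar> \<le> pi \<Longrightarrow> cmod (kap (of_real r)) \<le> M0"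
    "\<And>r. \<bar>r\<bar> \<le> pi \<Longrightarrow> cmod (deriv kap (of_real r)) \<le> M0" "\<And>r. \<bar>r\<bar> \<le> pi \<Longrightarrow> cmod (deriv (deriv kap) (of_real r)) \<le> M0"
    by (rule holomorphic_real_bound[OF kap_holomorphic]) (rule that)
  obtain M1 where M1: "M1 > 0" "\<And>r. \<bar>r\<bar> \<le> pi \<Longrightarrow> cmod (kap1 (of_real r)) \<le> M1"
    "\<And>r. \<bar>r\<bar> \<le> pi \<Longrightarrow> cmod (deriv kap1 (of_real r)) \<le> M1" "\<And>r. \<bar>r\<bar> \<le> pi \<Longrightarrow> cmod (deriv (deriv kap1) (of_real r)) \<le> M1"
    by (rule holomorphic_real_bound[OF kap1_holomorphic]) (rule that)
  \<comment> \<open>A single constant for all the bounds required by \<open>product_approx\<close>;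
    its summands are what the estimates below use up.\<close>
  define K where "K = 1 + 2 * F + 2 * F\<^sup>2 + M0 * (1 + F + 2 * F\<^sup>2) + M1 * (3 * F + 3 * F\<^sup>2)"
  have Kge: "1 \<le> K" "2 * F \<le> K" "2 * F\<^sup>2 \<le> K" "M0 * (1 + F + 2 * F\<^sup>2) + M1 * (3 * F + 3 * F\<^sup>2) \<le> K"
    using F_pos M0(1) M1(1) by (simp_all add: K_def add_nonneg_nonneg)
  show ?thesis
  proof (rule that)
    show "0 < 5 * K\<^sup>2" using Kge by simp
    fix n k :: nat assume k: "2 \<le> k" and P1: "1 \<le> p (real n)" and P2: "4 * F \<le> (p (real n))\<^sup>2"
      and rng: "\<And>t. \<bar>t\<bar> \<le> 1/2 \<Longrightarrow> \<bar>p (real n + t) - pi * real k\<bar> \<le> pi"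
    define P where "P = p (real n)"
    note PP = P1[folded P_def] P2[folded P_def] P_def
    have P0: "0 < P" "P \<noteq> 0" using PP by auto
    define q where "q t = p (real n + t)" for t
    define r where "r t = q t - pi * real k" for t
    define r0 where "r0 = P - pi * real k"
    have r0: "\<bar>r0\<bar> \<le> pi" using rng[of 0] by (simp add: r0_def P_def)
    have rt: "\<bar>r t\<bar> \<le> pi" if "\<bar>t\<bar> \<le> 1/2" for t using rng[OF that] by (simp add: r_def q_def)
    note ex = p_expansion[OF PP, folded q_def]
    have qpos: "0 < q t" if "\<bar>t\<bar> \<le> 1/2" for t using ex(2)[OF that] P0 by linarith
    define \<Phi> where "\<Phi> t = 4 / (3 * F) * q t ^ 3 - 2 * pi * real k * t" for t
    \<comment> \<open>The derivative of \<open>H\<close> below: the Jacobian F/(2q) turns the factor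
      2/F into 1/q.\<close>
    define H' where "H' t = exp (- \<i> * of_real (\<Phi> t)) * of_real (1 / q t) * (kap (of_real (r t)) + of_real F * kap1 (of_real (r t)) / of_real (q t))" for t
    define \<kappa> where "\<kappa> = kap (of_real r0)"
    define X where "X t = deriv kap (of_real r0) * of_real (F * t / 2) + of_real F * kap1 (of_real r0)" for t
    define A0 where "A0 t = exp (- \<i> * of_real (4 / (3 * F) * P ^ 3 + 2 * r0 * t))" for t
    \<comment> \<open>\<open>H'\<close> with each factor replaced by its expansion at t = 0. It is a
      combination of the integrands of \<open>box_moment\<close> and can be integrated
      exactly.\<close>
    define G' where "G' t = A0 t / of_real P * (\<kappa> + (X t - \<i> * of_real (F * t\<^sup>2 / 2) * \<kappa>) / of_real P)" for t
    have diff: "cmod (H' t - G' t) \<le> 5 * K\<^sup>2 / P ^ 3" if t: "\<bar>t\<bar> \<le> 1/2" for t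
    proof -
      define a where "a = exp (- \<i> * of_real (\<Phi> t)) / A0 t - (1 - \<i> * of_real ((F * t\<^sup>2 / 2) / P))"
      define d where "d = (kap (of_real (r t)) + of_real F * kap1 (of_real (r t)) / of_real (q t)) - (\<kappa> + X t / of_real P)"
      have nA: "cmod (exp (- \<i> * of_real (\<Phi> t))) = 1" "cmod (A0 t) = 1" by (simp_all add: A0_def norm_exp_eq_Re)
      have A00: "A0 t \<noteq> 0" using nA(2) by auto
      have t2: "t\<^sup>2 \<le> 1 / 4" using power_mono[OF t, of 2] by (simp add: power2_eq_square)
      define y where "y = F * t\<^sup>2 / 2 / P"
      have y0: "0 \<le> y" "y \<le> F / 8 / P" 
      proof -
        have "F * t\<^sup>2 \<le> F * (1 / 4)" using t2 F_pos by (intro mult_left_mono) auto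
        then show "y \<le> F / 8 / P" unfolding y_def using P0 by (intro divide_right_mono) auto
      qed (use F_pos P0 in \<open>simp add: y_def\<close>)
      have aK: "cmod a \<le> K / P\<^sup>2"
      proof -
        define th where "th = \<Phi> t - (4 / (3 * F) * P ^ 3 + 2 * r0 * t) - y"
        have th: "\<bar>th\<bar> \<le> F\<^sup>2 / P ^ 3"
          using phase_expansion[OF PP t, of k] unfolding th_def \<Phi>_def q_def r0_def y_def
          by (simp add: algebra_simps)
        have e1: "exp (- \<i> * of_real (\<Phi> t)) / A0 t = exp (- \<i> * of_real y) * exp (- \<i> * of_real th)"
          unfolding A0_def exp_diff[symmetric] exp_add[symmetric] th_def
          by (rule arg_cong[of _ _ exp]) (simp add: algebra_simps)
        have "a = exp (- \<i> * of_real y) * (exp (- \<i> * of_real th) - 1) + (exp (- \<i> * of_real y) - (1 - \<i> * of_real y))"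
          unfolding a_def e1 y_def by (simp add: algebra_simps)
        then have "cmod a \<le> cmod (exp (- \<i> * of_real y)) * cmod (exp (- \<i> * of_real th) - 1) + cmod (exp (- \<i> * of_real y) - (1 - \<i> * of_real y))"
          using norm_triangle_ineq by (metis norm_mult)
        also have "\<dots> \<le> 1 * \<bar>th\<bar> + y\<^sup>2 / 2"
          by (intro add_mono mult_mono exp_minus_i_approx) (auto simp: norm_exp_eq_Re)
        also have "\<dots> \<le> F\<^sup>2 / P ^ 3 + (F / 8 / P)\<^sup>2 / 2"
          using th y0 by (intro add_mono divide_right_mono power_mono) auto
        also have "\<dots> \<le> F\<^sup>2 / P\<^sup>2 + F\<^sup>2 / P\<^sup>2"
        proof (rule add_mono)
          show "F\<^sup>2 / P ^ 3 \<le> F\<^sup>2 / P\<^sup>2" using PP(1) P0 by (intro divide_left_mono power_increasing) auto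
          show "(F / 8 / P)\<^sup>2 / 2 \<le> F\<^sup>2 / P\<^sup>2" using F_pos P0 by (simp add: power_divide field_simps)
        qed
        also have "\<dots> = 2 * F\<^sup>2 / P\<^sup>2" by simp
        also have "\<dots> \<le> K / P\<^sup>2" using Kge P0 by (intro divide_right_mono) auto
        finally show ?thesis .
      qed
      have bK: "\<bar>1 / q t - 1 / P\<bar> \<le> K / P ^ 3"
        using ex(5)[OF t] Kge(2) P0 by (intro order_trans[OF ex(5)[OF t]] divide_right_mono) auto
      have dr: "\<bar>r t - r0\<bar> \<le> F / P" using ex(3)[OF t] by (simp add: r_def r0_def)
      have D1: "cmod (kap (of_real (r t)) - \<kappa> - deriv kap (of_real r0) * of_real (r t - r0)) \<le> M0 * (F\<^sup>2 / P\<^sup>2)"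
      proof -
        have "cmod (kap (of_real (r t)) - \<kappa> - deriv kap (of_real r0) * of_real (r t - r0)) \<le> M0 * (r t - r0)\<^sup>2"
          unfolding \<kappa>_def by (rule Taylor_kapU(2)[OF kap_holomorphic M0(3,4) r0 rt[OF t]])
        also have "(r t - r0)\<^sup>2 \<le> (F / P)\<^sup>2" using power_mono[OF dr, of 2] by simp
        finally show ?thesis using M0(1) by (simp add: power_divide)
      qed
      have D2: "cmod (deriv kap (of_real r0) * of_real (r t - r0 - F * t / (2 * P))) \<le> M0 * (F\<^sup>2 / P\<^sup>2)"
      proof -
        have "\<bar>r t - r0 - F * t / (2 * P)\<bar> \<le> F\<^sup>2 / P ^ 3" using ex(4)[OF t] by (simp add: r_def r0_def)
        also have "\<dots> \<le> F\<^sup>2 / P\<^sup>2" using PP(1) P0 by (intro divide_left_mono power_increasing) auto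
        finally show ?thesis unfolding norm_mult norm_of_real using M0 r0 by (intro mult_mono) auto
      qed
      have D3: "cmod (of_real F * (kap1 (of_real (r t)) - kap1 (of_real r0)) / of_real P) \<le> M1 * (F\<^sup>2 / P\<^sup>2)"
      proof -
        have "cmod (kap1 (of_real (r t)) - kap1 (of_real r0)) \<le> M1 * \<bar>r t - r0\<bar>"
          by (rule Taylor_kapU(1)[OF kap1_holomorphic M1(3,4) r0 rt[OF t]])
        also have "\<dots> \<le> M1 * (F / P)" using dr M1(1) by (intro mult_left_mono) auto
        finally have "F * cmod (kap1 (of_real (r t)) - kap1 (of_real r0)) / P \<le> F * (M1 * (F / P)) / P"
          using F_pos P0 by (intro divide_right_mono mult_left_mono) auto
        then show ?thesis using F_pos P0 by (simp add: norm_mult norm_divide power2_eq_square mult_ac)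
      qed
      have D4: "cmod (of_real F * kap1 (of_real (r t)) * of_real (1 / q t - 1 / P)) \<le> M1 * (2 * F\<^sup>2 / P\<^sup>2)"
      proof -
        have "\<bar>1 / q t - 1 / P\<bar> \<le> 2 * F / P\<^sup>2"
          using PP(1) P0 F_pos by (intro order_trans[OF ex(5)[OF t]] divide_left_mono power_increasing) auto
        then have "F * cmod (kap1 (of_real (r t))) * \<bar>1 / q t - 1 / P\<bar> \<le> F * M1 * (2 * F / P\<^sup>2)"
          using F_pos M1 rt[OF t] by (intro mult_mono) auto
        moreover have "cmod (of_real F * kap1 (of_real (r t)) * of_real (1 / q t - 1 / P)) = F * cmod (kap1 (of_real (r t))) * \<bar>1 / q t - 1 / P\<bar>"
          unfolding norm_mult norm_of_real using F_pos by simp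
        ultimately show ?thesis by (simp add: power2_eq_square mult_ac)
      qed
      have deq: "d = (kap (of_real (r t)) - \<kappa> - deriv kap (of_real r0) * of_real (r t - r0))
          + deriv kap (of_real r0) * of_real (r t - r0 - F * t / (2 * P))
          + of_real F * (kap1 (of_real (r t)) - kap1 (of_real r0)) / of_real P
          + of_real F * kap1 (of_real (r t)) * of_real (1 / q t - 1 / P)"
        unfolding d_def X_def by (simp add: algebra_simps add_divide_distrib diff_divide_distrib)
      have dK: "cmod d \<le> K / P\<^sup>2"
      proof -
        have "cmod d \<le> M0 * (F\<^sup>2 / P\<^sup>2) + M0 * (F\<^sup>2 / P\<^sup>2) + M1 * (F\<^sup>2 / P\<^sup>2) + M1 * (2 * F\<^sup>2 / P\<^sup>2)"
          unfolding deq by (intro order_trans[OF norm_triangle_ineq] add_mono D1 D2 D3 D4)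
        also have "\<dots> = (M0 * (2 * F\<^sup>2) + M1 * (3 * F\<^sup>2)) / P\<^sup>2" by (simp add: add_divide_distrib algebra_simps)
        also have "\<dots> \<le> K / P\<^sup>2"
        proof (rule divide_right_mono)
          have "0 \<le> M0 * (1 + F)" "0 \<le> M1 * (3 * F)" using M0(1) M1(1) F_pos by auto
          then show "M0 * (2 * F\<^sup>2) + M1 * (3 * F\<^sup>2) \<le> K" using Kge(4) by (simp add: algebra_simps)
        qed simp
        finally show ?thesis .
      qed
      have MF: "0 \<le> M0 * F" "0 \<le> M0 * F\<^sup>2" "0 \<le> M1 * F" "0 \<le> M1 * F\<^sup>2" using M0(1) M1(1) F_pos by auto
      have DK: "cmod (kap (of_real (r t)) + of_real F * kap1 (of_real (r t)) / of_real (q t)) \<le> K"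
      proof -
        have "P / 2 \<le> q t" by (rule ex(2)[OF t])
        then have "1 / 2 \<le> q t" using PP(1) by linarith
        then have "cmod (of_real F * kap1 (of_real (r t)) / of_real (q t)) \<le> F * M1 / (1/2)"
          unfolding norm_mult norm_divide norm_of_real using F_pos M1 rt[OF t] by (intro frac_le mult_mono) auto
        then have "cmod (kap (of_real (r t)) + of_real F * kap1 (of_real (r t)) / of_real (q t)) \<le> M0 + F * M1 / (1/2)"
          by (intro order_trans[OF norm_triangle_ineq] add_mono M0 rt t)
        also have "\<dots> \<le> K" using Kge(4) MF by (simp add: algebra_simps)
        finally show ?thesis .
      qed
      have XK: "cmod (X t) \<le> K"
      proof -
        have "cmod (deriv kap (of_real r0) * of_real (F * t / 2)) \<le> M0 * F"
        proof -
          have "\<bar>F * t / 2\<bar> \<le> F" using t F_pos by (simp add: abs_mult)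
          then show ?thesis unfolding norm_mult norm_of_real using M0 r0 by (intro mult_mono) auto
        qed
        moreover have "cmod (of_real F * kap1 (of_real r0)) \<le> F * M1"
          using F_pos M1 r0 by (simp add: norm_mult)
        ultimately have "cmod (X t) \<le> M0 * F + F * M1" 
          unfolding X_def by (intro order_trans[OF norm_triangle_ineq] add_mono)
        also have "\<dots> = M0 * F + M1 * F" by simp
        also have "\<dots> \<le> M0 + M0 * F + 2 * (M0 * F\<^sup>2) + 3 * (M1 * F) + 3 * (M1 * F\<^sup>2)"
          using MF M0(1) by linarith
        also have "\<dots> \<le> K" using Kge(4) by (simp add: algebra_simps)
        finally show ?thesis .
      qed
      have kK: "cmod \<kappa> \<le> K"
        using M0(2)[OF r0] Kge(4) MF unfolding \<kappa>_def by (simp add: algebra_simps)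
      have sK: "\<bar>F * t\<^sup>2 / 2\<bar> \<le> K"
      proof -
        have "F * t\<^sup>2 \<le> F * (1 / 4)" using t2 F_pos by (intro mult_left_mono) auto
        moreover have "0 \<le> F * t\<^sup>2" using F_pos by simp
        ultimately show ?thesis using Kge(2) F_pos by linarith
      qed
      show ?thesis
        unfolding H'_def G'_def
        by (rule product_approx[OF PP(1) Kge(1) nA _ _ _ aK bK dK DK XK kK sK])
           (use A00 in \<open>simp_all add: a_def d_def\<close>)
    qed
    define H where "H t = om k * of_real (2 / F) * Pr k (r t)" for t
    have H_int: "(H' has_integral (H (1/2) - H (-1/2))) {-1/2..1/2}"
    proof (rule fundamental_theorem_of_calculus)
      fix t :: real assume "t \<in> {-1/2..1/2}"
      then have t: "\<bar>t\<bar> \<le> 1/2" by auto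
      have rd: "(r has_vector_derivative F / (2 * q t)) (at t within {-1/2..1/2})"
      proof -
        have "((\<lambda>t. p (real n + t)) has_real_derivative F / (2 * p (real n + t)) * 1) (at t within {-1/2..1/2})"
          by (rule DERIV_chain2[where f = p and g = "\<lambda>t. real n + t", OF p_has_derivative[OF ex(1)[OF t]]]) (auto intro!: derivative_eq_intros)
        then show ?thesis unfolding r_def[abs_def] q_def has_real_derivative_iff_has_vector_derivative[symmetric]
          by (auto intro!: derivative_eq_intros)
      qed
      have "(Pr k has_vector_derivative W k (r t) * Eo k (r t)) (at (r t) within r ` {-1/2..1/2})"
      proof (rule has_vector_derivative_within_subset[OF Pr_has_vector_derivative[OF k rt[OF t]]])
        show "r ` {-1/2..1/2} \<subseteq> {-pi..pi}"
        proof safe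
          fix s :: real assume "s \<in> {-1/2..1/2}"
          then have "\<bar>s\<bar> \<le> 1/2" by auto
          from rt[OF this] show "r s \<in> {-pi..pi}" by auto
        qed
      qed
      from vector_diff_chain_within[OF rd this]
      have "((\<lambda>t. Pr k (r t)) has_vector_derivative (F / (2 * q t)) *\<^sub>R (W k (r t) * Eo k (r t))) (at t within {-1/2..1/2})"
        by (simp add: o_def)
      from has_vector_derivative_mult_right[OF this, of "om k * of_real (2 / F)"]
      have "(H has_vector_derivative om k * of_real (2 / F) * ((F / (2 * q t)) *\<^sub>R (W k (r t) * Eo k (r t)))) (at t within {-1/2..1/2})"
        by (simp add: H_def[abs_def])
      moreover have "om k * of_real (2 / F) * ((F / (2 * q t)) *\<^sub>R (W k (r t) * Eo k (r t))) = H' t"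
      proof -
        have oE: "om k * Eo k (r t) = exp (- \<i> * of_real (\<Phi> t))"
          using om_Eo[OF ex(1)[OF t], of k] by (simp add: r_def q_def \<Phi>_def)
        have "om k * of_real (2 / F) * ((F / (2 * q t)) *\<^sub>R (W k (r t) * Eo k (r t))) = (om k * Eo k (r t)) * of_real (1 / q t) * W k (r t)"
          using F_pos qpos[OF t] by (simp add: scaleR_conv_of_real field_simps)
        then show ?thesis unfolding oE H'_def W_def by (simp add: r_def)
      qed
      ultimately show "(H has_vector_derivative H' t) (at t within {-1/2..1/2})" by simp
    qed simp
    have G_int: "(G' has_integral (of_real (chi r0) * b n)) {-1/2..1/2}"
    proof -
      define c where "c = exp (- \<i> * of_real (4 / (3 * F) * P ^ 3)) / of_real P"
      have E: "exp (- 2 * \<i> * of_real r0 * of_real t) * c = A0 t / of_real P" for t :: real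
        unfolding c_def A0_def times_divide_eq_right exp_add[symmetric]
        by (rule arg_cong2[of _ _ _ _ "(/)"]) (auto intro!: arg_cong[of _ _ exp] simp: algebra_simps)
      let ?m = "\<lambda>j t. of_real t ^ j * exp (- 2 * \<i> * of_real r0 * of_real t)"
      have int: "((\<lambda>t. c * (\<kappa> * ?m 0 t + (deriv kap (of_real r0) * of_real (F / 2) * ?m 1 t + of_real F * kap1 (of_real r0) * ?m 0 t
            - \<i> * of_real (F / 2) * \<kappa> * ?m 2 t) / of_real P)) has_integral
          c * (\<kappa> * box_moment 0 (of_real r0) + (deriv kap (of_real r0) * of_real (F / 2) * box_moment 1 (of_real r0)
            + of_real F * kap1 (of_real r0) * box_moment 0 (of_real r0) - \<i> * of_real (F / 2) * \<kappa> * box_moment 2 (of_real r0)) / of_real P)) {-1/2..1/2}"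
        by (intro has_integral_add has_integral_diff has_integral_mult_right has_integral_divide has_integral_box_moment)
      \<comment> \<open>The equation solved by \<open>kap1\<close>, multiplied by F: it cancels the
        whole bracket over P.\<close>
      have k1: "of_real F * kap1 (of_real r0) * box_moment 0 (of_real r0)
          = - (deriv kap (of_real r0) * of_real (F / 2) * box_moment 1 (of_real r0) - \<i> * of_real (F / 2) * \<kappa> * box_moment 2 (of_real r0))"
      proof -
        have "of_real r0 \<in> kapU" using r0 real_subset_kapU by (auto simp: abs_le_iff)
        then show ?thesis
          unfolding mult.assoc[of "of_real F" "kap1 (of_real r0)"] \<kappa>_def by (simp add: kap1_box_moment algebra_simps)
      qed
      have v: "c * (\<kappa> * box_moment 0 (of_real r0) + (deriv kap (of_real r0) * of_real (F / 2) * box_moment 1 (of_real r0)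
            + of_real F * kap1 (of_real r0) * box_moment 0 (of_real r0) - \<i> * of_real (F / 2) * \<kappa> * box_moment 2 (of_real r0)) / of_real P) = of_real (chi r0) * b n"
        unfolding k1 using kap_chi[OF r0] by (simp add: \<kappa>_def b_def c_def P_def mult.commute)
      show ?thesis
      proof (rule has_integral_eq[OF _ int[unfolded v]])
        fix t :: real
        show "c * (\<kappa> * ?m 0 t + (deriv kap (of_real r0) * of_real (F / 2) * ?m 1 t + of_real F * kap1 (of_real r0) * ?m 0 t
            - \<i> * of_real (F / 2) * \<kappa> * ?m 2 t) / of_real P) = G' t"
          unfolding G'_def E[symmetric] X_def by (simp add: algebra_simps power2_eq_square add_divide_distrib diff_divide_distrib)
      qed
    qed
    have "norm ((H (1/2) - H (-1/2)) - of_real (chi r0) * b n) \<le> 5 * K\<^sup>2 / P ^ 3"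
    proof -
      have "norm ((H (1/2) - H (-1/2)) - of_real (chi r0) * b n) \<le> 5 * K\<^sup>2 / P ^ 3 * measure lborel {-1/2..1/2::real}"
        by (rule has_integral_bound_real[OF _ finite.emptyI has_integral_diff[OF H_int G_int]])
           (use diff Kge P0 in \<open>auto simp: abs_le_iff\<close>)
      then show ?thesis by simp
    qed
    then show "cmod (om k * of_real (2 / F) * (Pr k (p (real n + 1/2) - pi * real k) - Pr k (p (real n - 1/2) - pi * real k))
       - of_real (chi (p (real n) - pi * real k)) * b n) \<le> 5 * K\<^sup>2 / p (real n) ^ 3"
      by (simp add: H_def r_def q_def P_def r0_def algebra_simps)
  qed
qed

end

section \<open>Summing the completed resonance integrals by parts\<close>

lemma inv_sqrt_telescope:
  assumes "1 \<le> x"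
  shows "1 / (x * sqrt x) \<le> 4 * (1 / sqrt x - 1 / sqrt (x + 1))"
proof -
  define a where "a = sqrt x" define b where "b = sqrt (x + 1)"
  have ab: "1 \<le> a" "a \<le> b" "a\<^sup>2 = x" "b\<^sup>2 = x + 1" using assms by (auto simp: a_def b_def)
  \<comment> \<open>The crude ratio 3/2 gives the factor 3/2 * 5/2 = 15/4, which the constant 4
    absorbs.\<close>
  have b2: "b \<le> 3/2 * a"
    by (rule power2_le_imp_le) (use ab assms in \<open>auto simp: power_mult_distrib power_divide\<close>)
  have "1 / a - 1 / b = 1 / (a * b * (a + b))"
  proof -
    have "(b - a) * (a + b) = 1" using ab by (simp add: algebra_simps power2_eq_square)
    then have "b - a = 1 / (a + b)" using ab by (simp add: field_simps)
    moreover have "1 / a - 1 / b = (b - a) / (a * b)" using ab by (simp add: field_simps)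
    ultimately show ?thesis using ab by simp
  qed
  moreover have "a * b * (a + b) \<le> a * (3/2 * a) * (a + 3/2 * a)"
    using ab b2 by (intro mult_mono) auto
  then have "1 / (a * (3/2 * a) * (a + 3/2 * a)) \<le> 1 / (a * b * (a + b))"
    using ab by (intro divide_left_mono) (auto intro!: mult_pos_pos)
  then have "4 * (1 / (a * (3/2 * a) * (a + 3/2 * a))) \<le> 4 * (1 / (a * b * (a + b)))" by (intro mult_left_mono) auto
  moreover have "1 / (x * a) \<le> 4 * (1 / (a * (3/2 * a) * (a + 3/2 * a)))"
    using ab by (simp add: field_simps power2_eq_square flip: ab(3))
  ultimately show ?thesis unfolding a_def[symmetric] b_def[symmetric] using order_trans by metis
qed

lemma sum_inv_sqrt_bound:
  assumes "1 \<le> K"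
  shows "(\<Sum>k\<in>{K..<L}. 1 / (real k * sqrt (real k))) \<le> 4 / sqrt (real K)"
proof (cases "K \<le> L")
  case True
  have "(\<Sum>k\<in>{K..<L}. 1 / (real k * sqrt (real k))) \<le> (\<Sum>k\<in>{K..<L}. 4 * (1 / sqrt (real k) - 1 / sqrt (real (Suc k))))"
  proof (rule sum_mono)
    fix k assume "k \<in> {K..<L}"
    then show "1 / (real k * sqrt (real k)) \<le> 4 * (1 / sqrt (real k) - 1 / sqrt (real (Suc k)))"
      using inv_sqrt_telescope[of "real k"] assms by (simp add: add.commute)
  qed
  also have "\<dots> = 4 * (1 / sqrt (real K) - 1 / sqrt (real L))"
    unfolding sum_distrib_left[symmetric]
    using sum_Suc_diff'[OF True, of "\<lambda>k. - (1 / sqrt (real k))"] by simp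
  also have "\<dots> \<le> 4 / sqrt (real K)" by simp
  finally show ?thesis .
qed simp

locale osc_res = osc_sum +
  fixes Bd :: real
  assumes om_bdd: "\<And>K L. cmod (\<Sum>k\<in>{K..<L}. om k) \<le> Bd"
begin

definition S :: "nat \<Rightarrow> complex" where
  "S k = om k * of_real (2 / F) * Jv k"

text \<open>The resonances still to come. Its increment is \<open>S K\<close>, so it is the null
  sequence whose differences remove the jumps in the second substitution.\<close>

definition tail :: "nat \<Rightarrow> complex" where
  "tail K = (\<Sum>j. S (j + K))"

lemma Bd_nonneg: "0 \<le> Bd"
  using om_bdd[of 0 0] by simp

text \<open>Abel summation: the partial sums of \<open>om\<close> are bounded, and \<open>Jv\<close>
  is O(k^(-1/2)) with increments O(k^(-3/2)). The terms of \<open>S\<close> are only O(k^(-1/2)), so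
  the hypothesis on \<open>om\<close> is what produces convergence.\<close>

lemma sum_S_bound:
  obtains C where "C > 0" "\<And>K L. 2 \<le> K \<Longrightarrow> cmod (\<Sum>k\<in>{K..<L}. S k) \<le> C / sqrt (real K)"
proof -
  obtain C1 where C1: "C1 > 0" "\<And>k. 2 \<le> k \<Longrightarrow> cmod (Jv k) \<le> C1 / sqrt (real k)"
    by (rule Jv_bound) (rule that)
  obtain C2 where C2: "C2 > 0" "\<And>k. 2 \<le> k \<Longrightarrow> cmod (Jv k - Jv (Suc k)) \<le> C2 / (real k * sqrt (real k))"
    by (rule Jv_diff_bound) (rule that)
  have "0 < (Bd + 1) * C1" "0 < (Bd + 1) * (4 * C2)" using Bd_nonneg C1(1) C2(1) by simp_all
  then have pos: "0 < 2 / F * ((Bd + 1) * C1 + (Bd + 1) * (4 * C2))"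
    using F_pos by (intro mult_pos_pos[of "2 / F"] add_pos_pos) (simp_all only: divide_pos_pos zero_less_numeral)
  show ?thesis
  proof (rule that)
    show "0 < 2 / F * ((Bd + 1) * C1 + (Bd + 1) * (4 * C2))"
      by (rule pos)
    fix K L :: nat assume K: "2 \<le> K"
    show "cmod (\<Sum>k\<in>{K..<L}. S k) \<le> 2 / F * ((Bd + 1) * C1 + (Bd + 1) * (4 * C2)) / sqrt (real K)"
    proof (cases "K \<le> L")
      case True
      define T where "T j = (\<Sum>k\<in>{K..<j}. om k)" for j
      have T: "cmod (T j) \<le> Bd + 1" for j unfolding T_def using om_bdd[of K j] by simp
      have abel: "(\<Sum>k\<in>{K..<j}. om k * Jv k) = T j * Jv j + (\<Sum>k\<in>{K..<j}. T (Suc k) * (Jv k - Jv (Suc k)))" if "K \<le> j" for j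
        using that
      proof (induction j rule: dec_induct)
        case base show ?case by (simp add: T_def)
      next
        case (step n)
        have "T (Suc n) = T n + om n" using step by (simp add: T_def)
        then show ?case using step by (simp add: algebra_simps)
      qed
      have sL: "0 < sqrt (real K)" "sqrt (real K) \<le> sqrt (real L)" using K True by auto
      have "cmod (\<Sum>k\<in>{K..<L}. om k * Jv k) \<le> (Bd + 1) * (C1 / sqrt (real K)) + (\<Sum>k\<in>{K..<L}. (Bd + 1) * (C2 * (1 / (real k * sqrt (real k)))))"
        unfolding abel[OF True]
      proof (rule order_trans[OF norm_triangle_ineq add_mono])
        have "cmod (Jv L) \<le> C1 / sqrt (real L)" using C1(2) K True by simp
        also have "\<dots> \<le> C1 / sqrt (real K)" using sL C1(1) by (intro divide_left_mono) auto
        finally show "cmod (T L * Jv L) \<le> (Bd + 1) * (C1 / sqrt (real K))"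
          unfolding norm_mult using T Bd_nonneg by (intro mult_mono) auto
        show "cmod (\<Sum>k\<in>{K..<L}. T (Suc k) * (Jv k - Jv (Suc k))) \<le> (\<Sum>k\<in>{K..<L}. (Bd + 1) * (C2 * (1 / (real k * sqrt (real k)))))"
        proof (rule sum_norm_le)
          fix k assume "k \<in> {K..<L}"
          then have "cmod (Jv k - Jv (Suc k)) \<le> C2 * (1 / (real k * sqrt (real k)))" using C2(2)[of k] K by simp
          then show "cmod (T (Suc k) * (Jv k - Jv (Suc k))) \<le> (Bd + 1) * (C2 * (1 / (real k * sqrt (real k))))"
            unfolding norm_mult using T Bd_nonneg by (intro mult_mono) auto
        qed
      qed
      also have "(\<Sum>k\<in>{K..<L}. (Bd + 1) * (C2 * (1 / (real k * sqrt (real k))))) = (Bd + 1) * (C2 * (\<Sum>k\<in>{K..<L}. 1 / (real k * sqrt (real k))))"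
        by (simp add: sum_distrib_left)
      also have "\<dots> \<le> (Bd + 1) * (C2 * (4 / sqrt (real K)))"
        using sum_inv_sqrt_bound[of K L] K C2(1) Bd_nonneg by (intro mult_left_mono) auto
      finally have *: "cmod (\<Sum>k\<in>{K..<L}. om k * Jv k) \<le> ((Bd + 1) * C1 + (Bd + 1) * (4 * C2)) / sqrt (real K)"
        by (simp add: add_divide_distrib mult_ac)
      have "(\<Sum>k\<in>{K..<L}. S k) = of_real (2 / F) * (\<Sum>k\<in>{K..<L}. om k * Jv k)"
        unfolding S_def sum_distrib_left by (simp add: mult_ac)
      then have "cmod (\<Sum>k\<in>{K..<L}. S k) = 2 / F * cmod (\<Sum>k\<in>{K..<L}. om k * Jv k)"
        using F_pos by (simp add: norm_mult norm_divide)
      also have "\<dots> \<le> 2 / F * (((Bd + 1) * C1 + (Bd + 1) * (4 * C2)) / sqrt (real K))"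
        using F_pos by (intro mult_left_mono *) auto
      finally show ?thesis by simp
    next
      case False
      then have "{K..<L} = {}" by simp
      then show ?thesis unfolding norm_zero
        by (simp only: sum.empty norm_zero) (intro divide_nonneg_nonneg less_imp_le[OF pos], simp)
    qed
  qed
qed

lemma summable_S: "summable S"
proof -
  obtain C where C: "C > 0" "\<And>K L. 2 \<le> K \<Longrightarrow> cmod (\<Sum>k\<in>{K..<L}. S k) \<le> C / sqrt (real K)"
    by (rule sum_S_bound) (rule that)
  have lim: "(\<lambda>n. C / sqrt (real n)) \<longlonglongrightarrow> 0"
    by real_asymp
  show ?thesis
    unfolding summable_Cauchy
  proof (intro allI impI)
    fix e :: real assume "0 < e"
    then have "eventually (\<lambda>n. C / sqrt (real n) < e) sequentially"
      using order_tendstoD(2)[OF lim] by simp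
    then obtain N where N: "\<And>n. n \<ge> N \<Longrightarrow> C / sqrt (real n) < e" unfolding eventually_sequentially by blast
    show "\<exists>N. \<forall>m\<ge>N. \<forall>n. norm (sum S {m..<n}) < e"
    proof (intro exI allI impI)
      fix m n assume "max N 2 \<le> m"
      then show "norm (sum S {m..<n}) < e" using C(2)[of m n] N[of m] by simp
    qed
  qed
qed

lemma tail_Suc: "tail K = S K + tail (Suc K)"
proof -
  have "summable (\<lambda>j. S (j + K))" using summable_S by (simp add: summable_iff_shift)
  from suminf_split_head[OF this] show ?thesis by (simp add: tail_def)
qed

lemma tail_bound:
  obtains C where "C > 0" "\<And>K. 2 \<le> K \<Longrightarrow> cmod (tail K) \<le> C / sqrt (real K)"
proof -
  obtain C where C: "C > 0" "\<And>K L. 2 \<le> K \<Longrightarrow> cmod (\<Sum>k\<in>{K..<L}. S k) \<le> C / sqrt (real K)"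
    by (rule sum_S_bound) (rule that)
  show ?thesis
  proof (rule that[OF C(1)])
    fix K :: nat assume K: "2 \<le> K"
    have "summable (\<lambda>j. S (j + K))" using summable_S by (simp add: summable_iff_shift)
    then have "(\<lambda>n. \<Sum>j<n. S (j + K)) \<longlonglongrightarrow> tail K" unfolding tail_def by (rule summable_LIMSEQ)
    moreover have "cmod (\<Sum>j<n. S (j + K)) \<le> C / sqrt (real K)" for n
    proof -
      have "(\<Sum>j<n. S (j + K)) = (\<Sum>k\<in>{K..<n + K}. S k)"
        using sum.shift_bounds_nat_ivl[of S 0 K n] by (simp add: atLeast0LessThan)
      then show ?thesis using C(2)[OF K] by simp
    qed
    ultimately show "cmod (tail K) \<le> C / sqrt (real K)"
      by (intro LIMSEQ_le_const2[OF tendsto_norm]) auto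
  qed
qed

text \<open>Both amplitudes vanish at +-pi, so the integrand is at most linear in the distance from
  the end of the window and the truncated integral is quadratic. At a jump this distance is O(1/p),
  which turns the truncated pieces into O(p^(-2)).\<close>

lemma Pr_edge:
  obtains C where "C > 0" "\<And>k r. 2 \<le> k \<Longrightarrow> r \<in> {-pi..pi} \<Longrightarrow> cmod (Pr k pi - Pr k r) \<le> C * (pi - r)\<^sup>2"
    "\<And>k r. 2 \<le> k \<Longrightarrow> r \<in> {-pi..pi} \<Longrightarrow> cmod (Pr k r) \<le> C * (pi + r)\<^sup>2"
proof -
  obtain M0 where M0: "M0 > 0" "\<And>r. \<bar>r\<bar> \<le> pi \<Longrightarrow> cmod (deriv kap (of_real r)) \<le> M0" "\<And>r. \<bar>r\<bar> \<le> pi \<Longrightarrow> cmod (deriv (deriv kap) (of_real r)) \<le> M0"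
    by (rule holomorphic_real_bound[OF kap_holomorphic]) (rule that)
  obtain M1 where M1: "M1 > 0" "\<And>r. \<bar>r\<bar> \<le> pi \<Longrightarrow> cmod (deriv kap1 (of_real r)) \<le> M1" "\<And>r. \<bar>r\<bar> \<le> pi \<Longrightarrow> cmod (deriv (deriv kap1) (of_real r)) \<le> M1"
    by (rule holomorphic_real_bound[OF kap1_holomorphic]) (rule that)
  define C where "C = M0 + F * M1"
  have C0: "C > 0" unfolding C_def using M0(1) M1(1) F_pos by (simp add: add_pos_pos)
  have Wb: "cmod (W k r) \<le> C * \<bar>r - s\<bar>" if k: "2 \<le> k" and r: "\<bar>r\<bar> \<le> pi" and s: "s = pi \<or> s = -pi" for k r s
  proof -
    have sp: "\<bar>s\<bar> \<le> pi" using s by auto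
    have z: "kap (of_real s) = 0" "kap1 (of_real s) = 0" using s kap_pi by auto
    have 1: "cmod (kap (of_real r)) \<le> M0 * \<bar>r - s\<bar>"
      using Taylor_kapU(1)[OF kap_holomorphic M0(2,3) sp r] z by simp
    have 2: "cmod (kap1 (of_real r)) \<le> M1 * \<bar>r - s\<bar>"
      using Taylor_kapU(1)[OF kap1_holomorphic M1(2,3) sp r] z by simp
    have "1 \<le> pi * real k + r" using shift_bounds(1)[OF k r] k by linarith
    then have "cmod (of_real F * kap1 (of_real r) / of_real (pi * real k + r)) \<le> F * (M1 * \<bar>r - s\<bar>) / 1"
      unfolding norm_mult norm_divide norm_of_real using F_pos 2 M1(1) by (intro frac_le mult_mono) auto
    then show ?thesis
      unfolding W_def C_def using norm_triangle_ineq[of "kap (of_real r)" "of_real F * kap1 (of_real r) / of_real (pi * real k + r)"] 1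
      by (simp add: algebra_simps)
  qed
  have edge: "cmod (Pr k s - Pr k r) \<le> C * (s - r)\<^sup>2" if k: "2 \<le> k" and r: "r \<in> {-pi..pi}" and s: "s = pi \<or> s = -pi" for k r s
  proof -
    have sub: "closed_segment r s \<subseteq> {-pi..pi}" using r s pi_ge_zero by (auto simp: closed_segment_eq_real_ivl split: if_splits)
    have "norm (Pr k s - Pr k r) \<le> (C * \<bar>s - r\<bar>) * norm (s - r)"
    proof (rule differentiable_bound[of "closed_segment r s" "Pr k" "\<lambda>x h. h *\<^sub>R (W k x * Eo k x)"])
      fix x assume x: "x \<in> closed_segment r s"
      then have x': "\<bar>x\<bar> \<le> pi" using sub by (auto simp: abs_le_iff)
      have "(Pr k has_vector_derivative W k x * Eo k x) (at x within closed_segment r s)"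
        by (rule has_vector_derivative_within_subset[OF Pr_has_vector_derivative[OF k x'] sub])
      then show "(Pr k has_derivative (\<lambda>h. h *\<^sub>R (W k x * Eo k x))) (at x within closed_segment r s)"
        by (simp add: has_vector_derivative_def)
      have "\<bar>x - s\<bar> \<le> \<bar>s - r\<bar>" using x by (auto simp: closed_segment_eq_real_ivl split: if_splits)
      then have "cmod (W k x) \<le> C * \<bar>s - r\<bar>"
        using Wb[OF k x' s] C0 by (meson mult_left_mono less_imp_le order_trans)
      then show "onorm (\<lambda>h. h *\<^sub>R (W k x * Eo k x)) \<le> C * \<bar>s - r\<bar>"
        by (intro onorm_le) (auto simp: norm_mult cmod_Eo mult.commute[of "C * \<bar>s - r\<bar>"] intro: mult_left_mono)
    qed auto
    then show ?thesis by (simp add: power2_eq_square abs_mult_self_eq mult.assoc)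
  qed
  have P0: "Pr k (-pi) = 0" for k by (simp add: Pr_def)
  show ?thesis
  proof (rule that[OF C0])
    fix k :: nat and r :: real assume k: "2 \<le> k" and r: "r \<in> {-pi..pi}"
    show "cmod (Pr k pi - Pr k r) \<le> C * (pi - r)\<^sup>2" using edge[OF k r, of pi] by simp
    show "cmod (Pr k r) \<le> C * (pi + r)\<^sup>2" using edge[OF k r, of "-pi"] P0[of k] by (simp add: power2_eq_square algebra_simps)
  qed
qed

text \<open>The index mi n is that of the first resonance not passed at time $n - \frac12$. Only the integrals of the two
  resonances whose windows contain $p(n-\frac12)$ are incomplete, and Q collects their defects.\<close>

definition mi :: "nat \<Rightarrow> nat" where
  "mi n = nat \<lceil>p (real n - 1/2) / pi\<rceil>"

definition R :: "nat \<Rightarrow> real \<Rightarrow> complex" where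
  "R k r = om k * of_real (2 / F) * (Pr k pi - Pr k r)"

definition L :: "nat \<Rightarrow> real \<Rightarrow> complex" where
  "L k r = om k * of_real (2 / F) * Pr k r"

definition Q :: "nat \<Rightarrow> complex" where
  "Q n = R (mi n - 1) (p (real n - 1/2) - pi * real (mi n - 1)) - L (mi n) (p (real n - 1/2) - pi * real (mi n))"

end

lemma card_real_ball_le:
  assumes "0 \<le> l"
  shows "finite {n::nat. \<bar>real n - x\<bar> \<le> l}" "real (card {n::nat. \<bar>real n - x\<bar> \<le> l}) \<le> 2 * l + 1"
proof -
  let ?S = "{n::nat. \<bar>real n - x\<bar> \<le> l}"
  have sub: "int ` ?S \<subseteq> {\<lceil>x - l\<rceil>..\<lfloor>x + l\<rfloor>}"
    by (auto simp: abs_le_iff ceiling_le_iff le_floor_iff)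
  then have fin: "finite (int ` ?S)" by (rule finite_subset) simp
  then show "finite ?S" by (rule finite_imageD) simp
  have "card ?S = card (int ` ?S)" by (simp add: card_image)
  also have "\<dots> \<le> card {\<lceil>x - l\<rceil>..\<lfloor>x + l\<rfloor>}" by (rule card_mono[OF _ sub]) simp
  also have "\<dots> = nat (\<lfloor>x + l\<rfloor> - \<lceil>x - l\<rceil> + 1)" by simp
  finally have "real (card ?S) \<le> real (nat (\<lfloor>x + l\<rfloor> - \<lceil>x - l\<rceil> + 1))" by simp
  also have "\<dots> \<le> 2 * l + 1"
  proof (cases "0 \<le> \<lfloor>x + l\<rfloor> - \<lceil>x - l\<rceil> + 1")
    case True
    then have "real (nat (\<lfloor>x + l\<rfloor> - \<lceil>x - l\<rceil> + 1)) = of_int \<lfloor>x + l\<rfloor> - of_int \<lceil>x - l\<rceil> + 1" by simp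
    then show ?thesis using of_int_floor_le[of "x + l"] le_of_int_ceiling[of "x - l"] by linarith
  qed (use assms in simp)
  finally show "real (card ?S) \<le> 2 * l + 1" .
qed

text \<open>The complement of \<open>chi\<close> is its own translate and carries a factor sin
  (r/2). A linear bound suffices: it is applied with r = O(1/p) against |b n| = 1/p.\<close>

lemma one_minus_chi: "\<bar>1 - chi r\<bar> \<le> 2 * \<bar>r\<bar>"
proof -
  have "chi (r + pi) = sin (r / 2) ^ 4 * (3 - 2 * sin (r / 2) ^ 2)"
  proof -
    have "cos ((r + pi) / 2) = - sin (r / 2)" by (simp add: add_divide_distrib cos_add)
    then show ?thesis by (simp add: chi_def)
  qed
  then have eq: "1 - chi r = sin (r / 2) ^ 4 * (3 - 2 * sin (r / 2) ^ 2)" using chi_partition[of r] by linarith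
  have s: "sin (r/2) ^ 2 \<le> 1" by (simp add: abs_square_le_1)
  have "\<bar>1 - chi r\<bar> = \<bar>sin (r / 2)\<bar> ^ 3 * (3 - 2 * sin (r / 2) ^ 2) * \<bar>sin (r / 2)\<bar>"
    unfolding eq using s by (simp add: abs_mult power_abs[symmetric] power4_eq_xxxx power3_eq_cube)
  also have "\<dots> \<le> 1 * 3 * \<bar>r / 2\<bar>"
    using s by (intro mult_mono power_le_one abs_sin_x_le_abs_x) auto
  finally have "\<bar>1 - chi r\<bar> \<le> 3 / 2 * \<bar>r\<bar>" by simp
  then show ?thesis using abs_ge_zero[of r] by linarith
qed

context osc_sum
begin

text \<open>A threshold for p(n) beyond which half a unit of time moves p by at most 1/4. A cell is
  then much shorter than the spacing pi of the resonances and meets at most one of them.\<close>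

definition K0 :: real where "K0 = 20 + 4 * F + 4 * F\<^sup>2"

lemma K0_facts:
  assumes "K0 \<le> P"
  shows "20 \<le> P" "4 * F \<le> P\<^sup>2" "F / P \<le> 1/4" "2 * F \<le> sqrt P"
proof -
  have P: "20 + 4 * F + 4 * F\<^sup>2 \<le> P" using assms by (simp add: K0_def)
  have nn: "0 \<le> F\<^sup>2" by simp
  show P20: "20 \<le> P" using P F_pos nn by linarith
  have PF: "4 * F \<le> P" using P F_pos nn by linarith
  have "P * 1 \<le> P * P" using P20 by (intro mult_left_mono) auto
  then show "4 * F \<le> P\<^sup>2" using PF by (simp add: power2_eq_square)
  show "F / P \<le> 1/4" using PF P20 by (simp add: field_simps)
  have "(2 * F)\<^sup>2 \<le> P" using P F_pos by (simp add: power_mult_distrib)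
  then show "2 * F \<le> sqrt P" by (rule real_le_rsqrt)
qed

lemma p_large:
  "\<exists>N. \<forall>n\<ge>N. K \<le> p (real n) \<and> F * real n / 2 \<le> (p (real n))\<^sup>2 \<and> (p (real n))\<^sup>2 \<le> 2 * F * real n \<and> 1 \<le> n"
proof -
  define N where "N = nat \<lceil>2 * (\<bar>e\<bar> + K\<^sup>2) / F\<rceil> + 1"
  show ?thesis
  proof (intro exI allI impI)
    fix n assume n: "N \<le> n"
    have "2 * (\<bar>e\<bar> + K\<^sup>2) / F \<le> real (nat \<lceil>2 * (\<bar>e\<bar> + K\<^sup>2) / F\<rceil>)" by (rule real_nat_ceiling_ge)
    then have "2 * (\<bar>e\<bar> + K\<^sup>2) / F \<le> real n" using n unfolding N_def by linarith
    then have Fn: "2 * (\<bar>e\<bar> + K\<^sup>2) \<le> F * real n" using F_pos by (simp add: field_simps)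
    have K2: "0 \<le> K\<^sup>2" by simp
    have e1: "- e \<le> \<bar>e\<bar>" "e \<le> \<bar>e\<bar>" "0 \<le> \<bar>e\<bar>" by auto
    have pos: "0 \<le> F * real n + e" using Fn K2 e1 unfolding distrib_left by linarith
    have P2: "(p (real n))\<^sup>2 = F * real n + e" using pos by (simp add: p_def)
    have "K\<^sup>2 \<le> F * real n + e" using Fn K2 e1 unfolding distrib_left by linarith
    then have "\<bar>K\<bar> \<le> p (real n)" unfolding p_def by (intro real_le_rsqrt) simp
    moreover have "F * real n / 2 \<le> F * real n + e" "F * real n + e \<le> 2 * F * real n"
      using Fn K2 e1 unfolding distrib_left by linarith+
    ultimately show "K \<le> p (real n) \<and> F * real n / 2 \<le> (p (real n))\<^sup>2 \<and> (p (real n))\<^sup>2 \<le> 2 * F * real n \<and> 1 \<le> n"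
      unfolding P2 using n by (auto simp: N_def)
  qed
qed

lemma p_mono: "x \<le> y \<Longrightarrow> p x \<le> p y"
  using F_pos by (simp add: p_def)

lemma p_half_bounds:
  assumes "K0 \<le> p (real n)"
  shows "p (real n - 1/2) \<le> p (real n)" "p (real n) \<le> p (real n + 1/2)"
    "p (real n) - p (real n - 1/2) \<le> F / p (real n)" "p (real n + 1/2) - p (real n) \<le> F / p (real n)"
  using p_expansion(3)[of "p (real n)" "real n" "1/2"] p_expansion(3)[of "p (real n)" "real n" "-1/2"]
    K0_facts[OF assms] p_mono[of "real n - 1/2" "real n"] p_mono[of "real n" "real n + 1/2"] by auto

end

section \<open>Splitting \<open>b\<close> into differences of null sequences and an error\<close>

context osc_res
begin

lemma mi_bounds:
  assumes "0 < p (real n - 1/2)"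
  shows "p (real n - 1/2) \<le> pi * real (mi n)" "pi * (real (mi n) - 1) < p (real n - 1/2)"
proof -
  define t where "t = p (real n - 1/2)"
  have "0 < t / pi" using assms by (simp add: t_def)
  then have m: "real (mi n) = of_int \<lceil>t / pi\<rceil>" unfolding mi_def t_def by simp
  have "t / pi \<le> real (mi n)" "real (mi n) - 1 < t / pi" unfolding m by linarith+
  then show "p (real n - 1/2) \<le> pi * real (mi n)" "pi * (real (mi n) - 1) < p (real n - 1/2)"
    unfolding t_def[symmetric] by (simp_all add: field_simps)
qed

lemma mi_facts:
  assumes n: "K0 \<le> p (real n)"
  shows "p (real n - 1/2) \<le> pi * real (mi n)" "pi * (real (mi n) - 1) < p (real n - 1/2)"
    "p (real n + 1/2) \<le> pi * real (mi (Suc n))" "pi * (real (mi (Suc n)) - 1) < p (real n + 1/2)"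
    "3 \<le> mi n" "real (mi n) \<le> p (real n)" "p (real n) / 8 \<le> real (mi n) - 1"
    "mi (Suc n) = mi n \<or> mi (Suc n) = Suc (mi n)"
proof -
  note K = K0_facts[OF n] and h = p_half_bounds[OF n]
  have pos: "0 < p (real n - 1/2)" using K h by linarith
  have pos': "0 < p (real (Suc n) - 1/2)" using K h p_mono[of "real n" "real (Suc n) - 1/2"] by auto
  have eq: "real (Suc n) - 1/2 = real n + 1/2" by simp
  note m = mi_bounds[OF pos] and m' = mi_bounds[OF pos', unfolded eq]
  show 1: "p (real n - 1/2) \<le> pi * real (mi n)" "pi * (real (mi n) - 1) < p (real n - 1/2)"
    "p (real n + 1/2) \<le> pi * real (mi (Suc n))" "pi * (real (mi (Suc n)) - 1) < p (real n + 1/2)"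
    using m m' by auto
  have pi34: "3 < pi" "pi < 4" using pi_gt3 pi_less_4 by auto
  have "p (real n) - 1/4 \<le> pi * real (mi n)" using 1 h K by linarith
  also have "pi * real (mi n) \<le> 4 * real (mi n)" using pi34 by (intro mult_right_mono) auto
  finally have low: "p (real n) - 1/4 \<le> 4 * real (mi n)" .
  then have "real (mi n) > 4" using K(1) by linarith
  then show m3: "3 \<le> mi n" by simp
  show "p (real n) / 8 \<le> real (mi n) - 1" using low K(1) by simp
  have "3 * (real (mi n) - 1) \<le> pi * (real (mi n) - 1)" using pi34 m3 by (intro mult_right_mono) auto
  also have "\<dots> < p (real n - 1/2)" by (rule 1(2))
  also have "\<dots> \<le> p (real n)" by (rule h(1))
  finally show "real (mi n) \<le> p (real n)" using K(1) by simp
  have "pi * (real (mi n) - 1) < pi * real (mi (Suc n))" using 1 h by linarith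
  then have a: "mi n \<le> mi (Suc n)" by simp
  have "pi * (real (mi (Suc n)) - 1) < pi * (real (mi n) + 1)" 
    using 1 h K(3) pi34 unfolding right_diff_distrib distrib_left mult_1_right by linarith
  then have "mi (Suc n) \<le> Suc (mi n)" by simp
  then show "mi (Suc n) = mi n \<or> mi (Suc n) = Suc (mi n)" using a by linarith
qed

text \<open>Both parts of \<open>Q\<close> are integrals from the current point to an end of a
  window. If the point keeps distance d from every multiple of pi, neither integral reaches its
  stationary point, and \<open>osc_far\<close> improves the bound of
  \<open>osc_near\<close>.\<close>

lemma Q_bounds:
  obtains C where "C > 0" "\<And>n. K0 \<le> p (real n) \<Longrightarrow> cmod (Q n) \<le> C / sqrt (p (real n))"
    "\<And>n d. K0 \<le> p (real n) \<Longrightarrow> 0 < d \<Longrightarrow> (\<And>k. d \<le> \<bar>p (real n - 1/2) - pi * real k\<bar>) \<Longrightarrow> cmod (Q n) \<le> C / (p (real n) * d)"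
proof -
  obtain C where C: "C > 0"
    "\<And>k a b. 2 \<le> k \<Longrightarrow> a \<in> {-pi..pi} \<Longrightarrow> b \<in> {-pi..pi} \<Longrightarrow> cmod (Pr k b - Pr k a) \<le> C / sqrt (real k)"
    "\<And>k a b m. 2 \<le> k \<Longrightarrow> a \<le> b \<Longrightarrow> -pi \<le> a \<Longrightarrow> b \<le> pi \<Longrightarrow> 0 < m \<Longrightarrow> m \<le> a \<or> b \<le> -m \<Longrightarrow> cmod (Pr k b - Pr k a) \<le> C / (real k * m)"
    by (rule Pr_bounds) (rule that)
  have P0: "Pr k (-pi) = 0" for k by (simp add: Pr_def)
  have nF: "cmod (om k * of_real (2 / F) * x) = 2 / F * cmod x" for k x
    using F_pos by (simp add: norm_mult norm_divide cmod_om)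
  have nQ: "cmod (Q n) \<le> 2 / F * (cmod (Pr (mi n - 1) pi - Pr (mi n - 1) (p (real n - 1/2) - pi * real (mi n - 1)))
      + cmod (Pr (mi n) (p (real n - 1/2) - pi * real (mi n)) - Pr (mi n) (-pi)))" for n
    unfolding Q_def R_def L_def P0
    by (rule order_trans[OF norm_triangle_ineq4]) (simp only: nF diff_zero distrib_left)
  have common: "p (real n) / 8 \<le> real (mi n - 1)" "p (real n) / 8 \<le> real (mi n)" "2 \<le> mi n - 1" "2 \<le> mi n"
     "p (real n - 1/2) - pi * real (mi n - 1) \<in> {-pi..pi}" "p (real n - 1/2) - pi * real (mi n) \<in> {-pi..pi}"
     "0 < p (real n - 1/2) - pi * real (mi n - 1)" "p (real n - 1/2) - pi * real (mi n) \<le> 0"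
     "20 \<le> p (real n)"
    if "K0 \<le> p (real n)" for n
    using mi_facts[OF that] K0_facts(1)[OF that] by (auto simp: of_nat_diff algebra_simps)
  show ?thesis
  proof (rule that)
    show "0 < 2 / F * (16 * C)" using F_pos C(1) by simp
    fix n assume n: "K0 \<le> p (real n)"
    note c = common[OF n]
    have sq: "C / sqrt (real k) \<le> 8 * C / sqrt (p (real n))" if k: "p (real n) / 8 \<le> real k" for k
    proof -
      have "sqrt (p (real n)) / 8 \<le> sqrt (p (real n) / 8)"
        using c(9) by (intro real_le_rsqrt) (simp add: power_divide)
      also have "\<dots> \<le> sqrt (real k)" using k by simp
      finally have s: "sqrt (p (real n)) / 8 \<le> sqrt (real k)" .
      have "C / sqrt (real k) \<le> C / (sqrt (p (real n)) / 8)"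
        using s c(9) C(1) k by (intro divide_left_mono) (auto intro!: mult_pos_pos)
      then show ?thesis by (simp add: mult.commute)
    qed
    have "cmod (Q n) \<le> 2 / F * (8 * C / sqrt (p (real n)) + 8 * C / sqrt (p (real n)))"
      using F_pos c
      by (intro order_trans[OF nQ] mult_left_mono add_mono order_trans[OF C(2) sq]) auto
    then show "cmod (Q n) \<le> 2 / F * (16 * C) / sqrt (p (real n))" by (simp add: add_divide_distrib[symmetric])
    fix d :: real assume d: "0 < d" and far: "\<And>k. d \<le> \<bar>p (real n - 1/2) - pi * real k\<bar>"
    have lin: "C / (real k * d) \<le> 8 * C / (p (real n) * d)" if k: "p (real n) / 8 \<le> real k" for k
    proof -
      have "C / (real k * d) \<le> C / (p (real n) / 8 * d)"
        using k c(9) C(1) d by (intro divide_left_mono mult_right_mono) (auto intro!: mult_pos_pos)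
      then show ?thesis by (simp add: mult.commute)
    qed
    have dL: "p (real n - 1/2) - pi * real (mi n) \<le> - d" using far[of "mi n"] c(8) by simp
    have dR: "d \<le> p (real n - 1/2) - pi * real (mi n - 1)" using far[of "mi n - 1"] c(7) by linarith
    have 1: "cmod (Pr (mi n - 1) pi - Pr (mi n - 1) (p (real n - 1/2) - pi * real (mi n - 1))) \<le> 8 * C / (p (real n) * d)"
      by (rule order_trans[OF C(3)[OF c(3) _ _ _ d] lin[OF c(1)]]) (use c dR in auto)
    have 2: "cmod (Pr (mi n) (p (real n - 1/2) - pi * real (mi n)) - Pr (mi n) (-pi)) \<le> 8 * C / (p (real n) * d)"
      by (rule order_trans[OF C(3)[OF c(4) _ _ _ d] lin[OF c(2)]]) (use c dL in auto)
    have "cmod (Q n) \<le> 2 / F * (8 * C / (p (real n) * d) + 8 * C / (p (real n) * d))"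
      using F_pos by (intro order_trans[OF nQ] mult_left_mono add_mono 1 2) auto
    then show "cmod (Q n) \<le> 2 / F * (16 * C) / (p (real n) * d)" by (simp add: add_divide_distrib[symmetric])
  qed
qed

text \<open>Without a jump the cell of n lies in the windows of both k = mi n - 1 and k = mi n, and
  two local errors remain. At a jump the point pi * mi n lies in the cell, and only the window of k
  = mi n contains it entirely. The neighbouring windows contribute truncated pieces and chi is not
  exactly 1, which costs O(p^(-2)), but only once per resonance.\<close>

lemma b_split:
  obtains C where "C > 0" "\<And>n. K0 \<le> p (real n) \<Longrightarrow>
    cmod (b n - (Q n - Q (Suc n) + (tail (mi n) - tail (mi (Suc n))))) \<le> C / p (real n) ^ 3 + (if mi (Suc n) = mi n then 0 else C / (p (real n))\<^sup>2)"
proof -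
  obtain C1 where C1: "C1 > 0" "\<And>n k. 2 \<le> k \<Longrightarrow> 1 \<le> p (real n) \<Longrightarrow> 4 * F \<le> (p (real n))\<^sup>2 \<Longrightarrow>
     (\<And>t. \<bar>t\<bar> \<le> 1/2 \<Longrightarrow> \<bar>p (real n + t) - pi * real k\<bar> \<le> pi) \<Longrightarrow>
     cmod (om k * of_real (2 / F) * (Pr k (p (real n + 1/2) - pi * real k) - Pr k (p (real n - 1/2) - pi * real k))
       - of_real (chi (p (real n) - pi * real k)) * b n) \<le> C1 / p (real n) ^ 3"
    by (rule local_step) (rule that; blast)
  obtain C2 where C2: "C2 > 0" "\<And>k r. 2 \<le> k \<Longrightarrow> r \<in> {-pi..pi} \<Longrightarrow> cmod (Pr k pi - Pr k r) \<le> C2 * (pi - r)\<^sup>2"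
    "\<And>k r. 2 \<le> k \<Longrightarrow> r \<in> {-pi..pi} \<Longrightarrow> cmod (Pr k r) \<le> C2 * (pi + r)\<^sup>2"
    by (rule Pr_edge) (rule that)
  define C where "C = 2 * C1 + 2 * F + 2 / F * (C2 * (2 * F)\<^sup>2) * 2"
  show ?thesis
  proof (rule that)
    show C0: "0 < C" using C1(1) C2(1) F_pos by (simp add: C_def add_pos_nonneg)
    have CC: "2 * C1 \<le> C" "2 * F + 2 / F * (C2 * (2 * F)\<^sup>2) * 2 \<le> C"
      using C1(1) C2(1) F_pos by (simp_all add: C_def)
    fix n assume n: "K0 \<le> p (real n)"
    define m where "m = mi n"
    define P where "P = p (real n)"
    define t where "t = p (real n - 1/2)"
    define t' where "t' = p (real n + 1/2)"
    note K = K0_facts[OF n, folded P_def]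
    note h = p_half_bounds[OF n, folded t_def t'_def P_def]
    note f = mi_facts[OF n, folded t_def t'_def m_def P_def]
    have P0: "0 < P" using K by simp
    have pm1: "pi * real (m - 1) = pi * (real m - 1)" using f(5) by (simp add: of_nat_diff)
    have tt: "t \<le> p (real n + s) \<and> p (real n + s) \<le> t'" if "\<bar>s\<bar> \<le> 1/2" for s
      unfolding t_def t'_def using that by (auto intro!: p_mono)
    define Z where "Z k = om k * of_real (2 / F) * (Pr k (t' - pi * real k) - Pr k (t - pi * real k))" for k
    have step: "cmod (Z k - of_real (chi (P - pi * real k)) * b n) \<le> C1 / P ^ 3"
      if "2 \<le> k" "-pi \<le> t - pi * real k" "t' - pi * real k \<le> pi" for k
      unfolding Z_def t_def t'_def P_def
    proof (rule C1(2))
      fix s :: real assume "\<bar>s\<bar> \<le> 1/2"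
      then show "\<bar>p (real n + s) - pi * real k\<bar> \<le> pi" using tt[of s] that by linarith
    qed (use that K in \<open>simp_all add: P_def\<close>)
    have t'eq: "p (real (Suc n) - 1/2) = t'" by (simp add: t'_def add.commute)
    show "cmod (b n - (Q n - Q (Suc n) + (tail (mi n) - tail (mi (Suc n))))) \<le> C / p (real n) ^ 3 + (if mi (Suc n) = mi n then 0 else C / (p (real n))\<^sup>2)"
    proof (cases "mi (Suc n) = mi n")
      case True
      have eq: "Q n - Q (Suc n) + (tail (mi n) - tail (mi (Suc n))) = Z (m - 1) + Z m"
        unfolding Q_def True t'eq t_def[symmetric] m_def[symmetric] R_def L_def Z_def by (simp add: algebra_simps)
      have fT: "t' \<le> pi * real m" using f(3) True by (simp add: m_def)
      \<comment> \<open>The two windows are shifted by pi against each other, so their cutoffs form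
        a partition of unity at p(n).\<close>
      have c1: "chi (P - pi * real m) + chi (P - pi * real (m - 1)) = 1"
        using chi_partition[of "P - pi * real m"] unfolding pm1 by (simp add: algebra_simps)
      have s1: "cmod (Z m - of_real (chi (P - pi * real m)) * b n) \<le> C1 / P ^ 3"
        by (rule step) (use f fT in \<open>auto simp: algebra_simps\<close>)
      have s2: "cmod (Z (m - 1) - of_real (chi (P - pi * real (m - 1))) * b n) \<le> C1 / P ^ 3"
        by (rule step) (use f fT in \<open>auto simp: pm1 algebra_simps\<close>)
      have "b n = of_real (chi (P - pi * real m)) * b n + of_real (chi (P - pi * real (m - 1))) * b n"
        using arg_cong[OF c1, of complex_of_real] by (simp add: distrib_right[symmetric])
      then have "b n - (Z (m - 1) + Z m) = - ((Z m - of_real (chi (P - pi * real m)) * b n) + (Z (m - 1) - of_real (chi (P - pi * real (m - 1))) * b n))"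
        by (simp add: algebra_simps)
      then have "cmod (b n - (Z (m - 1) + Z m)) \<le> C1 / P ^ 3 + C1 / P ^ 3"
        by (simp only: norm_minus_cancel) (intro order_trans[OF norm_triangle_ineq] add_mono s1 s2)
      also have "\<dots> \<le> C / P ^ 3" using CC(1) P0 by (simp add: add_divide_distrib[symmetric] divide_right_mono)
      finally show ?thesis unfolding eq using True by (simp add: P_def)
    next
      case False
      then have mS: "mi (Suc n) = Suc m" using f(8) by (simp add: m_def)
      note f' = f(3,4)[unfolded mS]
      \<comment> \<open>The pieces left over by the change of index: \<open>u\<close> is the missing
        end of the window of m - 1, \<open>v\<close> the beginning of the window of m + 1. Both lie
        within 2F/P of an edge.\<close>
      define u where "u = om (m - 1) * of_real (2 / F) * (Pr (m - 1) pi - Pr (m - 1) (t - pi * real (m - 1)))"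
      define v where "v = om (Suc m) * of_real (2 / F) * Pr (Suc m) (t' - pi * real (Suc m))"
      have eq: "Q n - Q (Suc n) + (tail (mi n) - tail (mi (Suc n))) = u + Z m + v"
      proof -
        have "tail (mi n) - tail (mi (Suc n)) = S m" unfolding mS m_def[symmetric] using tail_Suc[of m] by simp
        also have "S m = om m * of_real (2 / F) * Pr m pi" by (simp add: S_def Jv_def)
        finally show ?thesis
          unfolding Q_def mS t'eq t_def[symmetric] m_def[symmetric] R_def L_def Z_def u_def v_def by (simp add: algebra_simps)
      qed
      have dt: "t' - t \<le> 2 * F / P" using h by simp
      have FP: "0 \<le> F / P" using F_pos P0 by simp
      have tm: "t \<le> pi * real m" "pi * real m < t'" using f f' by auto
      have r1: "0 \<le> pi - (t - pi * real (m - 1))" "pi - (t - pi * real (m - 1)) \<le> 2 * F / P"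
        unfolding pm1 using f dt tm by (simp_all add: algebra_simps)
      have r2: "0 \<le> pi + (t' - pi * real (Suc m))" "pi + (t' - pi * real (Suc m)) \<le> 2 * F / P"
        using dt tm by (simp_all add: algebra_simps)
      have "2 * F / P = 2 * (F / P)" by simp
      then have F2: "2 * F / P < pi" using K(3) pi_gt3 by linarith
      have nF: "cmod (om k * of_real (2 / F) * x) = 2 / F * cmod x" for k x
        using F_pos by (simp add: norm_mult norm_divide cmod_om)
      have ub: "cmod u \<le> 2 / F * (C2 * (2 * F / P)\<^sup>2)"
      proof -
        have "cmod (Pr (m - 1) pi - Pr (m - 1) (t - pi * real (m - 1))) \<le> C2 * (pi - (t - pi * real (m - 1)))\<^sup>2"
          by (rule C2(2)) (use f(5) r1 F2 in auto)
        also have "\<dots> \<le> C2 * (2 * F / P)\<^sup>2" using r1 C2(1) by (intro mult_left_mono power_mono) auto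
        finally show ?thesis unfolding u_def nF using F_pos by (intro mult_left_mono) auto
      qed
      have vb: "cmod v \<le> 2 / F * (C2 * (2 * F / P)\<^sup>2)"
      proof -
        have "cmod (Pr (Suc m) (t' - pi * real (Suc m))) \<le> C2 * (pi + (t' - pi * real (Suc m)))\<^sup>2"
          by (rule C2(3)) (use f(5) r2 F2 in auto)
        also have "\<dots> \<le> C2 * (2 * F / P)\<^sup>2" using r2 C2(1) by (intro mult_left_mono power_mono) auto
        finally show ?thesis unfolding v_def nF using F_pos by (intro mult_left_mono) auto
      qed
      have zb: "cmod (Z m - of_real (chi (P - pi * real m)) * b n) \<le> C1 / P ^ 3"
        by (rule step) (use f tm dt F2 in auto)
      have cb: "cmod (of_real (1 - chi (P - pi * real m)) * b n) \<le> 2 * F / P\<^sup>2"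
      proof -
        have nb: "cmod (b n) = 1 / P"
          using P0 by (simp add: b_def norm_divide norm_exp_eq_Re P_def)
        have "\<bar>P - pi * real m\<bar> \<le> F / P" using h tm by (simp add: abs_le_iff)
        then have "\<bar>1 - chi (P - pi * real m)\<bar> \<le> 2 * (F / P)"
          by (intro order_trans[OF one_minus_chi mult_left_mono]) auto
        then have "\<bar>1 - chi (P - pi * real m)\<bar> * (1 / P) \<le> 2 * (F / P) * (1 / P)"
          using P0 by (intro mult_right_mono) auto
        then show ?thesis unfolding norm_mult nb norm_of_real by (simp add: power2_eq_square)
      qed
      have "b n - (u + Z m + v) = of_real (1 - chi (P - pi * real m)) * b n - (Z m - of_real (chi (P - pi * real m)) * b n) - u - v"
        by (simp add: algebra_simps)
      then have "cmod (b n - (u + Z m + v)) \<le> 2 * F / P\<^sup>2 + C1 / P ^ 3 + 2 / F * (C2 * (2 * F / P)\<^sup>2) + 2 / F * (C2 * (2 * F / P)\<^sup>2)"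
        by (simp only:) (intro order_trans[OF norm_triangle_ineq4] add_mono ub vb zb cb)
      also have "\<dots> = C1 / P ^ 3 + (2 * F + 2 / F * (C2 * (2 * F)\<^sup>2) * 2) / P\<^sup>2"
        by (simp add: power_divide add_divide_distrib)
      also have "\<dots> \<le> C / P ^ 3 + C / P\<^sup>2"
        using CC C1(1) P0 by (intro add_mono divide_right_mono) auto
      finally show ?thesis unfolding eq using False by (simp add: P_def)
    qed
  qed
qed

end

section \<open>Sparsity of the indices near a resonance\<close>

context osc_sum
begin

text \<open>Away from the resonances Q is small enough for its square to be harmless; the exceptional indices near a
  resonance are sparse enough for $1/n$ to be summable over them.\<close>

definition near :: "nat \<Rightarrow> bool" where
  "near n \<longleftrightarrow> (\<exists>k::nat. \<bar>p (real n) - pi * real k\<bar> \<le> 1 / sqrt (sqrt (p (real n))))"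

text \<open>The gain over the bound p^(-1/2) for \<open>Q\<close>. With neighbourhoods of radius
  p^(-a), the near indices have total weight of order sum k^(-1-a), and elsewhere the cubic terms
  have size p^(a - 5/2). Both sums converge for 0 < a < 1/2; the exponent 1/4 is the
  midpoint.\<close>

definition rho :: "nat \<Rightarrow> real" where
  "rho n = (if near n then 1 else 1 / sqrt (sqrt (p (real n))))"

lemma summable_p_power:
  assumes N: "\<And>n. n \<ge> N \<Longrightarrow> K0 \<le> p (real n) \<and> F * real n / 2 \<le> (p (real n))\<^sup>2 \<and> (p (real n))\<^sup>2 \<le> 2 * F * real n \<and> 1 \<le> n"
    and s: "s < -2"
  shows "summable (\<lambda>n. p (real (n + N)) powr s)"
proof (rule summable_comparison_test)
  have "summable (\<lambda>n. real n powr (s / 2))" using s by (simp add: summable_real_powr_iff)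
  then have "summable (\<lambda>n. real (n + N) powr (s / 2))" by (rule summable_ignore_initial_segment)
  then show "summable (\<lambda>n. (F / 2) powr (s / 2) * real (n + N) powr (s / 2))" by (rule summable_mult)
  show "\<exists>M. \<forall>n\<ge>M. norm (p (real (n + N)) powr s) \<le> (F / 2) powr (s / 2) * real (n + N) powr (s / 2)"
  proof (intro exI allI impI)
    fix n :: nat
    have h: "K0 \<le> p (real (n + N))" "F * real (n + N) / 2 \<le> (p (real (n + N)))\<^sup>2" "1 \<le> n + N" using N[of "n + N"] by auto
    have p0: "0 < p (real (n + N))" using K0_facts(1)[OF h(1)] by simp
    have "p (real (n + N)) powr s = ((p (real (n + N)))\<^sup>2) powr (s / 2)"
    proof -
      have "((p (real (n + N)))\<^sup>2) powr (s / 2) = (p (real (n + N)) powr 2) powr (s / 2)" using p0 by (simp add: powr_numeral)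
      then show ?thesis by (simp add: powr_powr)
    qed
    also have "\<dots> \<le> (F * real (n + N) / 2) powr (s / 2)"
      using h F_pos s by (intro powr_mono2') auto
    also have "\<dots> = (F / 2) powr (s / 2) * real (n + N) powr (s / 2)"
      using F_pos by (subst powr_mult[symmetric]) auto
    finally show "norm (p (real (n + N)) powr s) \<le> (F / 2) powr (s / 2) * real (n + N) powr (s / 2)" by simp
  qed
qed

text \<open>p(n)^2 is affine in n, so a deviation p^(-1/4) of p from pi k means a deviation of order
  k * k^(-1/4) of n from the time at which p equals pi k.\<close>

lemma near_block:
  assumes n: "K0 \<le> p (real n)" "near n" and P2: "(p (real n))\<^sup>2 = F * real n + e"
  obtains k where "1 \<le> k" "real k \<le> p (real n)"
    "\<bar>real n - (pi\<^sup>2 * real k ^ 2 - e) / F\<bar> \<le> 12 / F * real k powr (3/4)" 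
proof -
  define P where "P = p (real n)"
  have P: "20 \<le> P" using K0_facts(1)[OF n(1)] by (simp add: P_def)
  obtain k :: nat where k: "\<bar>P - pi * real k\<bar> \<le> 1 / sqrt (sqrt P)" using n(2) by (auto simp: near_def P_def)
  define d where "d = 1 / sqrt (sqrt P)"
  have ss: "1 \<le> sqrt (sqrt P)" using P by simp
  have d1: "d \<le> 1" "0 < d" using ss by (simp_all add: d_def)
  have k1: "\<bar>P - pi * real k\<bar> \<le> d" using k by (simp add: d_def)
  have pk: "P - 1 \<le> pi * real k" "pi * real k \<le> P + 1" using k1 d1 by (auto simp: abs_le_iff)
  have "pi * real k \<le> 4 * real k" using pi_less_4 by (intro mult_right_mono) auto
  then have k4: "P - 1 \<le> 4 * real k" using pk by linarith
  then have k_ge: "1 \<le> k" using P by simp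
  have "3 * real k \<le> pi * real k" using pi_gt3 by (intro mult_right_mono) auto
  then have kP: "real k \<le> P" using pk P by linarith
  have "real n - (pi\<^sup>2 * real k ^ 2 - e) / F = (P\<^sup>2 - (pi * real k)\<^sup>2) / F"
    using P2 F_pos by (simp add: P_def field_simps power_mult_distrib)
  also have "P\<^sup>2 - (pi * real k)\<^sup>2 = (P - pi * real k) * (P + pi * real k)" by (simp add: power2_eq_square algebra_simps)
  finally have "\<bar>real n - (pi\<^sup>2 * real k ^ 2 - e) / F\<bar> = \<bar>P - pi * real k\<bar> * \<bar>P + pi * real k\<bar> / F"
    using F_pos by (simp add: abs_mult)
  also have "\<dots> \<le> d * (9 * real k) / F"
  proof (intro divide_right_mono mult_mono k1)
    have "P + pi * real k \<le> 9 * real k" using pk k4 P by linarith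
    moreover have "0 \<le> P + pi * real k" using P by simp
    ultimately show "\<bar>P + pi * real k\<bar> \<le> 9 * real k" by simp
  qed (use d1 F_pos in auto)
  also have "d \<le> real k powr (-1/4)"
  proof -
    have "sqrt (sqrt P) = P powr (1/4)" using P by (simp add: powr_half_sqrt[symmetric] powr_powr)
    then have "d = P powr (-1/4)" unfolding d_def using P by (simp add: powr_minus_divide)
    also have "\<dots> \<le> real k powr (-1/4)" using kP k_ge by (intro powr_mono2') auto
    finally show ?thesis .
  qed
  finally have "\<bar>real n - (pi\<^sup>2 * real k ^ 2 - e) / F\<bar> \<le> real k powr (-1/4) * (9 * real k) / F"
    using F_pos by (simp add: divide_right_mono mult_right_mono)
  also have "real k powr (-1/4) * (9 * real k) = 9 * real k powr (3/4)"
    using k_ge powr_add[of "real k" "-1/4" 1] by simp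
  also have "9 * real k powr (3/4) / F \<le> 12 / F * real k powr (3/4)"
    using F_pos by (simp add: divide_right_mono mult_right_mono)
  finally show ?thesis using that[of k] k_ge kP by (simp add: P_def)
qed

text \<open>The k-th block has O(k^(3/4)) members and each term is at most 1/k^2, so a block
  contributes O(k^(-5/4)).\<close>

lemma summable_near:
  assumes N: "\<And>n. n \<ge> N \<Longrightarrow> K0 \<le> p (real n) \<and> F * real n / 2 \<le> (p (real n))\<^sup>2 \<and> (p (real n))\<^sup>2 \<le> 2 * F * real n \<and> 1 \<le> n"
  shows "summable (\<lambda>n. (if near (n + N) then 1 / (p (real (n + N)))\<^sup>2 else 0))"
proof -
  define B where "B k = {n::nat. \<bar>real n - (pi\<^sup>2 * real k ^ 2 - e) / F\<bar> \<le> 12 / F * real k powr (3/4)}" for k :: nat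
  define g where "g k = (24 / F + 1) * real k powr (-5/4)" for k :: nat
  have fB: "finite (B k)" and cB: "real (card (B k)) \<le> 2 * (12 / F * real k powr (3/4)) + 1" for k
    unfolding B_def using card_real_ball_le[of "12 / F * real k powr (3/4)"] F_pos by auto
  have sg: "summable g" unfolding g_def by (intro summable_mult) (simp add: summable_real_powr_iff)
  have g0: "0 \<le> g k" for k unfolding g_def using F_pos by simp
  have cBg: "real (card (B k)) * (1 / real k ^ 2) \<le> g k" if k: "1 \<le> k" for k
  proof -
    have "1 \<le> real k powr (3/4)" using k by (intro ge_one_powr_ge_zero) auto
    then have "real (card (B k)) \<le> (24 / F + 1) * real k powr (3/4)"
      using cB[of k] by (simp add: algebra_simps)
    then have "real (card (B k)) * (1 / real k ^ 2) \<le> (24 / F + 1) * real k powr (3/4) * (1 / real k ^ 2)"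
      by (intro mult_right_mono) auto
    also have "\<dots> = g k"
    proof -
      have "1 / real k ^ 2 = real k powr (-2)" using k by (simp add: powr_minus_divide powr_numeral)
      then show ?thesis unfolding g_def using powr_add[of "real k" "3/4" "-2"] by (simp add: mult.assoc)
    qed
    finally show ?thesis .
  qed
  show ?thesis
  proof (rule summableI_nonneg_bounded)
    show "0 \<le> (if near (n + N) then 1 / (p (real (n + N)))\<^sup>2 else 0)" for n by simp
    fix M
    \<comment> \<open>Every near index is charged to the block of its k. As k <= p(n), finitely many
      blocks meet the first M indices, and the finite double sum can be interchanged.\<close>
    define Kx where "Kx = nat \<lceil>p (real (M + N))\<rceil>"
    have "(\<Sum>n<M. if near (n + N) then 1 / (p (real (n + N)))\<^sup>2 else 0) \<le> (\<Sum>n<M. \<Sum>k\<in>{1..Kx}. if n + N \<in> B k then 1 / real k ^ 2 else 0)"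
    proof (rule sum_mono)
      fix n assume "n \<in> {..<M}"
      then have nM: "n < M" by simp
      show "(if near (n + N) then 1 / (p (real (n + N)))\<^sup>2 else 0) \<le> (\<Sum>k\<in>{1..Kx}. if n + N \<in> B k then 1 / real k ^ 2 else 0)"
      proof (cases "near (n + N)")
        case True
        have h: "K0 \<le> p (real (n + N))" using N[of "n + N"] by auto
        have p0: "0 < p (real (n + N))" using K0_facts(1)[OF h] by simp
        then have P2: "(p (real (n + N)))\<^sup>2 = F * real (n + N) + e" by (simp add: p_def)
        obtain k where k: "1 \<le> k" "real k \<le> p (real (n + N))"
          "\<bar>real (n + N) - (pi\<^sup>2 * real k ^ 2 - e) / F\<bar> \<le> 12 / F * real k powr (3/4)"
          by (rule near_block[OF h True P2]) (rule that)
        have "p (real (n + N)) \<le> p (real (M + N))" using nM by (intro p_mono) simp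
        then have "real k \<le> p (real (M + N))" using k(2) by linarith
        then have kK: "k \<in> {1..Kx}" using k(1) unfolding Kx_def by (simp add: le_nat_iff) linarith
        have "1 / (p (real (n + N)))\<^sup>2 \<le> 1 / real k ^ 2"
          using k p0 by (intro divide_left_mono power_mono) auto
        also have "\<dots> = (if n + N \<in> B k then 1 / real k ^ 2 else 0)" using k(3) by (simp add: B_def)
        also have "\<dots> \<le> (\<Sum>k\<in>{1..Kx}. if n + N \<in> B k then 1 / real k ^ 2 else 0)"
          by (rule member_le_sum[OF kK]) auto
        finally show ?thesis using True by simp
      qed (auto intro!: sum_nonneg)
    qed
    also have "\<dots> = (\<Sum>k\<in>{1..Kx}. \<Sum>n<M. if n + N \<in> B k then 1 / real k ^ 2 else 0)"
      by (rule sum.swap)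
    also have "\<dots> \<le> (\<Sum>k\<in>{1..Kx}. g k)"
    proof (rule sum_mono)
      fix k assume k: "k \<in> {1..Kx}"
      have "(\<Sum>n<M. if n + N \<in> B k then 1 / real k ^ 2 else 0) = real (card {n \<in> {..<M}. n + N \<in> B k}) * (1 / real k ^ 2)"
        by (simp add: sum.If_cases Int_def)
      also have "card {n \<in> {..<M}. n + N \<in> B k} \<le> card (B k)"
        by (rule card_inj_on_le[where f = "\<lambda>n. n + N"]) (auto simp: inj_on_def fB)
      then have "real (card {n \<in> {..<M}. n + N \<in> B k}) * (1 / real k ^ 2) \<le> real (card (B k)) * (1 / real k ^ 2)"
        by (intro mult_right_mono) auto
      also have "\<dots> \<le> g k" using k by (intro cBg) auto
      finally show "(\<Sum>n<M. if n + N \<in> B k then 1 / real k ^ 2 else 0) \<le> g k" .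
    qed
    also have "\<dots> \<le> suminf g" by (rule sum_le_suminf[OF sg]) (auto simp: g0)
    finally show "(\<Sum>n<M. if near (n + N) then 1 / (p (real (n + N)))\<^sup>2 else 0) \<le> suminf g" .
  qed
qed

end

section \<open>Convergence for the model recursion\<close>

context osc_res
begin

text \<open>A jump raises \<open>mi\<close> by exactly 1, so each term is at most a multiple of the
  corresponding decrease of 1 / sqrt (mi n), and the sum telescopes.\<close>

lemma summable_jump:
  assumes N: "\<And>n. n \<ge> N \<Longrightarrow> K0 \<le> p (real n)"
  shows "summable (\<lambda>n. if mi (Suc (n + N)) = mi (n + N) then 0 else 1 / (p (real (n + N)) * sqrt (p (real (n + N)))))"
proof (rule summableI_nonneg_bounded)
  have pp: "20 \<le> p (real (n + N))" for n using K0_facts(1)[OF N[of "n + N"]] by simp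
  show "0 \<le> (if mi (Suc (n + N)) = mi (n + N) then 0 else 1 / (p (real (n + N)) * sqrt (p (real (n + N)))))" for n
    using pp[of n] by simp
  fix M
  have "(\<Sum>n<M. if mi (Suc (n + N)) = mi (n + N) then 0 else 1 / (p (real (n + N)) * sqrt (p (real (n + N)))))
      \<le> (\<Sum>n<M. 4 * (1 / sqrt (real (mi (n + N))) - 1 / sqrt (real (mi (Suc n + N)))))"
  proof (rule sum_mono)
    fix n
    note f = mi_facts[OF N[of "n + N"]]
    show "(if mi (Suc (n + N)) = mi (n + N) then 0 else 1 / (p (real (n + N)) * sqrt (p (real (n + N))))) \<le> 4 * (1 / sqrt (real (mi (n + N))) - 1 / sqrt (real (mi (Suc n + N))))"
    proof (cases "mi (Suc (n + N)) = mi (n + N)")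
      case False
      then have S: "mi (Suc (n + N)) = Suc (mi (n + N))" using f(8) by simp
      have m: "3 \<le> mi (n + N)" "real (mi (n + N)) \<le> p (real (n + N))" using f(5,6) by simp_all
      have "1 / (p (real (n + N)) * sqrt (p (real (n + N)))) \<le> 1 / (real (mi (n + N)) * sqrt (real (mi (n + N))))"
        using m pp[of n] by (intro divide_left_mono mult_mono) auto
      also have "\<dots> \<le> 4 * (1 / sqrt (real (mi (n + N))) - 1 / sqrt (real (mi (n + N)) + 1))"
        using m by (intro inv_sqrt_telescope) simp
      finally show ?thesis using S by (simp add: add.commute)
    qed simp
  qed
  also have "\<dots> = 4 * (\<Sum>n<M. 1 / sqrt (real (mi (n + N))) - 1 / sqrt (real (mi (Suc n + N))))"
    by (rule sum_distrib_left[symmetric])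
  also have "(\<Sum>n<M. 1 / sqrt (real (mi (n + N))) - 1 / sqrt (real (mi (Suc n + N)))) = 1 / sqrt (real (mi N)) - 1 / sqrt (real (mi (M + N)))"
    by (induction M) auto
  also have "4 * \<dots> \<le> 4 / sqrt (real (mi N))" by simp
  finally show "(\<Sum>n<M. if mi (Suc (n + N)) = mi (n + N) then 0 else 1 / (p (real (n + N)) * sqrt (p (real (n + N))))) \<le> 4 / sqrt (real (mi N))" .
qed


text \<open>\<open>gauge_convergence\<close> is applied with multiples of \<open>Q\<close> and of
  \<open>tail\<close> along \<open>mi\<close>. The coefficient J is of size p^(-1/2) at jumps and
  zero otherwise. A jump occurs once per resonance, so cubic terms containing J are summable like
  k^(-3/2).\<close>

theorem osc_convergence:
  fixes y \<epsilon> :: "nat \<Rightarrow> complex" and \<mu> B :: real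
  defines "A \<equiv> \<lambda>n. - \<i> * of_real \<mu> * b n"
  assumes step: "\<And>n. n \<ge> n0 \<Longrightarrow> y (Suc n) = (1 + of_real ((cmod (A n))\<^sup>2 / 2)) * y n + A n * cnj (y n) + \<epsilon> n"
    and eps: "\<And>n. n \<ge> n0 \<Longrightarrow> cmod (\<epsilon> n) \<le> B / p (real n) ^ 3 * cmod (y n)"
    and nz: "\<And>n. n \<ge> n0 \<Longrightarrow> y n \<noteq> 0"
  shows "convergent (\<lambda>n. ln (cmod (y n)))"
proof -
  obtain C1 where C1: "C1 > 0" "\<And>n. K0 \<le> p (real n) \<Longrightarrow> cmod (Q n) \<le> C1 / sqrt (p (real n))"
    "\<And>n d. K0 \<le> p (real n) \<Longrightarrow> 0 < d \<Longrightarrow> (\<And>k. d \<le> \<bar>p (real n - 1/2) - pi * real k\<bar>) \<Longrightarrow> cmod (Q n) \<le> C1 / (p (real n) * d)"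
    by (rule Q_bounds) (rule that; blast)
  obtain C2 where C2: "C2 > 0" "\<And>n. K0 \<le> p (real n) \<Longrightarrow>
    cmod (b n - (Q n - Q (Suc n) + (tail (mi n) - tail (mi (Suc n))))) \<le> C2 / p (real n) ^ 3 + (if mi (Suc n) = mi n then 0 else C2 / (p (real n))\<^sup>2)"
    by (rule b_split) (rule that; blast)
  obtain C3 where C3: "C3 > 0" "\<And>K. 2 \<le> K \<Longrightarrow> cmod (tail K) \<le> C3 / sqrt (real K)"
    by (rule tail_bound) (rule that)
  define D where "D = 1 + \<bar>\<mu>\<bar> + \<bar>B\<bar> + \<bar>\<mu>\<bar> * (2 * C1) + \<bar>\<mu>\<bar> * C2 + \<bar>\<mu>\<bar> * (4 * C3)"
  have nn: "0 \<le> \<bar>\<mu>\<bar> * C1" "0 \<le> \<bar>\<mu>\<bar> * C2" "0 \<le> \<bar>\<mu>\<bar> * C3" "0 \<le> \<bar>\<mu>\<bar>" "0 \<le> \<bar>B\<bar>"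
    using C1(1) C2(1) C3(1) by auto
  have D: "1 \<le> D" "\<bar>\<mu>\<bar> \<le> D" "\<bar>B\<bar> \<le> D" "\<bar>\<mu>\<bar> * (2 * C1) \<le> D" "\<bar>\<mu>\<bar> * C2 \<le> D" "\<bar>\<mu>\<bar> * (4 * C3) \<le> D"
    using nn unfolding D_def by simp_all
  have D0: "0 \<le> D" using D by simp
  \<comment> \<open>The bound 16 D^2 gives sqrt p >= 4 D, so D / sqrt p <= 1/4 and the gauge
    coefficients stay below 1/2.\<close>
  obtain N1 where N1: "\<And>n. n \<ge> N1 \<Longrightarrow> max K0 (16 * D\<^sup>2) \<le> p (real n) \<and> F * real n / 2 \<le> (p (real n))\<^sup>2 \<and> (p (real n))\<^sup>2 \<le> 2 * F * real n \<and> 1 \<le> n"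
    using p_large[of "max K0 (16 * D\<^sup>2)"] by blast
  define N where "N = max N1 n0"
  have Nn: "K0 \<le> p (real n) \<and> F * real n / 2 \<le> (p (real n))\<^sup>2 \<and> (p (real n))\<^sup>2 \<le> 2 * F * real n \<and> 1 \<le> n" if "n \<ge> N" for n
    using N1[of n] that by (auto simp: N_def)
  have ND: "16 * D\<^sup>2 \<le> p (real n)" if "n \<ge> N" for n using N1[of n] that by (auto simp: N_def)
  define P where "P n = p (real (n + N))" for n
  have PK: "K0 \<le> P n" for n using Nn[of "n + N"] by (simp add: P_def)
  have P20: "20 \<le> P n" and P0: "0 < P n" for n using K0_facts(1)[OF PK[of n]] by simp_all
  have sqD: "4 * D \<le> sqrt (P n)" for n
    using ND[of "n + N"] D0 by (intro real_le_rsqrt) (simp add: P_def power_mult_distrib)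
  define jump where "jump n \<longleftrightarrow> mi (Suc (n + N)) \<noteq> mi (n + N)" for n
  define Q' where "Q' n = - \<i> * of_real \<mu> * Q (n + N)" for n
  define Pt where "Pt n = - \<i> * of_real \<mu> * tail (mi (n + N))" for n
  define J where "J n = Pt n - Pt (Suc n)" for n
  \<comment> \<open>The decomposition demanded by \<open>gauge_convergence\<close> is exact, so A is
    replaced by this main part and the difference \<open>\<eta>\<close> is moved into the
    error.\<close>
  define A' where "A' n = Q' n - Q' (Suc n) + J n" for n
  define \<eta> where "\<eta> n = A (n + N) - A' n" for n
  define q where "q n = D / sqrt (P n) * rho (n + N)" for n
  define r where "r n = D / sqrt (P n)" for n
  \<comment> \<open>One summand for each kind of error: cubic terms containing \<open>Q\<close>,
    terms of order n^(-5/4), and terms present only at jumps.\<close>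
  define s0 where "s0 n = rho (n + N) / (P n)\<^sup>2 + P n powr (-5/2) + (if jump n then 1 / (P n * sqrt (P n)) else 0)" for n
  have c\<mu>: "cmod (- \<i> * of_real \<mu> * x) = \<bar>\<mu>\<bar> * cmod x" for x by (simp add: norm_mult)
  have Pmono: "P n \<le> P (Suc n)" for n unfolding P_def by (intro p_mono) simp
  have rho: "0 \<le> rho (n + N)" "rho (n + N) \<le> 1" for n
    using P20[of n] by (auto simp: rho_def P_def)
  have sq: "1 \<le> sqrt (P n)" "sqrt (P n) * sqrt (P n) = P n" for n using P20[of n] by simp_all
  have A_b: "cmod (A (n + N)) = \<bar>\<mu>\<bar> / P n" for n
    unfolding A_def c\<mu> using P0[of n] by (simp add: b_def norm_divide norm_exp_eq_Re P_def)
  have eta_b: "cmod (\<eta> n) \<le> D / P n ^ 3 + (if jump n then D / (P n)\<^sup>2 else 0)" for n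
  proof -
    have "\<eta> n = - \<i> * of_real \<mu> * (b (n + N) - (Q (n + N) - Q (Suc (n + N)) + (tail (mi (n + N)) - tail (mi (Suc (n + N))))))"
      by (simp add: \<eta>_def A_def A'_def Q'_def J_def Pt_def algebra_simps)
    then have "cmod (\<eta> n) = \<bar>\<mu>\<bar> * cmod (b (n + N) - (Q (n + N) - Q (Suc (n + N)) + (tail (mi (n + N)) - tail (mi (Suc (n + N))))))"
      by (simp only: c\<mu>)
    also have "\<dots> \<le> \<bar>\<mu>\<bar> * (C2 / P n ^ 3 + (if jump n then C2 / (P n)\<^sup>2 else 0))"
      using C2(2)[of "n + N"] PK[of n] unfolding P_def jump_def by (intro mult_left_mono) auto
    also have "\<dots> = (\<bar>\<mu>\<bar> * C2) / P n ^ 3 + (if jump n then (\<bar>\<mu>\<bar> * C2) / (P n)\<^sup>2 else 0)" by (simp add: algebra_simps)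
    also have "\<dots> \<le> D / P n ^ 3 + (if jump n then D / (P n)\<^sup>2 else 0)"
      using D(5) P0[of n] by (auto intro!: add_mono divide_right_mono)
    finally show ?thesis .
  qed
  have q_b: "cmod (Q' n) \<le> q n" "cmod (Q' (Suc n)) \<le> q n" for n
  proof -
    \<comment> \<open>One estimate for \<open>n + N\<close> and its successor: in both cases p(m -
      1/2) is within F / P n of P n, so whether it is close to a resonance is decided by
      \<open>near (n + N)\<close>.\<close>
    have gen: "cmod (Q m) \<le> 2 * C1 / sqrt (P n) * rho (n + N)"
      if mK: "K0 \<le> p (real m)" and le: "P n \<le> p (real m)" and t: "\<bar>p (real m - 1/2) - P n\<bar> \<le> F / P n" for m
    proof (cases "near (n + N)")
      case True
      have "cmod (Q m) \<le> C1 / sqrt (p (real m))" by (rule C1(2)[OF mK])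
      also have "\<dots> \<le> 2 * C1 / sqrt (P n)" using le P0[of n] C1(1) by (intro frac_le) auto
      finally show ?thesis using True by (simp add: rho_def)
    next
      case False
      define d where "d = 1 / sqrt (sqrt (P n)) / 2"
      have ss: "1 \<le> sqrt (sqrt (P n))" using P20[of n] by simp
      have d0: "0 < d" using ss by (simp add: d_def)
      have FP: "F / P n \<le> d"
      proof -
        have "2 * F \<le> sqrt (P n)" by (rule K0_facts(4)[OF PK])
        then have "F / P n \<le> (sqrt (P n) / 2) / P n" using P0[of n] by (intro divide_right_mono) auto
        also have "\<dots> = 1 / sqrt (P n) / 2" using sq[of n] P0[of n] by (simp add: field_simps)
        also have "\<dots> \<le> d"
        proof -
          have "sqrt (sqrt (P n)) * 1 \<le> sqrt (sqrt (P n)) * sqrt (sqrt (P n))" using ss by (intro mult_left_mono) auto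
          also have "\<dots> = sqrt (P n)" using P0[of n] by simp
          finally show ?thesis unfolding d_def using ss by (intro divide_right_mono divide_left_mono) (auto intro!: mult_pos_pos simp: P0)
        qed
        finally show ?thesis .
      qed
      have far: "d \<le> \<bar>p (real m - 1/2) - pi * real k\<bar>" for k
      proof -
        have "2 * d < \<bar>P n - pi * real k\<bar>" using False unfolding near_def d_def P_def by (simp add: not_le)
        then show ?thesis using t FP by linarith
      qed
      have "cmod (Q m) \<le> C1 / (p (real m) * d)" by (rule C1(3)[OF mK d0 far])
      also have "\<dots> \<le> C1 / (P n * d)" using le P0[of n] C1(1) d0 by (intro divide_left_mono mult_right_mono) auto
      also have "\<dots> = 2 * C1 / sqrt (P n) * (sqrt (sqrt (P n)) / sqrt (P n))"
        using sq(2)[of n] P0[of n] ss by (simp add: d_def field_simps)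
      also have "sqrt (sqrt (P n)) / sqrt (P n) = 1 / sqrt (sqrt (P n))"
        using P0[of n] ss by (simp add: field_simps)
      finally show ?thesis using False by (simp add: rho_def P_def)
    qed
    have fin: "cmod (- \<i> * of_real \<mu> * x) \<le> q n" if "cmod x \<le> 2 * C1 / sqrt (P n) * rho (n + N)" for x
    proof -
      have "cmod (- \<i> * of_real \<mu> * x) \<le> \<bar>\<mu>\<bar> * (2 * C1 / sqrt (P n) * rho (n + N))"
        unfolding c\<mu> using that by (intro mult_left_mono) auto
      also have "\<dots> = (\<bar>\<mu>\<bar> * (2 * C1)) / sqrt (P n) * rho (n + N)" by simp
      also have "\<dots> \<le> q n" unfolding q_def using D(4) P0[of n] rho[of n] by (intro mult_right_mono divide_right_mono) auto
      finally show ?thesis .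
    qed
    have h: "K0 \<le> p (real (n + N))" using PK[of n] by (simp add: P_def)
    note ph = p_half_bounds[OF h, folded P_def]
    show "cmod (Q' n) \<le> q n" unfolding Q'_def
      by (rule fin, rule gen) (use h ph in \<open>auto simp: P_def abs_le_iff\<close>)
    have e: "real (Suc (n + N)) - 1/2 = real (n + N) + 1/2" by simp
    show "cmod (Q' (Suc n)) \<le> q n" unfolding Q'_def
      by (rule fin, rule gen) (use PK[of "Suc n"] Pmono[of n] ph P0[of n] F_pos in \<open>auto simp: P_def[of "Suc n"] e abs_le_iff simp del: of_nat_add of_nat_Suc\<close>)
  qed
  have r_b: "cmod (Pt n) \<le> r n" "cmod (Pt (Suc n)) \<le> r n" for n
  proof -
    have h: "K0 \<le> p (real (n + N))" using PK[of n] by (simp add: P_def)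
    note f = mi_facts[OF h, folded P_def]
    have gen: "cmod (- \<i> * of_real \<mu> * tail k) \<le> r n" if k: "2 \<le> k" "P n / 8 \<le> real k" for k
    proof -
      have "sqrt (P n) / 4 \<le> sqrt (real k)"
        using k(2) P0[of n] by (intro real_le_rsqrt) (simp add: power_divide)
      then have "C3 / sqrt (real k) \<le> C3 / (sqrt (P n) / 4)" using k P0[of n] C3(1) by (intro divide_left_mono) auto
      then have "cmod (tail k) \<le> 4 * C3 / sqrt (P n)" using C3(2)[OF k(1)] by (simp add: mult.commute)
      then have "\<bar>\<mu>\<bar> * cmod (tail k) \<le> \<bar>\<mu>\<bar> * (4 * C3 / sqrt (P n))" by (intro mult_left_mono) auto
      also have "\<dots> = \<bar>\<mu>\<bar> * (4 * C3) / sqrt (P n)" by simp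
      also have "\<dots> \<le> r n" unfolding r_def using D(6) P0[of n] by (intro divide_right_mono) auto
      finally show ?thesis unfolding c\<mu> .
    qed
    show "cmod (Pt n) \<le> r n" unfolding Pt_def by (rule gen) (use f in auto)
    show "cmod (Pt (Suc n)) \<le> r n" unfolding Pt_def by (rule gen) (use f in auto)
  qed
  have r_half: "r n \<le> 1/2" for n
    unfolding r_def using sqD[of n] sq(1)[of n] D0 by (simp add: divide_le_eq)
  have r0: "0 \<le> r n" for n using r_b(1)[of n] norm_ge_zero order_trans by blast
  have q_r: "q n = r n * rho (n + N)" for n by (simp add: q_def r_def)
  have q_half: "q n \<le> 1/2" for n
    unfolding q_r using r_half[of n] rho[of n] r0[of n] mult_left_le[of "rho (n + N)" "r n"] by linarith
  have q0: "0 \<le> q n" for n unfolding q_r using r0 rho by simp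
  have J_b: "cmod (J n) \<le> (if jump n then 2 * r n else 0)" for n
    using norm_triangle_ineq4[of "Pt n" "Pt (Suc n)"] r_b[of n] by (auto simp: J_def jump_def Pt_def)
  have A'_b: "cmod (A' n) \<le> 3 * D / P n" for n
  proof -
    have 1: "D / P n ^ 3 \<le> D / P n" using P20[of n] D0 by (intro divide_left_mono) (auto intro!: self_le_power)
    have 2: "D / (P n)\<^sup>2 \<le> D / P n" using P20[of n] D0 by (intro divide_left_mono) (auto intro!: self_le_power)
    have "cmod (A' n) \<le> cmod (A (n + N)) + cmod (\<eta> n)"
      using norm_triangle_ineq4[of "A (n + N)" "\<eta> n"] by (simp add: \<eta>_def)
    also have "\<dots> \<le> D / P n + (D / P n + D / P n)"
      using A_b[of n] D(2) P0[of n] 1 2 D0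
      by (intro add_mono order_trans[OF eta_b]) (auto simp: divide_right_mono intro!: add_mono)
    finally show ?thesis by simp
  qed
  \<comment> \<open>Exchanging A for \<open>A'\<close> changes the off-diagonal term by
    \<open>\<eta>\<close> and the quadratic diagonal by half a difference of squares, which is at
    most |eta| because both moduli are below 1.\<close>
  define \<epsilon>' where "\<epsilon>' n = \<epsilon> (n + N) + of_real (((cmod (A (n + N)))\<^sup>2 - (cmod (A' n))\<^sup>2) / 2) * y (n + N) + \<eta> n * cnj (y (n + N))" for n
  define e' where "e' n = D / P n ^ 3 + 3 * cmod (\<eta> n)" for n
  have DP: "D / P n \<le> 1/4" for n
  proof -
    have "4 * D * 1 \<le> sqrt (P n) * sqrt (P n)" using sqD[of n] sq(1)[of n] D0 by (intro mult_mono) auto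
    then show ?thesis using sq(2)[of n] P0[of n] by (simp add: field_simps)
  qed
  have step': "y (Suc n + N) = (1 + of_real ((cmod (A' n))\<^sup>2 / 2)) * y (n + N) + A' n * cnj (y (n + N)) + \<epsilon>' n" for n
    using step[of "n + N"] by (simp add: N_def \<epsilon>'_def \<eta>_def algebra_simps diff_divide_distrib add_divide_distrib)
  have eps': "cmod (\<epsilon>' n) \<le> e' n * cmod (y (n + N))" for n
  proof -
    have 1: "cmod (\<epsilon> (n + N)) \<le> D / P n ^ 3 * cmod (y (n + N))"
    proof -
      have "cmod (\<epsilon> (n + N)) \<le> B / P n ^ 3 * cmod (y (n + N))" using eps[of "n + N"] by (simp add: N_def P_def)
      also have "\<dots> \<le> D / P n ^ 3 * cmod (y (n + N))"
        using D(3) P0[of n] by (intro mult_right_mono divide_right_mono) auto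
      finally show ?thesis .
    qed
    have AA: "cmod (A (n + N)) \<le> 1" "cmod (A' n) \<le> 1"
    proof -
      have "cmod (A (n + N)) \<le> D / P n" using A_b[of n] D(2) P0[of n] by (simp add: divide_right_mono)
      then show "cmod (A (n + N)) \<le> 1" using DP[of n] by linarith
      show "cmod (A' n) \<le> 1" using A'_b[of n] DP[of n] by simp
    qed
    have "\<bar>((cmod (A (n + N)))\<^sup>2 - (cmod (A' n))\<^sup>2) / 2\<bar> = \<bar>cmod (A (n + N)) - cmod (A' n)\<bar> * ((cmod (A (n + N)) + cmod (A' n)) / 2)"
      by (simp add: power2_eq_square square_diff_square_factored abs_mult)
    also have "\<dots> \<le> cmod (\<eta> n) * 1"
      unfolding \<eta>_def using AA by (intro mult_mono norm_triangle_ineq3) auto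
    finally have 2: "cmod (of_real (((cmod (A (n + N)))\<^sup>2 - (cmod (A' n))\<^sup>2) / 2) * y (n + N)) \<le> cmod (\<eta> n) * cmod (y (n + N))"
      unfolding norm_mult norm_of_real by (intro mult_right_mono) auto
    have 3: "cmod (\<eta> n * cnj (y (n + N))) = cmod (\<eta> n) * cmod (y (n + N))" by (simp add: norm_mult)
    have "cmod (\<epsilon>' n) \<le> D / P n ^ 3 * cmod (y (n + N)) + cmod (\<eta> n) * cmod (y (n + N)) + cmod (\<eta> n) * cmod (y (n + N))"
      unfolding \<epsilon>'_def by (intro order_trans[OF norm_triangle_ineq] add_mono 1 2 eq_refl[OF 3])
    also have "\<dots> \<le> e' n * cmod (y (n + N))"
      unfolding e'_def distrib_right by simp
    finally show ?thesis .
  qed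
  have s0_nn: "0 \<le> rho (n + N) / (P n)\<^sup>2" "0 \<le> P n powr (-5/2)" "0 \<le> (if jump n then 1 / (P n * sqrt (P n)) else 0)" for n
    using rho[of n] P0[of n] by auto
  have sum_s0: "summable s0"
  proof -
    have a: "summable (\<lambda>n. P n powr (-5/2))" unfolding P_def by (rule summable_p_power[OF Nn]) auto
    have b: "summable (\<lambda>n. if jump n then 1 / (P n * sqrt (P n)) else 0)"
    proof -
      have "summable (\<lambda>n. if mi (Suc (n + N)) = mi (n + N) then 0 else 1 / (p (real (n + N)) * sqrt (p (real (n + N)))))"
        by (rule summable_jump) (use Nn in auto)
      then show ?thesis by (rule back_subst[of summable]) (auto simp: jump_def P_def fun_eq_iff)
    qed
    have c: "summable (\<lambda>n. rho (n + N) / (P n)\<^sup>2)"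
    proof (rule summable_comparison_test)
      have "summable (\<lambda>n. P n powr (-9/4))" unfolding P_def by (rule summable_p_power[OF Nn]) auto
      then show "summable (\<lambda>n. (if near (n + N) then 1 / (p (real (n + N)))\<^sup>2 else 0) + P n powr (-9/4))"
        by (intro summable_add summable_near[OF Nn]) auto
      show "\<exists>M. \<forall>n\<ge>M. norm (rho (n + N) / (P n)\<^sup>2) \<le> (if near (n + N) then 1 / (p (real (n + N)))\<^sup>2 else 0) + P n powr (-9/4)"
      proof (intro exI allI impI)
        fix n
        have "1 / sqrt (sqrt (P n)) / (P n)\<^sup>2 = P n powr (-9/4)"
        proof -
          have "sqrt (sqrt (P n)) = P n powr (1/4)" using P0[of n] by (simp add: powr_half_sqrt[symmetric] powr_powr)
          moreover have "(P n)\<^sup>2 = P n powr 2" using P0[of n] by (simp add: powr_numeral)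
          ultimately have "1 / sqrt (sqrt (P n)) / (P n)\<^sup>2 = 1 / (P n powr (1/4) * P n powr 2)" by simp
          also have "\<dots> = P n powr (-9/4)" by (simp add: powr_add[symmetric] powr_minus_divide)
          finally show ?thesis .
        qed
        then show "norm (rho (n + N) / (P n)\<^sup>2) \<le> (if near (n + N) then 1 / (p (real (n + N)))\<^sup>2 else 0) + P n powr (-9/4)"
          using rho[of n] by (auto simp: rho_def P_def)
      qed
    qed
    show ?thesis unfolding s0_def by (intro summable_add a b c)
  qed
  \<comment> \<open>Dominates the coefficients 9 D^3, 18 D^3 and 4 D that occur below.\<close>
  define E where "E = 20 * D ^ 3"
  have DD: "D \<le> D ^ 2" "D ^ 2 \<le> D ^ 3" "1 \<le> D ^ 3"
    using D(1) by (auto intro!: power_increasing self_le_power one_le_power)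
  have p52: "1 / ((P n)\<^sup>2 * sqrt (P n)) = P n powr (-5/2)" for n
  proof -
    have "sqrt (P n) = P n powr (1/2)" "(P n)\<^sup>2 = P n powr 2" using P0[of n] by (simp_all add: powr_half_sqrt powr_numeral)
    then have "1 / ((P n)\<^sup>2 * sqrt (P n)) = 1 / (P n powr 2 * P n powr (1/2))" by simp
    also have "\<dots> = P n powr (-5/2)" by (simp add: powr_add[symmetric] powr_minus_divide)
    finally show ?thesis .
  qed
  have p3: "1 / P n ^ 3 \<le> P n powr (-5/2)" for n
  proof -
    have "(P n)\<^sup>2 * sqrt (P n) \<le> (P n)\<^sup>2 * P n"
      using sq[of n] mult_left_mono[OF sq(1)[of n], of "sqrt (P n)"] by (intro mult_left_mono) auto
    then have "1 / ((P n)\<^sup>2 * P n) \<le> 1 / ((P n)\<^sup>2 * sqrt (P n))" using P0[of n] by (intro divide_left_mono) auto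
    then show ?thesis unfolding p52 by (simp add: power2_eq_square power3_eq_cube)
  qed
  have Es: "x \<le> E * s0 n" if "x \<le> c * rho (n + N) / (P n)\<^sup>2 + c * P n powr (-5/2) + (if jump n then c / (P n * sqrt (P n)) else 0)" "c \<le> E" for x c n
  proof -
    have "c * rho (n + N) / (P n)\<^sup>2 + c * P n powr (-5/2) + (if jump n then c / (P n * sqrt (P n)) else 0) = c * s0 n"
      by (auto simp: s0_def algebra_simps)
    also have "\<dots> \<le> E * s0 n"
      using that(2) s0_nn[of n] by (intro mult_right_mono) (auto simp: s0_def)
    finally show ?thesis using that(1) by linarith
  qed
  have t0: "0 \<le> c * rho (n + N) / (P n)\<^sup>2" "0 \<le> c * P n powr (-5/2)" "0 \<le> (if jump n then c / (P n * sqrt (P n)) else 0)" if "0 \<le> c" for c n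
    using that rho[of n] P0[of n] by auto
  have E9: "9 * D ^ 3 \<le> E" "0 \<le> 9 * D ^ 3" using DD D0 unfolding E_def by simp_all
  note tt = t0[OF E9(2)]
  have rr: "r n * r n = D\<^sup>2 / P n" for n using sq(2)[of n] P0[of n] by (simp add: r_def power2_eq_square)
  have rr3: "r n * r n * r n = D ^ 3 / (P n * sqrt (P n))" for n
    unfolding rr r_def using P0[of n] by (simp add: power2_eq_square power3_eq_cube)
  have sA1: "r n * q n * cmod (A' n) \<le> 9 * D ^ 3 * rho (n + N) / (P n)\<^sup>2" for n
  proof -
    have "r n * q n * cmod (A' n) = (r n * r n) * rho (n + N) * cmod (A' n)" by (simp add: q_r)
    also have "\<dots> \<le> D\<^sup>2 / P n * rho (n + N) * (3 * D / P n)"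
      unfolding rr using A'_b[of n] rho[of n] P0[of n] by (intro mult_left_mono) auto
    also have "\<dots> = 3 * D ^ 3 * rho (n + N) / (P n)\<^sup>2" by (simp add: power2_eq_square power3_eq_cube)
    also have "\<dots> \<le> 9 * D ^ 3 * rho (n + N) / (P n)\<^sup>2"
      using DD D0 rho[of n] by (intro divide_right_mono mult_right_mono) auto
    finally show ?thesis .
  qed
  have sA2: "q n * (cmod (A' n))\<^sup>2 \<le> 9 * D ^ 3 * P n powr (-5/2)" for n
  proof -
    have "q n * (cmod (A' n))\<^sup>2 \<le> r n * (3 * D / P n)\<^sup>2"
      using A'_b[of n] rho[of n] r0[of n] q0[of n] unfolding q_r by (intro mult_mono power_mono) (auto simp: mult_left_le)
    also have "\<dots> = 9 * D ^ 3 * (1 / ((P n)\<^sup>2 * sqrt (P n)))" using P0[of n] by (simp add: r_def power2_eq_square power3_eq_cube mult_ac)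
    finally show ?thesis unfolding p52 .
  qed
  have sJ: "u * v * cmod (J n) \<le> (if jump n then 9 * D ^ 3 / (P n * sqrt (P n)) else 0)" if "0 \<le> u" "u \<le> r n" "0 \<le> v" "v \<le> r n" for u v n
  proof -
    have "u * v * cmod (J n) \<le> r n * r n * (if jump n then 2 * r n else 0)"
      using that J_b[of n] r0[of n] by (intro mult_mono) auto
    also have "\<dots> \<le> (if jump n then 9 * (r n * r n * r n) else 0)" using r0[of n] by simp
    finally show ?thesis unfolding rr3 by (auto split: if_splits)
  qed
  have q_le_r: "q n \<le> r n" for n unfolding q_r using rho[of n] r0[of n] by (simp add: mult_left_le)
  have sums: "summable (\<lambda>n. E * s0 n)" by (rule summable_mult[OF sum_s0])
  \<comment> \<open>The terms P^(-5/2) of a convergent series tend to 0; their fifth root times D is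
    \<open>r\<close>.\<close>
  have lim_r: "r \<longlonglongrightarrow> 0"
  proof -
    have "(\<lambda>n. P n powr (-5/2)) \<longlonglongrightarrow> 0"
      using summable_LIMSEQ_zero[OF summable_p_power[OF Nn, where s = "-5/2"]] by (simp add: P_def)
    then have "(\<lambda>n. D * (P n powr (-5/2)) powr (1/5)) \<longlonglongrightarrow> D * 0 powr (1/5)"
      by (intro tendsto_mult tendsto_const tendsto_powr') auto
    moreover have "D * (P n powr (-5/2)) powr (1/5) = r n" for n
    proof -
      have "(P n powr (-5/2)) powr (1/5) = P n powr (- (1/2))" unfolding powr_powr by simp
      also have "\<dots> = 1 / sqrt (P n)" using P0[of n] unfolding powr_minus_divide by (simp add: powr_half_sqrt)
      finally show ?thesis by (simp add: r_def)
    qed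
    ultimately show ?thesis by simp
  qed
  have "convergent (\<lambda>n. ln (cmod (y (n + N))))"
  proof (rule gauge_convergence[where y = "\<lambda>n. y (n + N)" and A = A' and \<epsilon> = \<epsilon>' and e = e' and Q = Q' and J = J and P = Pt and q = q and r = r and s = "\<lambda>n. E * s0 n"])
    show "y (Suc n + N) = (1 + of_real ((cmod (A' n))\<^sup>2 / 2)) * y (n + N) + A' n * cnj (y (n + N)) + \<epsilon>' n" for n by (rule step')
    show "cmod (\<epsilon>' n) \<le> e' n * cmod (y (n + N))" for n by (rule eps')
    show "A' n = Q' n - Q' (Suc n) + J n" for n by (rule A'_def)
    show "J n = Pt n - Pt (Suc n)" for n by (rule J_def)
    show "Q' \<longlonglongrightarrow> 0" by (rule Lim_null_comparison[OF _ lim_r]) (intro always_eventually allI order_trans[OF q_b(1) q_le_r])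
    show "Pt \<longlonglongrightarrow> 0" by (rule Lim_null_comparison[OF _ lim_r]) (use r_b(1) in auto)
    show "y (n + N) \<noteq> 0" for n using nz[of "n + N"] by (simp add: N_def)
    show "summable (\<lambda>n. E * s0 n)" by (rule sums)
    fix n
    show "cmod (Q' n) \<le> q n" "cmod (Q' (Suc n)) \<le> q n" "q n \<le> 1/2" by (rule q_b q_half)+
    show "cmod (Pt n) \<le> r n" "cmod (Pt (Suc n)) \<le> r n" "r n \<le> 1/2" by (rule r_b r_half)+
    show "r n * q n * cmod (A' n) \<le> E * s0 n"
      using sA1[of n] tt[of n] by (intro Es[OF _ E9(1)]) linarith
    have "(q n)\<^sup>2 * cmod (A' n) \<le> r n * q n * cmod (A' n)"
      unfolding power2_eq_square[of "q n"] using q_le_r[of n] q0[of n] by (intro mult_right_mono) auto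
    then show "(q n)\<^sup>2 * cmod (A' n) \<le> E * s0 n"
      using sA1[of n] tt[of n] by (intro Es[OF _ E9(1)]) linarith
    show "q n * (cmod (A' n))\<^sup>2 \<le> E * s0 n"
      using sA2[of n] tt[of n] by (intro Es[OF _ E9(1)]) linarith
    show "(q n)\<^sup>2 * cmod (J n) \<le> E * s0 n"
      using sJ[OF q0 q_le_r q0 q_le_r, of n] tt[of n] unfolding power2_eq_square[of "q n"] power2_eq_square[of "r n"] by (intro Es[OF _ E9(1)]) linarith
    show "(r n)\<^sup>2 * cmod (J n) \<le> E * s0 n"
      using sJ[OF r0 order_refl r0 order_refl, of n] tt[of n] unfolding power2_eq_square[of "q n"] power2_eq_square[of "r n"] by (intro Es[OF _ E9(1)]) linarith
    show "r n * q n * cmod (J n) \<le> E * s0 n"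
      using sJ[OF r0 order_refl q0 q_le_r, of n] tt[of n] by (intro Es[OF _ E9(1)]) linarith
    show "r n * (cmod (J n))\<^sup>2 \<le> E * s0 n"
    proof -
      have "r n * (cmod (J n))\<^sup>2 \<le> 2 * (r n * r n * cmod (J n))"
      proof -
        have "cmod (J n) \<le> 2 * r n" using J_b[of n] r0[of n] by (auto split: if_splits)
        then have "r n * cmod (J n) * cmod (J n) \<le> r n * (2 * r n) * cmod (J n)"
          using r0[of n] by (intro mult_right_mono mult_left_mono) auto
        then show ?thesis by (simp add: power2_eq_square mult_ac)
      qed
      also have "\<dots> \<le> (if jump n then 18 * D ^ 3 / (P n * sqrt (P n)) else 0)"
        using sJ[OF r0 order_refl r0 order_refl, of n] by (auto split: if_splits)
      finally have j18: "r n * (cmod (J n))\<^sup>2 \<le> (if jump n then 18 * D ^ 3 / (P n * sqrt (P n)) else 0)" .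
      have "0 \<le> 18 * D ^ 3" "18 * D ^ 3 \<le> E" using D0 by (simp_all add: E_def)
      then show ?thesis using j18 t0[OF \<open>0 \<le> 18 * D ^ 3\<close>, of n] by (intro Es[of _ "18 * D ^ 3"]) linarith+
    qed
    show "e' n \<le> E * s0 n"
    proof (rule Es)
      have "e' n \<le> 4 * D * (1 / P n ^ 3) + (if jump n then 3 * D / (P n)\<^sup>2 else 0)"
        unfolding e'_def using eta_b[of n] by (auto split: if_splits)
      also have "\<dots> \<le> 4 * D * P n powr (-5/2) + (if jump n then 3 * D / (P n * sqrt (P n)) else 0)"
      proof (intro add_mono mult_left_mono p3)
        have "P n * sqrt (P n) \<le> (P n)\<^sup>2" unfolding power2_eq_square
          using sq[of n] mult_left_mono[OF sq(1)[of n], of "sqrt (P n)"] P0[of n] by (intro mult_left_mono) auto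
        then have "3 * D / (P n)\<^sup>2 \<le> 3 * D / (P n * sqrt (P n))" using D0 P0[of n] by (intro divide_left_mono) auto
        then show "(if jump n then 3 * D / (P n)\<^sup>2 else 0) \<le> (if jump n then 3 * D / (P n * sqrt (P n)) else 0)" by simp
      qed (use D0 in simp)
      also have "\<dots> \<le> 4 * D * rho (n + N) / (P n)\<^sup>2 + 4 * D * P n powr (-5/2) + (if jump n then 4 * D / (P n * sqrt (P n)) else 0)"
        using t0[of "4 * D" n] D0 P0[of n] by (auto intro!: add_increasing divide_right_mono)
      finally show "e' n \<le> 4 * D * rho (n + N) / (P n)\<^sup>2 + 4 * D * P n powr (-5/2) + (if jump n then 4 * D / (P n * sqrt (P n)) else 0)" .
      show "4 * D \<le> E" using DD D0 by (simp add: E_def)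
    qed
  qed
  then show ?thesis
    by (rule iffD1[OF convergent_ignore_initial_segment])
qed

end

section \<open>Airy functions\<close>

text \<open>Both Maclaurin series are, up to a factor x, power series u(s) in s = x^3, and the Airy
  equation becomes 9 s u'' + m u' = u, with m = 6 for u(x^3) and m = 12 for x u(x^3). The recursion
  is this equation read off coefficientwise; \<open>diffs\<close> yields the derivative
  series.\<close>

locale airy_coeffs =
  fixes a :: "nat \<Rightarrow> real" and m :: real
  assumes m: "6 \<le> m" and rec: "\<And>k. (real k + 1) * (9 * real k + m) * a (Suc k) = a k"
begin

definition ps :: "nat \<Rightarrow> real \<Rightarrow> real" where
  "ps j s = (\<Sum>k. (diffs ^^ j) a k * s ^ k)"

lemma summable_a: "summable (\<lambda>k. a k * s ^ k)"
proof (rule summable_ratio_test[of "1/2" "nat \<lceil>\<bar>s\<bar>\<rceil>"])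
  fix k assume "nat \<lceil>\<bar>s\<bar>\<rceil> \<le> k"
  then have k: "\<bar>s\<bar> \<le> real k" by linarith
  define c where "c = (real k + 1) * (9 * real k + m)"
  have c6: "2 * (real k + 1) \<le> c"
  proof -
    have "(real k + 1) * 2 \<le> (real k + 1) * (9 * real k + m)" using m by (intro mult_left_mono) auto
    then show ?thesis by (simp add: c_def mult.commute)
  qed
  have "0 < 2 * (real k + 1)" by simp
  then have c0: "0 < c" using c6 by (rule less_le_trans)
  have "c * a (Suc k) = a k" using rec[of k] by (simp add: c_def)
  then have "a (Suc k) = a k / c" using c0 by (simp add: field_simps)
  then have "norm (a (Suc k) * s ^ Suc k) = norm (a k * s ^ k) * (\<bar>s\<bar> / c)"
    using c0 by (simp add: abs_mult)
  also have "\<dots> \<le> norm (a k * s ^ k) * (1/2)"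
  proof (rule mult_left_mono)
    have "2 * \<bar>s\<bar> \<le> c" using c6 k unfolding distrib_left by linarith
    then show "\<bar>s\<bar> / c \<le> 1/2" using c0 by (simp add: field_simps)
  qed simp
  finally show "norm (a (Suc k) * s ^ Suc k) \<le> 1/2 * norm (a k * s ^ k)" by simp
qed simp

lemma summable_diffs: "summable (\<lambda>k. (diffs ^^ j) a k * s ^ k)"
  by (induction j arbitrary: s) (auto intro: summable_a termdiff_converges_all)

lemma ps_deriv: "(ps j has_real_derivative ps (Suc j) s) (at s)"
  using termdiffs_strong_converges_everywhere[OF summable_diffs[of j], of s]
  by (simp add: ps_def[abs_def])

lemma ps_ode: "9 * s * ps 2 s + m * ps 1 s = ps 0 s"
proof -
  define g where "g k = real k * diffs a k * s ^ k" for k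
  have 1: "(\<lambda>k. g (Suc k)) sums (s * ps 2 s)"
  proof -
    have "(\<lambda>k. s * ((diffs ^^ 2) a k * s ^ k)) sums (s * ps 2 s)"
      unfolding ps_def by (intro sums_mult summable_sums summable_diffs)
    then show ?thesis by (simp add: g_def numeral_2_eq_2 diffs_def mult_ac)
  qed
  then have 2: "g sums (s * ps 2 s)" using sums_Suc_iff[of g] by (simp add: g_def)
  have 3: "(\<lambda>k. diffs a k * s ^ k) sums ps 1 s"
    using summable_sums[OF summable_diffs[of 1 s]] by (simp add: ps_def)
  have "(\<lambda>k. 9 * g k + m * (diffs a k * s ^ k)) sums (9 * (s * ps 2 s) + m * ps 1 s)"
    by (intro sums_add sums_mult 2 3)
  moreover have "9 * g k + m * (diffs a k * s ^ k) = a k * s ^ k" for k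
    unfolding g_def diffs_def rec[of k, symmetric] by (simp add: algebra_simps)
  ultimately have "(\<lambda>k. a k * s ^ k) sums (9 * (s * ps 2 s) + m * ps 1 s)" by simp
  then show ?thesis by (simp add: ps_def sums_iff mult.assoc)
qed

lemma ps_0: "ps 0 0 = a 0"
  by (simp add: ps_def)

lemma cube_deriv: "((\<lambda>x. ps j (x ^ 3)) has_real_derivative (3 * x\<^sup>2 * ps (Suc j) (x ^ 3))) (at x)"
  by (rule DERIV_cong[OF DERIV_chain2[where f = "ps j" and g = "\<lambda>x. x ^ 3", OF ps_deriv]]) (auto intro!: derivative_eq_intros)

end

lemma frac: "A \<noteq> 0 \<Longrightarrow> A * B / (x * y * A * z) = B / z / (x * y)" for A B x y z :: real
  by simp

lemma airy_f_ode:
  shows "(airy_f has_real_derivative deriv airy_f x) (at x)"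
    and "(deriv airy_f has_real_derivative x * airy_f x) (at x)"
    and "airy_f 0 = 1" and "deriv airy_f 0 = 0"
proof -
  define a where "a k = (3 ^ k * pochhammer (1/3) k / fact (3 * k) :: real)" for k
  interpret airy_coeffs a 6
  proof
    fix k
    have "fact (3 * Suc k) = (3 * real k + 3) * (3 * real k + 2) * (3 * real k + 1) * fact (3 * k)"
      by (simp add: numeral_3_eq_3 algebra_simps)
    then have "a (Suc k) = 3 * (1/3 + real k) * (3 ^ k * pochhammer (1/3) k) / ((3 * real k + 3) * (3 * real k + 2) * (3 * real k + 1) * fact (3 * k))"
      by (simp add: a_def pochhammer_Suc)
    also have "\<dots> = a k / ((3 * real k + 3) * (3 * real k + 2))"
    proof -
      have "3 * (1/3 + real k) = 3 * real k + 1" by simp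
      moreover have "3 * real k + 1 \<noteq> 0" using of_nat_0_le_iff[of k, where 'a = real] by linarith
      ultimately show ?thesis by (simp only: a_def) (rule frac)
    qed
    finally have "a (Suc k) = a k / ((3 * real k + 3) * (3 * real k + 2))" .
    moreover have "(3 * real k + 3) * (3 * real k + 2) = (real k + 1) * (9 * real k + 6)" by (simp add: algebra_simps)
    moreover have "(real k + 1) * (9 * real k + 6) \<noteq> 0" by simp
    ultimately show "(real k + 1) * (9 * real k + 6) * a (Suc k) = a k" by simp
  qed simp
  have f: "airy_f = (\<lambda>x. ps 0 (x ^ 3))"
    by (simp add: airy_f_def ps_def a_def fun_eq_iff power_mult)
  have d1: "(airy_f has_real_derivative (3 * x\<^sup>2 * ps 1 (x ^ 3))) (at x)" for x
    unfolding f using cube_deriv[of 0] by simp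
  then have D: "deriv airy_f = (\<lambda>x. 3 * x\<^sup>2 * ps 1 (x ^ 3))" by (auto simp: fun_eq_iff intro: DERIV_imp_deriv)
  show "(airy_f has_real_derivative deriv airy_f x) (at x)" unfolding D by (rule d1)
  have "(deriv airy_f has_real_derivative (6 * x * ps 1 (x ^ 3) + 3 * x\<^sup>2 * (3 * x\<^sup>2 * ps 2 (x ^ 3)))) (at x)"
    unfolding D using cube_deriv[of 1 x]
    by (auto intro!: derivative_eq_intros simp: numeral_2_eq_2)
  moreover have "6 * x * ps 1 (x ^ 3) + 3 * x\<^sup>2 * (3 * x\<^sup>2 * ps 2 (x ^ 3)) = x * airy_f x"
    unfolding f ps_ode[of "x ^ 3", symmetric] by (simp add: algebra_simps power2_eq_square power3_eq_cube)
  ultimately show "(deriv airy_f has_real_derivative x * airy_f x) (at x)" by simp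
  show "airy_f 0 = 1" by (simp add: f ps_0 a_def)
  show "deriv airy_f 0 = 0" by (simp add: D)
qed

lemma airy_g_ode:
  shows "(airy_g has_real_derivative deriv airy_g x) (at x)"
    and "(deriv airy_g has_real_derivative x * airy_g x) (at x)"
    and "airy_g 0 = 0" and "deriv airy_g 0 = 1"
proof -
  define a where "a k = (3 ^ k * pochhammer (2/3) k / fact (3 * k + 1) :: real)" for k
  interpret airy_coeffs a 12
  proof
    fix k
    have "fact (3 * Suc k + 1) = (3 * real k + 4) * (3 * real k + 3) * (3 * real k + 2) * fact (3 * k + 1)"
      by (simp add: numeral_3_eq_3 algebra_simps)
    then have "a (Suc k) = 3 * (2/3 + real k) * (3 ^ k * pochhammer (2/3) k) / ((3 * real k + 4) * (3 * real k + 3) * (3 * real k + 2) * fact (3 * k + 1))"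
      by (simp add: a_def pochhammer_Suc)
    also have "\<dots> = a k / ((3 * real k + 4) * (3 * real k + 3))"
    proof -
      have "3 * (2/3 + real k) = 3 * real k + 2" by simp
      moreover have "3 * real k + 2 \<noteq> 0" using of_nat_0_le_iff[of k, where 'a = real] by linarith
      ultimately show ?thesis by (simp only: a_def) (rule frac)
    qed
    finally have "a (Suc k) = a k / ((3 * real k + 4) * (3 * real k + 3))" .
    moreover have "(3 * real k + 4) * (3 * real k + 3) = (real k + 1) * (9 * real k + 12)" by (simp add: algebra_simps)
    moreover have "(real k + 1) * (9 * real k + 12) \<noteq> 0" by simp
    ultimately show "(real k + 1) * (9 * real k + 12) * a (Suc k) = a k" by simp
  qed simp
  have f: "airy_g = (\<lambda>x. x * ps 0 (x ^ 3))"
  proof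
    fix x
    have "(\<lambda>k. x * (a k * (x ^ 3) ^ k)) sums (x * ps 0 (x ^ 3))"
      using sums_mult[OF summable_sums[OF summable_a]] by (simp add: ps_def)
    moreover have "x * (a k * (x ^ 3) ^ k) = 3 ^ k * pochhammer (2/3) k * x ^ (3 * k + 1) / fact (3 * k + 1)" for k
      unfolding a_def power_add power_mult[of x 3 k] by (simp del: fact_Suc)
    ultimately show "airy_g x = x * ps 0 (x ^ 3)"
      unfolding airy_g_def by (intro sums_unique[symmetric]) (simp only:)
  qed
  have d1: "(airy_g has_real_derivative (ps 0 (x ^ 3) + 3 * x ^ 3 * ps 1 (x ^ 3))) (at x)" for x
    unfolding f using cube_deriv[of 0 x]
    by (auto intro!: derivative_eq_intros simp: power2_eq_square power3_eq_cube)
  then have D: "deriv airy_g = (\<lambda>x. ps 0 (x ^ 3) + 3 * x ^ 3 * ps 1 (x ^ 3))" by (auto simp: fun_eq_iff intro: DERIV_imp_deriv)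
  show "(airy_g has_real_derivative deriv airy_g x) (at x)" unfolding D by (rule d1)
  have "(deriv airy_g has_real_derivative (3 * x\<^sup>2 * ps 1 (x ^ 3) + (9 * x\<^sup>2 * ps 1 (x ^ 3) + 3 * x ^ 3 * (3 * x\<^sup>2 * ps 2 (x ^ 3))))) (at x)"
    unfolding D using cube_deriv[of 0 x] cube_deriv[of 1 x]
    by (auto intro!: derivative_eq_intros simp: numeral_2_eq_2)
  moreover have "3 * x\<^sup>2 * ps 1 (x ^ 3) + (9 * x\<^sup>2 * ps 1 (x ^ 3) + 3 * x ^ 3 * (3 * x\<^sup>2 * ps 2 (x ^ 3))) = x * airy_g x"
    unfolding f ps_ode[of "x ^ 3", symmetric] by (simp add: algebra_simps power2_eq_square power3_eq_cube)
  ultimately show "(deriv airy_g has_real_derivative x * airy_g x) (at x)" by simp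
  show "airy_g 0 = 0" by (simp add: f)
  show "deriv airy_g 0 = 1" by (simp add: D ps_0 a_def)
qed

definition Ai' :: "real \<Rightarrow> real" where
  "Ai' x = airy_c1 * deriv airy_f x - airy_c2 * deriv airy_g x"

definition Bi' :: "real \<Rightarrow> real" where
  "Bi' x = sqrt 3 * (airy_c1 * deriv airy_f x + airy_c2 * deriv airy_g x)"

lemma Ai_deriv: "(Ai has_real_derivative Ai' x) (at x)"
  unfolding Ai_def[abs_def] Ai'_def by (auto intro!: derivative_eq_intros airy_f_ode airy_g_ode)

lemma Bi_deriv: "(Bi has_real_derivative Bi' x) (at x)"
  unfolding Bi_def[abs_def] Bi'_def by (auto intro!: derivative_eq_intros airy_f_ode airy_g_ode)

lemma Ai'_deriv: "(Ai' has_real_derivative x * Ai x) (at x)"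
  unfolding Ai'_def[abs_def] Ai_def
  by (auto intro!: derivative_eq_intros airy_f_ode airy_g_ode simp: algebra_simps)

lemma Bi'_deriv: "(Bi' has_real_derivative x * Bi x) (at x)"
  unfolding Bi'_def[abs_def] Bi_def
  by (auto intro!: derivative_eq_intros airy_f_ode airy_g_ode simp: algebra_simps)

lemma airy_at_0: "Ai 0 = airy_c1" "Bi 0 = sqrt 3 * airy_c1" "Ai' 0 = - airy_c2" "Bi' 0 = sqrt 3 * airy_c2"
  by (simp_all add: Ai_def Bi_def Ai'_def Bi'_def airy_f_ode airy_g_ode)

text \<open>The reflection formula at 1/3 with sin (pi/3) = sqrt 3 / 2. It fixes the Wronskian of Ai
  and Bi.\<close>

lemma Gamma_third_product: "Gamma (1/3 :: real) * Gamma (2/3) = 2 * pi / sqrt 3"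
proof -
  have "complex_of_real (Gamma (1/3) * Gamma (2/3)) = Gamma (1/3) * Gamma (1 - 1/3)"
    using Gamma_complex_of_real[of "1/3"] Gamma_complex_of_real[of "2/3"] by simp
  also have "\<dots> = of_real pi / sin (of_real pi * (1/3))" by (rule Gamma_reflection_complex)
  also have "sin (of_real pi * (1/3)) = complex_of_real (sin (pi / 3))" by (simp flip: sin_of_real)
  also have "of_real pi / complex_of_real (sin (pi / 3)) = of_real (2 * pi / sqrt 3)" by (simp add: sin_60)
  finally show ?thesis by (simp only: of_real_eq_iff)
qed

lemma airy_c1_c2: "airy_c1 * airy_c2 = sqrt 3 / (6 * pi)"
proof -
  have "airy_c1 * airy_c2 = 1 / ((3 powr (2/3) * 3 powr (1/3)) * (Gamma (1/3) * Gamma (2/3)))"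
    by (simp add: airy_c1_def airy_c2_def mult_ac)
  also have "3 powr (2/3) * 3 powr (1/3) = (3::real)" by (simp flip: powr_add)
  finally show ?thesis unfolding Gamma_third_product by (simp add: field_simps)
qed

lemma airy_wronskian: "Ai x * Bi' x - Ai' x * Bi x = 1 / pi"
proof -
  define w where "w x = Ai x * Bi' x - Ai' x * Bi x" for x
  have "(w has_real_derivative 0) (at x)" for x
    unfolding w_def[abs_def]
    by (auto intro!: derivative_eq_intros Ai_deriv Bi_deriv Ai'_deriv Bi'_deriv simp: algebra_simps)
  then have "w x = w 0" using DERIV_isconst_all by blast
  also have "w 0 = 2 * sqrt 3 * (airy_c1 * airy_c2)" by (simp add: w_def airy_at_0 algebra_simps)
  also have "\<dots> = 1 / pi" unfolding airy_c1_c2 by (simp add: field_simps)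
  finally show ?thesis by (simp add: w_def)
qed

text \<open>Up to a constant factor, amom 0 is $\mathrm{Ai}^2 + \mathrm{Bi}^2$: both solve $P''' = 4 z P' + 2 P$ and their
  initial values agree. For $z \to -\infty$ it is a perturbed Gaussian integral.\<close>

definition amom :: "nat \<Rightarrow> real \<Rightarrow> real" where
  "amom j z = integral {0..} (\<lambda>v. v ^ (2 * j) * exp (z * v\<^sup>2 - v ^ 6 / 12))"

text \<open>With w = max 1 (v^2) the growing part of the exponent is at most c w. Once w exceeds 12
  c + 1, the term v^6/12 = w^3/12 absorbs it; before that, c (12 c + 1) is a bound.\<close>

lemma amom_integrand_bound:
  assumes "0 \<le> v"
  shows "v ^ m * exp (z * v\<^sup>2 - v ^ 6 / 12) \<le> exp ((\<bar>z\<bar> + real m + 1) * (12 * (\<bar>z\<bar> + real m + 1) + 1)) * exp (- 1 * v)"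
proof -
  define c where "c = \<bar>z\<bar> + real m + 1"
  have c1: "1 \<le> c" by (simp add: c_def)
  define w where "w = max 1 (v\<^sup>2)"
  have w: "1 \<le> w" "v\<^sup>2 \<le> w" "v \<le> w"
  proof -
    show "1 \<le> w" "v\<^sup>2 \<le> w" by (simp_all add: w_def)
    show "v \<le> w"
    proof (cases "v \<le> 1")
      case False
      then have "v * 1 \<le> v * v" by (intro mult_left_mono) auto
      then show ?thesis by (simp add: w_def power2_eq_square)
    qed (simp add: w_def)
  qed
  have vm: "v ^ m \<le> exp (real m * v)"
  proof -
    have "v \<le> exp v" using exp_ge_add_one_self[of v] by linarith
    then have "v ^ m \<le> exp v ^ m" using assms by (intro power_mono)
    then show ?thesis by (simp add: exp_of_nat_mult)
  qed
  have e: "z * v\<^sup>2 - v ^ 6 / 12 + real m * v + v \<le> c * (12 * c + 1)"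
  proof -
    have "z * v\<^sup>2 \<le> \<bar>z\<bar> * w" using w by (intro mult_mono) auto
    moreover have "real m * v \<le> real m * w" using w by (intro mult_left_mono) auto
    ultimately have 1: "z * v\<^sup>2 + real m * v + v \<le> c * w" using w by (simp add: c_def algebra_simps)
    show ?thesis
    proof (cases "w \<le> 12 * c + 1")
      case True
      then have "c * w \<le> c * (12 * c + 1)" using c1 by (intro mult_left_mono) auto
      moreover have "0 \<le> v ^ 6 / 12" using assms by simp
      ultimately show ?thesis using 1 by linarith
    next
      case False
      then have wv: "w = v\<^sup>2" using c1 by (simp add: w_def max_def split: if_splits)
      have "v ^ 6 = w * (w * w)" unfolding wv by (simp add: eval_nat_numeral)
      also have "w * (w * w) \<ge> w * (12 * c * 1)"
        using False w c1 by (intro mult_left_mono mult_mono) auto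
      finally have "c * w \<le> v ^ 6 / 12" by (simp add: mult_ac)
      moreover have "0 \<le> c * (12 * c + 1)" using c1 by simp
      ultimately show ?thesis using 1 by linarith
    qed
  qed
  have "v ^ m * exp (z * v\<^sup>2 - v ^ 6 / 12) \<le> exp (real m * v) * exp (z * v\<^sup>2 - v ^ 6 / 12)"
    using vm by (intro mult_right_mono) auto
  also have "\<dots> = exp (z * v\<^sup>2 - v ^ 6 / 12 + real m * v + v) * exp (- 1 * v)"
    by (simp flip: exp_add)
  also have "\<dots> \<le> exp (c * (12 * c + 1)) * exp (- 1 * v)"
    using e by (intro mult_right_mono) auto
  finally show ?thesis by (simp add: c_def)
qed

lemma amom_integrable: "(\<lambda>v::real. v ^ m * exp (z * v\<^sup>2 - v ^ 6 / 12)) integrable_on {0..}"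
proof (rule measurable_bounded_by_integrable_imp_integrable)
  show "(\<lambda>v. v ^ m * exp (z * v\<^sup>2 - v ^ 6 / 12)) \<in> borel_measurable (lebesgue_on {0..})"
    by (intro continuous_imp_measurable_on_sets_lebesgue continuous_intros) auto
  show "(\<lambda>v. exp ((\<bar>z\<bar> + real m + 1) * (12 * (\<bar>z\<bar> + real m + 1) + 1)) * exp (- 1 * v)) integrable_on {0..}"
    by (intro integrable_on_mult_right has_integral_integrable[OF has_integral_exp_minus_to_infinity]) auto
  show "norm (v ^ m * exp (z * v\<^sup>2 - v ^ 6 / 12)) \<le> exp ((\<bar>z\<bar> + real m + 1) * (12 * (\<bar>z\<bar> + real m + 1) + 1)) * exp (- 1 * v)" if "v \<in> {0..}" for v
    using amom_integrand_bound[of v m z] that by (simp add: abs_mult)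
qed auto

lemma amom_has_integral: "((\<lambda>v. v ^ (2 * j) * exp (z * v\<^sup>2 - v ^ 6 / 12)) has_integral amom j z) {0..}"
  unfolding amom_def by (rule integrable_integral[OF amom_integrable])

text \<open>Differentiation in z brings down v^2. The remainder is |exp x - 1 - x| <= x^2 exp |x|
  with x = h v^2, and for |h| <= 1 it is dominated by h^2 times the integrand of
  \<open>amom (j + 2)\<close> at |z| + 1.\<close>

lemma amom_deriv: "(amom j has_real_derivative amom (Suc j) z) (at z)"
proof -
  define C where "C = amom (j + 2) (\<bar>z\<bar> + 1)"
  have bd: "\<bar>amom j (z + h) - amom j z - h * amom (Suc j) z\<bar> \<le> h\<^sup>2 * C" if h: "\<bar>h\<bar> \<le> 1" for h
  proof -
    have i1: "((\<lambda>v. v ^ (2 * j) * exp ((z + h) * v\<^sup>2 - v ^ 6 / 12) - v ^ (2 * j) * exp (z * v\<^sup>2 - v ^ 6 / 12)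
        - h * (v ^ (2 * Suc j) * exp (z * v\<^sup>2 - v ^ 6 / 12))) has_integral
        (amom j (z + h) - amom j z - h * amom (Suc j) z)) {0..}"
      by (intro has_integral_diff has_integral_mult_right amom_has_integral)
    have i2: "((\<lambda>v. h\<^sup>2 * (v ^ (2 * (j + 2)) * exp ((\<bar>z\<bar> + 1) * v\<^sup>2 - v ^ 6 / 12))) has_integral h\<^sup>2 * C) {0..}"
      unfolding C_def by (intro has_integral_mult_right amom_has_integral)
    have "norm (integral {0..} (\<lambda>v. v ^ (2 * j) * exp ((z + h) * v\<^sup>2 - v ^ 6 / 12) - v ^ (2 * j) * exp (z * v\<^sup>2 - v ^ 6 / 12)
        - h * (v ^ (2 * Suc j) * exp (z * v\<^sup>2 - v ^ 6 / 12)))) \<le> integral {0..} (\<lambda>v. h\<^sup>2 * (v ^ (2 * (j + 2)) * exp ((\<bar>z\<bar> + 1) * v\<^sup>2 - v ^ 6 / 12)))"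
    proof (rule integral_norm_bound_integral[OF has_integral_integrable[OF i1] has_integral_integrable[OF i2]])
      fix v :: real assume "v \<in> {0..}"
      then have v: "0 \<le> v" by simp
      define x where "x = h * v\<^sup>2"
      have ax: "\<bar>x\<bar> = \<bar>h\<bar> * v\<^sup>2" by (simp add: x_def abs_mult)
      have "norm (exp x - (\<Sum>i\<le>1. x ^ i / fact i)) \<le> exp (norm x) * (norm x ^ Suc 1) / fact 1" by (rule Taylor_exp_field)
      then have T: "\<bar>exp x - 1 - x\<bar> \<le> exp \<bar>x\<bar> * x\<^sup>2" by (simp add: power2_eq_square diff_diff_eq)
      have "v ^ (2 * j) * exp ((z + h) * v\<^sup>2 - v ^ 6 / 12) - v ^ (2 * j) * exp (z * v\<^sup>2 - v ^ 6 / 12)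
        - h * (v ^ (2 * Suc j) * exp (z * v\<^sup>2 - v ^ 6 / 12)) = v ^ (2 * j) * exp (z * v\<^sup>2 - v ^ 6 / 12) * (exp x - 1 - x)"
      proof -
        have "exp ((z + h) * v\<^sup>2 - v ^ 6 / 12) = exp (z * v\<^sup>2 - v ^ 6 / 12) * exp x"
          unfolding x_def by (simp add: algebra_simps flip: exp_add)
        moreover have "v ^ (2 * Suc j) = v ^ (2 * j) * v\<^sup>2" by (simp add: power2_eq_square)
        ultimately show ?thesis by (simp add: x_def algebra_simps power2_eq_square)
      qed
      then have "norm (v ^ (2 * j) * exp ((z + h) * v\<^sup>2 - v ^ 6 / 12) - v ^ (2 * j) * exp (z * v\<^sup>2 - v ^ 6 / 12)
        - h * (v ^ (2 * Suc j) * exp (z * v\<^sup>2 - v ^ 6 / 12))) = v ^ (2 * j) * exp (z * v\<^sup>2 - v ^ 6 / 12) * \<bar>exp x - 1 - x\<bar>"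
        using v by (simp add: abs_mult)
      also have "\<dots> \<le> v ^ (2 * j) * exp (z * v\<^sup>2 - v ^ 6 / 12) * (exp (v\<^sup>2) * (h\<^sup>2 * v ^ 4))"
      proof (intro mult_left_mono order_trans[OF T])
        have "\<bar>x\<bar> \<le> 1 * v\<^sup>2" unfolding ax using h by (intro mult_right_mono) auto
        moreover have "x\<^sup>2 = h\<^sup>2 * v ^ 4" by (simp add: x_def power_mult_distrib)
        ultimately show "exp \<bar>x\<bar> * x\<^sup>2 \<le> exp (v\<^sup>2) * (h\<^sup>2 * v ^ 4)" by simp (intro mult_right_mono, simp_all)
      qed (use v in auto)
      also have "\<dots> = h\<^sup>2 * (v ^ (2 * (j + 2)) * exp ((z + 1) * v\<^sup>2 - v ^ 6 / 12))"
      proof -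
        have "exp ((z + 1) * v\<^sup>2 - v ^ 6 / 12) = exp (z * v\<^sup>2 - v ^ 6 / 12) * exp (v\<^sup>2)"
          by (simp add: algebra_simps flip: exp_add)
        moreover have "v ^ (2 * (j + 2)) = v ^ (2 * j) * v ^ 4"
        proof -
          have "2 * (j + 2) = 2 * j + 4" by simp
          then show ?thesis by (simp only: power_add)
        qed
        ultimately show ?thesis by (simp only: mult_ac)
      qed
      also have "\<dots> \<le> h\<^sup>2 * (v ^ (2 * (j + 2)) * exp ((\<bar>z\<bar> + 1) * v\<^sup>2 - v ^ 6 / 12))"
        using v by (intro mult_left_mono) (auto intro!: mult_right_mono)
      finally show "norm (v ^ (2 * j) * exp ((z + h) * v\<^sup>2 - v ^ 6 / 12) - v ^ (2 * j) * exp (z * v\<^sup>2 - v ^ 6 / 12)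
        - h * (v ^ (2 * Suc j) * exp (z * v\<^sup>2 - v ^ 6 / 12))) \<le> h\<^sup>2 * (v ^ (2 * (j + 2)) * exp ((\<bar>z\<bar> + 1) * v\<^sup>2 - v ^ 6 / 12))" .
    qed
    then show ?thesis unfolding integral_unique[OF i1] integral_unique[OF i2] by simp
  qed
  have "((\<lambda>h. (amom j (z + h) - amom j z) / h - amom (Suc j) z) \<longlongrightarrow> 0) (at 0)"
  proof (rule Lim_null_comparison)
    show "((\<lambda>h. \<bar>h\<bar> * C) \<longlongrightarrow> 0) (at 0)" by (auto intro!: tendsto_eq_intros)
    have "eventually (\<lambda>h::real. h \<noteq> 0 \<and> \<bar>h\<bar> \<le> 1) (at 0)"
      unfolding eventually_at by (rule exI[of _ 1]) auto
    then show "eventually (\<lambda>h. norm ((amom j (z + h) - amom j z) / h - amom (Suc j) z) \<le> \<bar>h\<bar> * C) (at 0)"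
    proof (rule eventually_mono)
      fix h :: real assume h: "h \<noteq> 0 \<and> \<bar>h\<bar> \<le> 1"
      then have "norm ((amom j (z + h) - amom j z) / h - amom (Suc j) z) = \<bar>amom j (z + h) - amom j z - h * amom (Suc j) z\<bar> / \<bar>h\<bar>"
        by (simp add: field_simps flip: abs_divide)
      also have "\<dots> \<le> (h\<^sup>2 * C) / \<bar>h\<bar>" using bd[of h] h by (intro divide_right_mono) auto
      also have "\<dots> = \<bar>h\<bar> * C" using h by (simp add: power2_eq_square field_simps abs_mult_self_eq)
      finally show "norm ((amom j (z + h) - amom j z) / h - amom (Suc j) z) \<le> \<bar>h\<bar> * C" .
    qed
  qed
  then show ?thesis unfolding DERIV_def by (simp add: LIM_zero_iff)
qed

text \<open>The derivative of v exp (z v^2 - v^6/12) has integral zero over the half-line, and its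
  three terms are multiples of the integrands of \<open>amom 0\<close>, \<open>amom 1\<close> and
  \<open>amom 3\<close>.\<close>

lemma amom_ode: "amom 3 z = 4 * z * amom 1 z + 2 * amom 0 z"
proof -
  define E where "E v = exp (z * v\<^sup>2 - v ^ 6 / 12)" for v
  define D where "D v = v ^ (2 * 0) * E v + 2 * z * (v ^ (2 * 1) * E v) - 1/2 * (v ^ (2 * 3) * E v)" for v
  have Dint: "(D has_integral (amom 0 z + 2 * z * amom 1 z - 1/2 * amom 3 z)) {0..}"
    unfolding D_def E_def by (intro has_integral_add has_integral_diff has_integral_mult_right amom_has_integral)
  define F where "F v = v * E v" for v
  have Fd: "(F has_real_derivative D v) (at v within A)" for v A
    unfolding F_def[abs_def] E_def D_def
    by (auto intro!: derivative_eq_intros simp: algebra_simps eval_nat_numeral)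
  have Fint: "(D has_integral F (real k)) {0..real k}" for k
    using fundamental_theorem_of_calculus[of 0 "real k" F D] Fd
    by (simp add: has_real_derivative_iff_has_vector_derivative F_def)
  \<comment> \<open>Truncation to [0, k], where the fundamental theorem applies; dominated
    convergence then passes to the half-line.\<close>
  define f where "f k v = (if v \<in> {0..real k} then D v else 0)" for k v
  have fk: "(f k has_integral F (real k)) {0..}" for k
    unfolding f_def[abs_def] by (subst has_integral_restrict) (use Fint in auto)
  have "(\<lambda>k. integral {0..} (f k)) \<longlonglongrightarrow> integral {0..} D"
  proof (rule dominated_convergence(2))
    show "f k integrable_on {0..}" for k using fk by (rule has_integral_integrable)
    show "(\<lambda>v. v ^ 0 * E v + \<bar>2 * z\<bar> * (v ^ 2 * E v) + 1/2 * (v ^ 6 * E v)) integrable_on {0..}"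
      unfolding E_def by (intro integrable_add integrable_on_mult_right amom_integrable)
    show "norm (f k v) \<le> v ^ 0 * E v + \<bar>2 * z\<bar> * (v ^ 2 * E v) + 1/2 * (v ^ 6 * E v)" if "v \<in> {0..}" for k v
    proof -
      have v: "0 \<le> v" using that by simp
      have E0: "0 \<le> E v" by (simp add: E_def)
      have "\<bar>D v\<bar> \<le> \<bar>E v\<bar> + \<bar>2 * z * (v ^ 2 * E v)\<bar> + \<bar>1/2 * (v ^ 6 * E v)\<bar>"
        unfolding D_def by simp
      also have "\<dots> = v ^ 0 * E v + \<bar>2 * z\<bar> * (v ^ 2 * E v) + 1/2 * (v ^ 6 * E v)"
        using v E0 by (simp add: abs_mult)
      finally have "\<bar>D v\<bar> \<le> v ^ 0 * E v + \<bar>2 * z\<bar> * (v ^ 2 * E v) + 1/2 * (v ^ 6 * E v)" .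
      then show ?thesis by (auto simp: f_def)
    qed
    show "(\<lambda>k. f k v) \<longlonglongrightarrow> D v" if "v \<in> {0..}" for v
    proof (rule tendsto_eventually)
      show "eventually (\<lambda>k. f k v = D v) sequentially"
        using eventually_ge_at_top[of "nat \<lceil>v\<rceil>"] by eventually_elim (use that in \<open>auto simp: f_def nat_ceiling_le_eq\<close>)
    qed
  qed
  moreover have "(\<lambda>k. integral {0..} (f k)) \<longlonglongrightarrow> 0"
  proof (rule Lim_null_comparison)
    define B where "B = exp ((\<bar>z\<bar> + real 1 + 1) * (12 * (\<bar>z\<bar> + real 1 + 1) + 1))"
    show "eventually (\<lambda>k. norm (integral {0..} (f k)) \<le> B * exp (- 1 * real k)) sequentially"
      using amom_integrand_bound[of "real _" 1 z]
      by (intro always_eventually allI) (simp add: integral_unique[OF fk] F_def E_def B_def abs_mult)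
    show "(\<lambda>k. B * exp (- 1 * real k)) \<longlonglongrightarrow> 0" by real_asymp
  qed
  ultimately have "integral {0..} D = 0" using LIMSEQ_unique by blast
  then have "amom 0 z + 2 * z * amom 1 z - 1/2 * amom 3 z = 0" using integral_unique[OF Dint] by simp
  then show ?thesis by simp
qed

lemma has_integral_open_closed_0: "(f has_integral y) {0<..} \<longleftrightarrow> (f has_integral y) {0..}" for f :: "real \<Rightarrow> real"
proof (rule has_integral_spike_set_eq)
  show "negligible {x \<in> {0..} - {0<..}. f x \<noteq> 0}" by (rule negligible_subset[of "{0}"]) auto
  show "negligible {x \<in> {0<..} - {0..}. f x \<noteq> 0}" by (rule negligible_subset[of "{}"]) auto
qed

text \<open>Euler's integral for Gamma under the substitution t = a v^d.\<close>

lemma monomial_exp_integral: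
  fixes a :: real and m d :: nat
  assumes a: "0 < a" and d: "1 \<le> d"
  defines "s \<equiv> (real m + 1) / real d"
  shows "((\<lambda>v. v ^ m * exp (- a * v ^ d)) has_integral (1 / (real d * a powr s) * Gamma s)) {0..}"
proof -
  have s0: "0 < s" using d by (simp add: s_def)
  have d0: "0 < real d" using d by simp
  define f where "f t = t powr (s - 1) / exp t" for t :: real
  define g where "g v = a * v ^ d" for v :: real
  have fint: "(f has_integral Gamma s) {0<..}"
    unfolding has_integral_open_closed_0 f_def by (rule Gamma_integral_real[OF s0])
  then have fabs: "f absolutely_integrable_on {0<..}"
    by (intro nonnegative_absolutely_integrable_1 has_integral_integrable[OF fint]) (auto simp: f_def)
  have img: "g ` {0<..} = {0<..}"
  proof
    show "{0<..} \<subseteq> g ` {0<..}"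
    proof
      fix t :: real assume t: "t \<in> {0<..}"
      have "t = g (root d (t / a))" using t a d by (simp add: g_def)
      then show "t \<in> g ` {0<..}" using t a d by (intro image_eqI[of _ _ "root d (t / a)"]) auto
    qed
  qed (use a in \<open>auto simp: g_def\<close>)
  have ai: "(\<lambda>v. \<bar>a * (real d * v ^ (d - 1))\<bar> * f (g v)) absolutely_integrable_on {0<..} \<and> integral {0<..} (\<lambda>v. \<bar>a * (real d * v ^ (d - 1))\<bar> * f (g v)) = Gamma s"
  proof (subst has_absolute_integral_change_of_variables_1'[where g = g])
    show "(g has_field_derivative a * (real d * x ^ (d - 1))) (at x within {0<..})" for x
      unfolding g_def by (auto intro!: derivative_eq_intros)
    show "inj_on g {0<..}" using a d by (auto simp: inj_on_def g_def intro: power_eq_imp_eq_base)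
    show "f absolutely_integrable_on g ` {0<..} \<and> integral (g ` {0<..}) f = Gamma s"
      unfolding img using fabs integral_unique[OF fint] by simp
  qed auto
  have I: "((\<lambda>v. \<bar>a * (real d * v ^ (d - 1))\<bar> * f (g v)) has_integral Gamma s) {0<..}"
    using integrable_integral[OF conjunct1[OF iffD1[OF absolutely_integrable_on_def conjunct1[OF ai]]]]
    unfolding conjunct2[OF ai] .
  have eq: "\<bar>a * (real d * v ^ (d - 1))\<bar> * f (g v) = (real d * a powr s) * (v ^ m * exp (- a * v ^ d))" if "v \<in> {0<..}" for v
  proof -
    have v: "0 < v" using that by simp
    have 1: "(a * v ^ d) powr (s - 1) = a powr (s - 1) * v powr (real d * (s - 1))"
      using v a by (simp add: powr_mult powr_realpow[symmetric] powr_powr)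
    have "real (d - 1) + real d * (s - 1) = real m" using d by (simp add: s_def field_simps of_nat_diff)
    then have 2: "v ^ (d - 1) * v powr (real d * (s - 1)) = v ^ m"
      using v by (simp add: powr_realpow[symmetric] flip: powr_add)
    have 3: "a * a powr (s - 1) = a powr s" using a by (simp add: powr_diff)
    have "a * (real d * v ^ (d - 1)) * (a * v ^ d) powr (s - 1) = real d * (a * a powr (s - 1)) * (v ^ (d - 1) * v powr (real d * (s - 1)))"
      unfolding 1 by simp
    also have "\<dots> = real d * a powr s * v ^ m" unfolding 2 3 ..
    finally have "a * (real d * v ^ (d - 1)) * (a * v ^ d) powr (s - 1) = real d * a powr s * v ^ m" .
    then show ?thesis using v a by (simp add: f_def g_def exp_minus divide_inverse abs_mult mult.assoc[symmetric])
  qed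
  have "((\<lambda>v. (real d * a powr s) * (v ^ m * exp (- a * v ^ d))) has_integral Gamma s) {0<..}"
    by (rule has_integral_eq[OF eq I])
  then have h: "((\<lambda>v. inverse (real d * a powr s) * ((real d * a powr s) * (v ^ m * exp (- a * v ^ d)))) has_integral inverse (real d * a powr s) * Gamma s) {0..}"
    unfolding has_integral_open_closed_0 by (rule has_integral_mult_right)
  have nz: "real d * a powr s \<noteq> 0" using d0 a by simp
  have "inverse c * (c * x) = x" if "c \<noteq> 0" for c x :: real using that by simp
  from h[unfolded this[OF nz]] show ?thesis by (simp only: divide_inverse mult_1)
qed

lemma amom_at_0: "amom j 0 = 1/6 * 12 powr ((2 * real j + 1) / 6) * Gamma ((2 * real j + 1) / 6)"
proof -
  have "((\<lambda>v. v ^ (2 * j) * exp (- (1/12) * v ^ 6)) has_integral (1 / (real 6 * (1/12) powr ((real (2 * j) + 1) / real 6)) * Gamma ((real (2 * j) + 1) / real 6))) {0..}"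
    by (rule monomial_exp_integral) auto
  moreover have "((\<lambda>v. v ^ (2 * j) * exp (- (1/12) * v ^ 6)) has_integral amom j 0) {0..}"
    using amom_has_integral[of j 0] by simp
  ultimately have "amom j 0 = 1 / (real 6 * (1/12) powr ((real (2 * j) + 1) / real 6)) * Gamma ((real (2 * j) + 1) / real 6)"
    using has_integral_unique by blast
  then show ?thesis by (simp add: powr_divide)
qed

text \<open>From 1 - x <= exp (-x) <= 1 with x = v^6/12 the integral lies between Gaussian moments;
  the sixth moment produces Gamma (7/2), and the relative error is of order u^(-3).\<close>

lemma amom_0_asymp:
  assumes u: "0 < u"
  shows "amom 0 (- u) \<le> sqrt pi / (2 * sqrt u)"
    and "sqrt pi / (2 * sqrt u) - Gamma (7/2) / 24 * u powr (-7/2) \<le> amom 0 (- u)"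
proof -
  have A: "((\<lambda>v. exp (- u * v ^ 2)) has_integral (sqrt pi / (2 * sqrt u))) {0..}"
    using monomial_exp_integral[of u 2 0] u by (simp add: powr_half_sqrt Gamma_one_half_real)
  have B: "((\<lambda>v. v ^ 6 * exp (- u * v ^ 2)) has_integral (Gamma (7/2) / 2 * u powr (-7/2))) {0..}"
    using monomial_exp_integral[of u 2 6] u by (simp add: powr_minus_divide)
  have C: "((\<lambda>v. exp (- u * v ^ 2 - v ^ 6 / 12)) has_integral amom 0 (- u)) {0..}"
    using amom_has_integral[of 0 "-u"] by simp
  show "amom 0 (- u) \<le> sqrt pi / (2 * sqrt u)"
    by (rule has_integral_le[OF C A]) auto
  have D: "((\<lambda>v. exp (- u * v ^ 2) - 1/12 * (v ^ 6 * exp (- u * v ^ 2))) has_integral (sqrt pi / (2 * sqrt u) - 1/12 * (Gamma (7/2) / 2 * u powr (-7/2)))) {0..}"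
    by (intro has_integral_diff has_integral_mult_right A B)
  have "sqrt pi / (2 * sqrt u) - 1/12 * (Gamma (7/2) / 2 * u powr (-7/2)) \<le> amom 0 (- u)"
  proof (rule has_integral_le[OF D C])
    fix v :: real
    have "exp (- u * v ^ 2) * (1 - v ^ 6 / 12) \<le> exp (- u * v ^ 2) * exp (- (v ^ 6 / 12))"
      using exp_ge_add_one_self[of "- (v ^ 6 / 12)"] by (intro mult_left_mono) auto
    also have "\<dots> = exp (- u * v ^ 2 - v ^ 6 / 12)" by (simp flip: exp_add)
    finally show "exp (- u * v ^ 2) - 1/12 * (v ^ 6 * exp (- u * v ^ 2)) \<le> exp (- u * v ^ 2 - v ^ 6 / 12)" by (simp add: algebra_simps)
  qed
  then show "sqrt pi / (2 * sqrt u) - Gamma (7/2) / 24 * u powr (-7/2) \<le> amom 0 (- u)" by simp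
qed

text \<open>An energy estimate run backwards from 0: multiplied by exp (K x), the sum of squares is
  nondecreasing on [z, 0], nonnegative, and zero at 0.\<close>

lemma airy_product_ode_unique:
  fixes D D1 D2 :: "real \<Rightarrow> real"
  assumes d: "\<And>z. (D has_real_derivative D1 z) (at z)" "\<And>z. (D1 has_real_derivative D2 z) (at z)"
    "\<And>z. (D2 has_real_derivative 4 * z * D1 z + 2 * D z) (at z)"
    and init: "D 0 = 0" "D1 0 = 0" "D2 0 = 0" and z: "z \<le> 0"
  shows "D z = 0"
proof -
  \<comment> \<open>Each mixed product in the derivative of the energy is split by 2 a b >= - (a^2 +
    b^2); these losses add up to at most 3 + 4 |z| times the energy.\<close>
  define K where "K = 3 + 4 * \<bar>z\<bar>"
  define h where "h x = ((D x)\<^sup>2 + (D1 x)\<^sup>2 + (D2 x)\<^sup>2) * exp (K * x)" for x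
  have "h z \<le> h 0"
  proof (rule DERIV_nonneg_imp_nondecreasing[OF z])
    fix x assume x: "z \<le> x" "x \<le> 0"
    define S' where "S' = 2 * D x * D1 x + 2 * D1 x * D2 x + 2 * D2 x * (4 * x * D1 x + 2 * D x)"
    have "(h has_real_derivative (S' * exp (K * x) + ((D x)\<^sup>2 + (D1 x)\<^sup>2 + (D2 x)\<^sup>2) * (K * exp (K * x)))) (at x)"
      unfolding h_def[abs_def] S'_def
      by (auto intro!: derivative_eq_intros d simp: algebra_simps)
    moreover have "0 \<le> S' * exp (K * x) + ((D x)\<^sup>2 + (D1 x)\<^sup>2 + (D2 x)\<^sup>2) * (K * exp (K * x))"
    proof -
      have amgm: "- (a\<^sup>2 + b\<^sup>2) \<le> 2 * a * b" for a b :: real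
        using zero_le_power2[of "a + b"] by (simp add: power2_eq_square algebra_simps)
      have "- (\<bar>z\<bar> * ((D1 x)\<^sup>2 + (D2 x)\<^sup>2)) \<le> x * (2 * D1 x * D2 x)"
      proof -
        have "\<bar>x * (2 * D1 x * D2 x)\<bar> \<le> \<bar>z\<bar> * ((D1 x)\<^sup>2 + (D2 x)\<^sup>2)"
          unfolding abs_mult[of x]
        proof (rule mult_mono)
          show "\<bar>2 * D1 x * D2 x\<bar> \<le> (D1 x)\<^sup>2 + (D2 x)\<^sup>2"
            using amgm[of "D1 x" "D2 x"] amgm[of "D1 x" "- D2 x"] by (simp add: abs_le_iff)
        qed (use x in auto)
        then show ?thesis by (simp add: abs_le_iff)
      qed
      then have "S' \<ge> - ((D x)\<^sup>2 + (D1 x)\<^sup>2) - ((D1 x)\<^sup>2 + (D2 x)\<^sup>2) - 4 * (\<bar>z\<bar> * ((D1 x)\<^sup>2 + (D2 x)\<^sup>2)) - 2 * ((D2 x)\<^sup>2 + (D x)\<^sup>2)"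
        using amgm[of "D x" "D1 x"] amgm[of "D1 x" "D2 x"] amgm[of "D2 x" "D x"] by (simp add: S'_def algebra_simps)
      moreover have "K * ((D x)\<^sup>2 + (D1 x)\<^sup>2 + (D2 x)\<^sup>2) - ((D x)\<^sup>2 + (D1 x)\<^sup>2) - ((D1 x)\<^sup>2 + (D2 x)\<^sup>2) - 4 * (\<bar>z\<bar> * ((D1 x)\<^sup>2 + (D2 x)\<^sup>2)) - 2 * ((D2 x)\<^sup>2 + (D x)\<^sup>2)
          = 4 * (\<bar>z\<bar> * (D x)\<^sup>2) + (D1 x)\<^sup>2"
        by (simp add: K_def algebra_simps)
      moreover have "0 \<le> 4 * (\<bar>z\<bar> * (D x)\<^sup>2) + (D1 x)\<^sup>2" by simp
      ultimately have "0 \<le> S' + K * ((D x)\<^sup>2 + (D1 x)\<^sup>2 + (D2 x)\<^sup>2)" by linarith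
      then have "0 \<le> (S' + K * ((D x)\<^sup>2 + (D1 x)\<^sup>2 + (D2 x)\<^sup>2)) * exp (K * x)" by simp
      then show ?thesis by (simp add: algebra_simps)
    qed
    ultimately show "\<exists>y. (h has_real_derivative y) (at x) \<and> 0 \<le> y" by blast
  qed
  also have "h 0 = 0" by (simp add: h_def init)
  finally have "(D z)\<^sup>2 + (D1 z)\<^sup>2 + (D2 z)\<^sup>2 \<le> 0" by (simp add: h_def mult_le_0_iff not_le[symmetric])
  then have "(D z)\<^sup>2 \<le> 0" using zero_le_power2[of "D1 z"] zero_le_power2[of "D2 z"] by linarith
  then show ?thesis by simp
qed

lemma Gamma_duplication_real:
  fixes x :: real
  assumes "0 < x"
  shows "Gamma x * Gamma (x + 1/2) = 2 powr (1 - 2 * x) * sqrt pi * Gamma (2 * x)"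
proof -
  have np: "complex_of_real y \<notin> \<int>\<^sub>\<le>\<^sub>0" if "0 < y" for y
    using that by (auto elim!: nonpos_Ints_cases simp: complex_eq_iff)
  have "complex_of_real (Gamma x * Gamma (x + 1/2)) = Gamma (complex_of_real x) * Gamma (complex_of_real x + 1/2)"
    using Gamma_complex_of_real[of "x + 1/2"] by (simp add: Gamma_complex_of_real)
  also have "\<dots> = exp ((1 - 2 * complex_of_real x) * of_real (ln 2)) * of_real (sqrt pi) * Gamma (2 * complex_of_real x)"
    by (rule Gamma_legendre_duplication) (use np[of x] np[of "x + 1/2"] assms in auto)
  also have "\<dots> = complex_of_real (2 powr (1 - 2 * x) * sqrt pi * Gamma (2 * x))"
    using Gamma_complex_of_real[of "2 * x"] by (simp add: powr_def flip: exp_of_real)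
  finally show ?thesis by (simp only: of_real_eq_iff)
qed

lemma Gamma_pos: "0 < Gamma (1/3 :: real)" "0 < Gamma (2/3 :: real)"
  by (simp_all add: Gamma_real_pos)

text \<open>Duplication at 1/6 and at 1/3 leads to thirds, and the product formula eliminates one of
  the two values.\<close>

lemma Gamma_sixths:
  "Gamma (1/6 :: real) = 2 powr (5/3) * pi * sqrt pi / (sqrt 3 * (Gamma (2/3))\<^sup>2)"
  "Gamma (5/6 :: real) = 2 powr (4/3) * pi * sqrt pi / (sqrt 3 * (Gamma (1/3))\<^sup>2)"
proof -
  note prod = Gamma_third_product
  have G: "Gamma (1/3 :: real) \<noteq> 0" "Gamma (2/3 :: real) \<noteq> 0"
    using Gamma_pos by (metis less_irrefl)+
  have p2: "2 powr (2/3) * 2 = (2 powr (5/3) :: real)" "2 powr (1/3) * 2 = (2 powr (4/3) :: real)"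
    using powr_add[of "2::real" "2/3" 1] powr_add[of "2::real" "1/3" 1] by simp_all
  have "Gamma (1/6) * Gamma (2/3) = 2 powr (2/3) * sqrt pi * Gamma (1/3 :: real)"
    using Gamma_duplication_real[of "1/6"] by simp
  moreover have "Gamma (1/3) = 2 * pi / (sqrt 3 * Gamma (2/3 :: real))"
    using prod G by (simp add: nonzero_eq_divide_eq mult_ac)
  ultimately show "Gamma (1/6 :: real) = 2 powr (5/3) * pi * sqrt pi / (sqrt 3 * (Gamma (2/3))\<^sup>2)"
    unfolding p2(1)[symmetric] using G by (simp add: nonzero_eq_divide_eq nonzero_divide_eq_eq power2_eq_square mult_ac)
  have "Gamma (1/3) * Gamma (5/6) = 2 powr (1/3) * sqrt pi * Gamma (2/3 :: real)"
    using Gamma_duplication_real[of "1/3"] by simp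
  moreover have "Gamma (2/3) = 2 * pi / (sqrt 3 * Gamma (1/3 :: real))"
    using prod G by (simp add: nonzero_eq_divide_eq mult_ac)
  ultimately show "Gamma (5/6 :: real) = 2 powr (4/3) * pi * sqrt pi / (sqrt 3 * (Gamma (1/3))\<^sup>2)"
    unfolding p2(2)[symmetric] using G by (simp add: nonzero_eq_divide_eq nonzero_divide_eq_eq power2_eq_square mult_ac)
qed

lemma powr_12: "12 powr a = (2 powr (2 * a) * 3 powr a :: real)"
proof -
  have "12 powr a = (4 * 3) powr a" by simp
  also have "\<dots> = 4 powr a * 3 powr a" by (rule powr_mult)
  also have "4 powr a = (2 powr 2) powr a" by simp
  finally show ?thesis by (simp only: powr_powr)
qed

text \<open>The right-hand sides are the values at 0 of Ai^2 + Bi^2 and of its first two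
  derivatives.\<close>

lemma amom_values:
  "2 / (pi * sqrt pi) * amom 0 0 = 4 * airy_c1\<^sup>2"
  "2 / (pi * sqrt pi) * amom 1 0 = 4 * (airy_c1 * airy_c2)"
  "2 / (pi * sqrt pi) * amom 2 0 = 8 * airy_c2\<^sup>2"
proof -
  note G = Gamma_pos
  have s3: "sqrt 3 = 3 powr (1/2::real)" by (simp add: powr_half_sqrt)
  have c1: "airy_c1\<^sup>2 = 3 powr (-4/3) / (Gamma (2/3))\<^sup>2"
  proof -
    have "(3 powr (2/3))\<^sup>2 = (3 powr (4/3) :: real)" by (simp add: power2_eq_square flip: powr_add)
    then show ?thesis by (simp add: airy_c1_def power_divide power_mult_distrib powr_minus_divide)
  qed
  have c2: "airy_c2\<^sup>2 = 3 powr (-2/3) / (Gamma (1/3))\<^sup>2"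
  proof -
    have "(3 powr (1/3))\<^sup>2 = (3 powr (2/3) :: real)" by (simp add: power2_eq_square flip: powr_add)
    then show ?thesis by (simp add: airy_c2_def power_divide power_mult_distrib powr_minus_divide)
  qed
  have "2 / (pi * sqrt pi) * amom 0 0 = 2 / (pi * sqrt pi) * (1/6 * (2 powr (1/3) * 3 powr (1/6)) * (2 powr (5/3) * pi * sqrt pi / (sqrt 3 * (Gamma (2/3))\<^sup>2)))"
    using amom_at_0[of 0] powr_12[of "1/6"] by (simp add: Gamma_sixths)
  also have "\<dots> = (2 powr (1/3) * 2 powr (5/3)) * (3 powr (1/6) / (3 * sqrt 3)) / (Gamma (2/3))\<^sup>2"
    by (simp add: field_simps)
  also have "2 powr (1/3) * 2 powr (5/3) = (4::real)" by (simp flip: powr_add)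
  also have "3 powr (1/6) / (3 * sqrt 3) = (3 powr (-4/3) :: real)"
  proof -
    have "3 powr (-4/3) = (3 powr (1/6) / (3 powr 1 * 3 powr (1/2)) :: real)"
      unfolding powr_add[symmetric] powr_diff[symmetric] by simp
    then show ?thesis unfolding s3 by simp
  qed
  finally show "2 / (pi * sqrt pi) * amom 0 0 = 4 * airy_c1\<^sup>2" unfolding c1 by simp
  have "sqrt 12 = 2 * sqrt 3" using real_sqrt_mult[of 4 3] by simp
  moreover have "amom 1 0 = 1/6 * 12 powr (1/2) * Gamma (1/2)" using amom_at_0[of 1] by simp
  moreover have "12 powr (1/2) = sqrt 12" by (simp add: powr_half_sqrt)
  ultimately have "2 / (pi * sqrt pi) * amom 1 0 = 2 / (pi * sqrt pi) * (1/6 * (2 * sqrt 3) * sqrt pi)"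
    by (simp only: Gamma_one_half_real)
  also have "\<dots> = 4 * (airy_c1 * airy_c2)" unfolding airy_c1_c2 by (simp add: field_simps)
  finally show "2 / (pi * sqrt pi) * amom 1 0 = 4 * (airy_c1 * airy_c2)" .
  have "2 / (pi * sqrt pi) * amom 2 0 = 2 / (pi * sqrt pi) * (1/6 * (2 powr (5/3) * 3 powr (5/6)) * (2 powr (4/3) * pi * sqrt pi / (sqrt 3 * (Gamma (1/3))\<^sup>2)))"
    using amom_at_0[of 2] powr_12[of "5/6"] by (simp add: Gamma_sixths)
  also have "\<dots> = (2 powr (5/3) * 2 powr (4/3)) * (3 powr (5/6) / (3 * sqrt 3)) / (Gamma (1/3))\<^sup>2"
    by (simp add: field_simps)
  also have "2 powr (5/3) * 2 powr (4/3) = (2 powr 3 :: real)" by (simp flip: powr_add)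
  also have "3 powr (5/6) / (3 * sqrt 3) = (3 powr (-2/3) :: real)"
  proof -
    have "3 powr (-2/3) = (3 powr (5/6) / (3 powr 1 * 3 powr (1/2)) :: real)"
      unfolding powr_add[symmetric] powr_diff[symmetric] by simp
    then show ?thesis unfolding s3 by simp
  qed
  finally show "2 / (pi * sqrt pi) * amom 2 0 = 8 * airy_c2\<^sup>2" unfolding c2 by simp
qed

text \<open>With t = v^2 this is the classical formula Ai^2 + Bi^2 = pi^(-3/2) times the integral of
  t^(-1/2) exp (z t - t^3/12) over t > 0, on the half-line where the Airy functions
  oscillate.\<close>

lemma airy_modulus:
  assumes "z \<le> 0"
  shows "(Ai z)\<^sup>2 + (Bi z)\<^sup>2 = 2 / (pi * sqrt pi) * amom 0 z"
proof -
  define c where "c = 2 / (pi * sqrt pi)"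
  define a0 a1 a2 a3 where a_def: "a0 = amom 0" "a1 = amom 1" "a2 = amom 2" "a3 = amom 3"
  define D where "D z = (Ai z)\<^sup>2 + (Bi z)\<^sup>2 - c * a0 z" for z
  define D1 where "D1 z = 2 * (Ai z * Ai' z + Bi z * Bi' z) - c * a1 z" for z
  define D2 where "D2 z = 2 * ((Ai' z)\<^sup>2 + (Bi' z)\<^sup>2) + 2 * z * ((Ai z)\<^sup>2 + (Bi z)\<^sup>2) - c * a2 z" for z
  note der = Ai_deriv Bi_deriv Ai'_deriv Bi'_deriv
  have am: "(a0 has_real_derivative a1 z) (at z)" "(a1 has_real_derivative a2 z) (at z)" "(a2 has_real_derivative a3 z) (at z)" for z
  proof -
    have s: "Suc 0 = 1" "Suc 1 = 2" "Suc 2 = 3" by simp_all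
    show "(a0 has_real_derivative a1 z) (at z)" "(a1 has_real_derivative a2 z) (at z)" "(a2 has_real_derivative a3 z) (at z)"
      unfolding a_def
      by (fact amom_deriv[of 0 z, unfolded s] amom_deriv[of 1 z, unfolded s] amom_deriv[of 2 z, unfolded s])+
  qed
  have a3: "a3 z = 4 * z * a1 z + 2 * a0 z" for z
    unfolding a_def by (rule amom_ode)
  have "D z = 0"
  proof (rule airy_product_ode_unique[OF _ _ _ _ _ _ assms])
    show "(D has_real_derivative D1 z) (at z)" for z
      unfolding D_def[abs_def] D1_def by (auto intro!: derivative_eq_intros der am simp: algebra_simps)
    show "(D1 has_real_derivative D2 z) (at z)" for z
      unfolding D1_def[abs_def] D2_def by (auto intro!: derivative_eq_intros der am simp: algebra_simps power2_eq_square)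
    show "(D2 has_real_derivative 4 * z * D1 z + 2 * D z) (at z)" for z
      unfolding D2_def[abs_def] D1_def D_def
      by (auto intro!: derivative_eq_intros der am simp: a3 algebra_simps power2_eq_square)
    show "D 0 = 0" "D1 0 = 0" "D2 0 = 0"
      unfolding D_def D1_def D2_def c_def a_def amom_values
      by (simp_all add: airy_at_0 power_mult_distrib)
  qed
  then show ?thesis by (simp add: D_def c_def a_def)
qed

section \<open>Wronskian, modulus and phase of the reference solution\<close>

lemma cube_root_cubed:
  assumes "0 < F"
  shows "(F powr (1/3)) ^ 3 = (F :: real)" "0 < F powr (1/3)"
  using assms powr_powr[of F "1/3" 3] by (simp_all add: powr_realpow)

definition zeta' :: "real \<Rightarrow> real \<Rightarrow> real \<Rightarrow> complex" where
  "zeta' F E x = - complex_of_real (F powr (1/3) * sqrt (pi / F powr (1/3))) *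
     (\<i> * of_real (Ai' (- (F powr (1/3)) * (x + E / F))) + of_real (Bi' (- (F powr (1/3)) * (x + E / F))))"

context
  fixes F E :: real
  assumes F_pos: "0 < F"
begin

lemma zeta_deriv: "(zeta F E has_vector_derivative zeta' F E x) (at x)"
  unfolding zeta_def[abs_def] zeta'_def
  by (rule derivative_eq_intros refl
      has_vector_derivative_of_real[where 'a = complex] Ai_deriv[THEN DERIV_chain2] Bi_deriv[THEN DERIV_chain2]
      | simp only: has_real_derivative_iff_has_vector_derivative[symmetric])+
    (simp_all add: algebra_simps)

lemma zeta'_deriv: "(zeta' F E has_vector_derivative - of_real (F * x + E) * zeta F E x) (at x)"
proof -
  have "F powr (1/3) * (F powr (1/3) * (F powr (1/3) * (x + E / F))) = F * x + E"
    using cube_root_cubed[OF F_pos] F_pos by (simp add: power3_eq_cube algebra_simps)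
  then have *: "of_real (F * x + E) = (of_real (F powr (1/3)) * (of_real (F powr (1/3)) * (of_real (F powr (1/3)) * (of_real x + of_real E / of_real F))) :: complex)"
    by (metis of_real_mult of_real_add of_real_divide)
  show ?thesis
    unfolding zeta_def[abs_def] zeta'_def[abs_def] *
    by (rule derivative_eq_intros refl
        has_vector_derivative_of_real[where 'a = complex] Ai'_deriv[THEN DERIV_chain2] Bi'_deriv[THEN DERIV_chain2]
        | simp only: has_real_derivative_iff_has_vector_derivative[symmetric])+
      (simp_all add: algebra_simps)
qed

text \<open>The factor sqrt (pi / F^(1/3)) is chosen for this value: its square times the inner
  derivative F^(1/3) cancels the 1/pi of the Airy Wronskian.\<close>

lemma zeta_wronskian: "zeta' F E x * cnj (zeta F E x) - zeta F E x * cnj (zeta' F E x) = 2 * \<i>"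
proof -
  define f where "f = F powr (1/3)"
  define u where "u = - f * (x + E / F)"
  define s where "s = sqrt (pi / f)"
  have f: "0 < f" using cube_root_cubed[OF F_pos] by (simp add: f_def)
  have "s * s = pi / f" using f by (simp add: s_def)
  then have s: "f * (s * s) = pi" using f by simp
  have "f * (s * s) * (Ai u * Bi' u - Ai' u * Bi u) = 1"
    unfolding s airy_wronskian by simp
  then have w: "f * (s * (s * (Ai u * Bi' u))) = 1 + f * (s * (s * (Ai' u * Bi u)))" by (simp add: algebra_simps)
  show ?thesis
    unfolding zeta_def zeta'_def f_def[symmetric] s_def[symmetric]
    unfolding u_def[symmetric]
    using w by (auto simp: complex_eq_iff algebra_simps)
qed

lemma zeta_nonzero: "zeta F E x \<noteq> 0"
  using zeta_wronskian[of x] by auto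

text \<open>The Airy argument is -u with u = (F x + E) / F^(2/3), so sqrt u is proportional to sqrt
  (F x + E), and the error u^(-7/2) becomes the seventh power of its inverse.\<close>

lemma zeta_norm:
  "\<exists>C\<ge>0. \<forall>x. 0 < F * x + E \<longrightarrow> (cmod (zeta F E x))\<^sup>2 \<le> 1 / sqrt (F * x + E)
     \<and> 1 / sqrt (F * x + E) - C / sqrt (F * x + E) ^ 7 \<le> (cmod (zeta F E x))\<^sup>2"
proof -
  define f where "f = F powr (1/3)"
  have f: "0 < f" "f ^ 3 = F" using cube_root_cubed[OF F_pos] by (simp_all add: f_def)
  define C where "C = 2 / (f * sqrt pi) * (Gamma (7/2) / 24) * f ^ 7"
  have C0: "C \<ge> 0" using f Gamma_real_pos[of "7/2"] by (simp add: C_def)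
  have "(cmod (zeta F E x))\<^sup>2 \<le> 1 / sqrt (F * x + E) \<and> 1 / sqrt (F * x + E) - C / sqrt (F * x + E) ^ 7 \<le> (cmod (zeta F E x))\<^sup>2"
    if pos: "0 < F * x + E" for x
  proof -
    define P where "P = sqrt (F * x + E)"
    define u where "u = f * (x + E / F)"
    have P: "0 < P" "P\<^sup>2 = F * x + E" using pos by (simp_all add: P_def)
    have uP: "u = (P / f)\<^sup>2"
    proof -
      have "u * f\<^sup>2 = f ^ 3 * (x + E / F)" by (simp add: u_def power2_eq_square power3_eq_cube)
      also have "\<dots> = P\<^sup>2" unfolding f(2) P(2) using F_pos by (simp add: field_simps)
      finally show ?thesis using f(1) by (simp add: power_divide field_simps)
    qed
    have u: "0 < u" unfolding uP using P f by simp
    have su: "sqrt u = P / f" unfolding uP using P f by simp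
    have u7: "u powr (-7/2) = f ^ 7 / P ^ 7"
    proof -
      have "u powr (-7/2) = (P / f) powr (-7)"
        unfolding uP using P f powr_powr[of "P / f" 2 "-7/2"] by simp
      also have "\<dots> = inverse ((P / f) ^ 7)"
        using P f by (simp add: powr_minus powr_realpow[of "P/f" 7, simplified])
      finally show ?thesis by (simp add: power_divide)
    qed
    have "(cmod (zeta F E x))\<^sup>2 = (sqrt (pi / f))\<^sup>2 * (cmod (\<i> * of_real (Ai (- u)) + of_real (Bi (- u))))\<^sup>2"
      unfolding zeta_def f_def[symmetric] u_def by (simp only: norm_mult power_mult_distrib norm_of_real power2_abs mult_minus_left)
    also have "(cmod (\<i> * of_real (Ai (- u)) + of_real (Bi (- u))))\<^sup>2 = (Ai (- u))\<^sup>2 + (Bi (- u))\<^sup>2"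
      by (simp add: cmod_power2)
    also have "\<dots> = 2 / (pi * sqrt pi) * amom 0 (- u)" using u by (intro airy_modulus) simp
    also have "(sqrt (pi / f))\<^sup>2 = pi / f" using f by simp
    finally have Z: "(cmod (zeta F E x))\<^sup>2 = 2 / (f * sqrt pi) * amom 0 (- u)" by simp
    have "2 / (f * sqrt pi) * (sqrt pi / (2 * sqrt u)) = 1 / P"
      unfolding su using f P by simp
    moreover have "2 / (f * sqrt pi) * (Gamma (7/2) / 24 * u powr (-7/2)) = C / P ^ 7"
      unfolding u7 C_def by (simp add: mult_ac)
    moreover have "2 / (f * sqrt pi) * amom 0 (- u) \<le> 2 / (f * sqrt pi) * (sqrt pi / (2 * sqrt u))"
      using amom_0_asymp(1)[OF u] f by (intro mult_left_mono) auto
    moreover have "2 / (f * sqrt pi) * (sqrt pi / (2 * sqrt u) - Gamma (7/2) / 24 * u powr (-7/2)) \<le> 2 / (f * sqrt pi) * amom 0 (- u)"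
      using amom_0_asymp(2)[OF u] f by (intro mult_left_mono) auto
    ultimately show ?thesis unfolding Z P_def[symmetric] right_diff_distrib by linarith
  qed
  then show ?thesis using C0 by blast
qed


text \<open>The WKB phase, a primitive of sqrt (F x + E).\<close>

definition Theta :: "real \<Rightarrow> real" where
  "Theta x = 2 / (3 * F) * sqrt (F * x + E) ^ 3"

lemma Theta_deriv:
  assumes "0 < F * x + E"
  shows "(Theta has_real_derivative sqrt (F * x + E)) (at x)"
proof -
  have e: "(F * x + E) / sqrt (F * x + E) = sqrt (F * x + E)" using assms by (simp add: real_div_sqrt)
  show ?thesis
    unfolding Theta_def[abs_def] using assms F_pos
    by (auto intro!: derivative_eq_intros simp: e divide_simps power2_eq_square)
qed

text \<open>The modulus determines the phase: by the Wronskian, the argument of zeta has derivative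
  1/|zeta|^2. Working with zeta / cnj zeta avoids choosing a continuous argument. Its deviation from
  exp (2 i Theta) has an integrable derivative and converges to a unimodular constant.\<close>

lemma zeta_asymp:
  obtains g C X where "cmod g = 1" and "0 \<le> C"
    and "\<And>x. X \<le> x \<Longrightarrow> 1 \<le> F * x + E"
    and "\<And>x. X \<le> x \<Longrightarrow> \<bar>(cmod (zeta F E x))\<^sup>2 - 1 / sqrt (F * x + E)\<bar> \<le> C / sqrt (F * x + E) ^ 4"
    and "\<And>x. X \<le> x \<Longrightarrow> cmod ((zeta F E x)\<^sup>2 - g\<^sup>2 * exp (2 * \<i> * of_real (Theta x)) / of_real (sqrt (F * x + E))) \<le> C / sqrt (F * x + E) ^ 4"
proof -
  define P where "P x = sqrt (F * x + E)" for x
  define Z where "Z x = (cmod (zeta F E x))\<^sup>2" for x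
  obtain C where C: "C \<ge> 0" "\<And>x. 0 < F * x + E \<Longrightarrow> Z x \<le> 1 / P x" "\<And>x. 0 < F * x + E \<Longrightarrow> 1 / P x - C / P x ^ 7 \<le> Z x"
    using zeta_norm unfolding Z_def P_def by blast
  \<comment> \<open>For x >= X both P >= 1 and 2 C <= P^6 hold, so the error in |zeta|^2 is at most
    half of the main term 1/P.\<close>
  define X where "X = (1 + 2 * C - E) / F"
  have X: "1 + 2 * C \<le> F * x + E" if "X \<le> x" for x
    using that F_pos by (simp add: X_def field_simps)
  have P1: "1 \<le> P x" "2 * C \<le> P x ^ 6" "0 < F * x + E" if "X \<le> x" for x
  proof -
    show 1: "1 \<le> P x" using X[OF that] C(1) by (simp add: P_def)
    show 2: "0 < F * x + E" using X[OF that] C(1) by simp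
    have "2 * C \<le> P x ^ 2" using X[OF that] 2 by (simp add: P_def)
    also have "\<dots> \<le> P x ^ 6" using 1 by (intro power_increasing) auto
    finally show "2 * C \<le> P x ^ 6" .
  qed
  have Zpos: "0 < Z x" for x using zeta_nonzero by (simp add: Z_def)
  have ZP: "\<bar>1 / Z x - P x\<bar> \<le> 2 * C / P x ^ 5" if "X \<le> x" for x
  proof -
    note P = P1[OF that] and Zx = Zpos[of x]
    have P0: "0 < P x" using P by linarith
    have "C / P x ^ 7 \<le> 1 / (2 * P x)"
      using P(2) P0 by (simp add: divide_simps power_Suc numeral_eq_Suc mult_ac)
    then have Zl: "1 / (2 * P x) \<le> Z x" using C(3)[OF P(3)] by (simp add: field_simps)
    have "\<bar>1 / Z x - P x\<bar> = P x * \<bar>1 / P x - Z x\<bar> * (1 / Z x)"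
      using Zx P0 by (auto simp: abs_if divide_simps mult.commute)
    also have "\<dots> \<le> P x * (C / P x ^ 7) * (2 * P x)"
    proof (intro mult_mono)
      show "\<bar>1 / P x - Z x\<bar> \<le> C / P x ^ 7" using C(2,3)[OF P(3)] by linarith
      show "1 / Z x \<le> 2 * P x" using Zl Zx P0 by (simp add: field_simps)
    qed (use P0 C(1) Zx in auto)
    also have "\<dots> = 2 * C / P x ^ 5" using P0 by (simp add: divide_simps power_Suc numeral_eq_Suc)
    finally show ?thesis .
  qed
  \<comment> \<open>Stays on the unit circle and satisfies G' = 2 i (1/|zeta|^2 - P) G, where the
    bracket is O(P^(-5)).\<close>
  define G where "G x = zeta F E x / cnj (zeta F E x) * exp (- 2 * \<i> * of_real (Theta x))" for x
  have Gn: "cmod (G x) = 1" for x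
    using zeta_nonzero[of x] by (simp add: G_def norm_mult norm_divide norm_exp_eq_Re)
  have Gd: "(G has_vector_derivative 2 * \<i> * of_real (1 / Z x - P x) * G x) (at x)" if "X \<le> x" for x
  proof -
    let ?z = "zeta F E x"
    have e: "((\<lambda>x. exp (- 2 * \<i> * of_real (Theta x))) has_vector_derivative - 2 * \<i> * of_real (P x) * exp (- 2 * \<i> * of_real (Theta x))) (at x)"
    proof -
      have "((\<lambda>x. - 2 * \<i> * complex_of_real (Theta x)) has_vector_derivative - 2 * \<i> * of_real (P x)) (at x)"
        using Theta_deriv[OF P1(3)[OF that]] unfolding P_def
        by (intro has_vector_derivative_mult_right has_vector_derivative_of_real)
      from field_vector_diff_chain_at[OF this DERIV_exp] show ?thesis by (simp add: o_def)
    qed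
    have c: "((\<lambda>x. cnj (zeta F E x)) has_vector_derivative cnj (zeta' F E x)) (at x)"
      by (rule has_vector_derivative_cnj[OF zeta_deriv])
    have i: "((\<lambda>x. inverse (cnj (zeta F E x))) has_vector_derivative - (cnj (zeta' F E x) / (cnj ?z)\<^sup>2)) (at x)"
      using field_vector_diff_chain_at[OF c DERIV_inverse[of "cnj ?z"]] zeta_nonzero[of x]
      by (simp add: o_def field_simps power2_eq_square numeral_eq_Suc)
    have d: "(G has_vector_derivative
        (zeta F E x * inverse (cnj (zeta F E x))) * (- 2 * \<i> * of_real (P x) * exp (- 2 * \<i> * of_real (Theta x)))
        + (zeta F E x * - (cnj (zeta' F E x) / (cnj ?z)\<^sup>2) + zeta' F E x * inverse (cnj (zeta F E x))) * exp (- 2 * \<i> * of_real (Theta x))) (at x)"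
      unfolding G_def[abs_def] divide_inverse
      by (intro has_vector_derivative_mult zeta_deriv i[unfolded divide_inverse] e)
    have "?z * - (cnj (zeta' F E x) / (cnj ?z)\<^sup>2) + zeta' F E x * inverse (cnj ?z)
      = (zeta' F E x * cnj ?z - ?z * cnj (zeta' F E x)) / (cnj ?z)\<^sup>2"
      using zeta_nonzero[of x] by (simp add: field_simps power2_eq_square)
    also have "\<dots> = 2 * \<i> * of_real (1 / Z x) * (?z / cnj ?z)"
    proof -
      have "complex_of_real (Z x) = ?z * cnj ?z" unfolding Z_def by (rule complex_norm_square)
      then show ?thesis unfolding zeta_wronskian using zeta_nonzero[of x] by (simp add: field_simps power2_eq_square)
    qed
    finally have k: "?z * - (cnj (zeta' F E x) / (cnj ?z)\<^sup>2) + zeta' F E x * inverse (cnj ?z) = 2 * \<i> * of_real (1 / Z x) * (?z / cnj ?z)" .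
    show ?thesis
      using d unfolding k by (rule back_subst) (simp add: G_def divide_inverse algebra_simps)
  qed
  define h where "h x = - (8 * C / (3 * F)) / P x ^ 3" for x
  have hd: "(h has_real_derivative 4 * C / P x ^ 5) (at x)" if "X \<le> x" for x
  proof -
    have P0: "0 < P x" using P1[OF that] by linarith
    have "(P has_real_derivative F / (2 * P x)) (at x)"
      unfolding P_def[abs_def] using P1(3)[OF that] by (auto intro!: derivative_eq_intros simp: field_simps)
    then show ?thesis unfolding h_def[abs_def] using P0 F_pos
      by (auto intro!: derivative_eq_intros simp: divide_simps power_Suc numeral_eq_Suc)
  qed
  have GG: "cmod (G y - G x) \<le> 8 * C / (3 * F) / P x ^ 3" if "X \<le> x" "x \<le> y" for x y
  proof (cases "x = y")
    case True
    then show ?thesis using P1[OF that(1)] C(1) F_pos by simp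
  next
    case False
    have "cmod (G y - G x) \<le> h y - h x"
    proof (rule differentiable_bound_general)
      show "x < y" using False that by simp
      show "continuous_on {x..y} G" "continuous_on {x..y} h"
        using that by (auto intro!: continuous_at_imp_continuous_on has_vector_derivative_continuous[OF Gd] DERIV_isCont[OF hd])
      fix z assume z: "x < z" "z < y"
      then have Xz: "X \<le> z" using that by simp
      show "(G has_vector_derivative 2 * \<i> * of_real (1 / Z z - P z) * G z) (at z)" by (rule Gd[OF Xz])
      show "(h has_vector_derivative 4 * C / P z ^ 5) (at z)"
        using hd[OF Xz] by (simp add: has_real_derivative_iff_has_vector_derivative)
      show "cmod (2 * \<i> * of_real (1 / Z z - P z) * G z) \<le> 4 * C / P z ^ 5"
        using ZP[OF Xz] unfolding norm_mult norm_of_real Gn by simp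
    qed
    also have "\<dots> \<le> 8 * C / (3 * F) / P x ^ 3"
      using P1(1)[of y] that C(1) F_pos by (simp add: h_def)
    finally show ?thesis .
  qed
  define C' where "C' = 8 * C / (3 * F)"
  have C'0: "0 \<le> C'" using C F_pos by (simp add: C'_def)
  have Plim: "filterlim (\<lambda>n. P (real n)) at_top sequentially"
    unfolding P_def using F_pos by real_asymp
  have hlim: "(\<lambda>n. C' / P (real n) ^ 3) \<longlonglongrightarrow> 0"
    by (intro tendsto_divide_0[OF tendsto_const] filterlim_at_top_imp_at_infinity filterlim_pow_at_top Plim) auto
  have "Cauchy (\<lambda>n. G (real n))"
  proof (rule metric_CauchyI)
    fix e :: real assume e: "0 < e"
    obtain N where N: "\<And>n. n \<ge> N \<Longrightarrow> C' / P (real n) ^ 3 < e"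
      using order_tendstoD(2)[OF hlim e] unfolding eventually_sequentially by blast
    define M where "M = max N (nat \<lceil>X\<rceil>)"
    have *: "cmod (G (real m) - G (real n)) < e" if "M \<le> n" "n \<le> m" for m n
      using GG[of "real n" "real m"] N[of n] that by (simp add: M_def C'_def)
    have "dist (G (real m)) (G (real n)) < e" if "M \<le> n" "M \<le> m" for m n
      using *[of n m] *[of m n] that by (cases "n \<le> m") (auto simp: dist_norm norm_minus_commute)
    then show "\<exists>M. \<forall>m\<ge>M. \<forall>n\<ge>M. dist (G (real m)) (G (real n)) < e" by blast
  qed
  then obtain G\<^sub>0 where lim: "(\<lambda>n. G (real n)) \<longlonglongrightarrow> G\<^sub>0"
    using Cauchy_convergent_iff convergent_def by blast
  have G0n: "cmod G\<^sub>0 = 1"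
    using tendsto_norm[OF lim] unfolding Gn by (simp add: LIMSEQ_const_iff)
  have G0: "cmod (G\<^sub>0 - G x) \<le> C' / P x ^ 3" if "X \<le> x" for x
  proof (rule tendsto_upperbound)
    show "(\<lambda>n. cmod (G (real n) - G x)) \<longlonglongrightarrow> cmod (G\<^sub>0 - G x)" by (intro tendsto_intros lim)
    show "\<forall>\<^sub>F n in sequentially. cmod (G (real n) - G x) \<le> C' / P x ^ 3"
      using eventually_ge_at_top[of "nat \<lceil>x\<rceil>"] by eventually_elim (use GG[OF that] in \<open>auto simp: C'_def\<close>)
  qed simp
  \<comment> \<open>A square root, because later alpha itself is multiplied by g while the
    off-diagonal coefficient sees g^2.\<close>
  define g where "g = csqrt G\<^sub>0"
  have g: "g\<^sup>2 = G\<^sub>0" "cmod g = 1"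
    using G0n by (simp_all add: g_def power2_eq_1_iff flip: norm_power)
  show thesis
  proof (rule that[of g "C + C'" X])
    show "cmod g = 1" "0 \<le> C + C'" using g C(1) C'0 by auto
    fix x assume x: "X \<le> x"
    note P = P1[OF x]
    have P0: "0 < P x" using P by linarith
    show "1 \<le> F * x + E" using X[OF x] C(1) by simp
    have "C / P x ^ 7 \<le> C / P x ^ 4"
      using P C(1) by (intro divide_left_mono power_increasing) auto
    then have a: "\<bar>Z x - 1 / P x\<bar> \<le> C / P x ^ 4" using C(2,3)[OF P(3)] by linarith
    also have "C / P x ^ 4 \<le> (C + C') / P x ^ 4" using P0 C'0 by (intro divide_right_mono) auto
    finally show "\<bar>(cmod (zeta F E x))\<^sup>2 - 1 / sqrt (F * x + E)\<bar> \<le> (C + C') / sqrt (F * x + E) ^ 4"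
      by (simp add: Z_def P_def)
    let ?e = "exp (2 * \<i> * of_real (Theta x))"
    have "(zeta F E x)\<^sup>2 = of_real (Z x) * G x * ?e"
      using zeta_nonzero[of x] unfolding Z_def complex_norm_square G_def
      by (simp add: exp_minus power2_eq_square field_simps)
    then have "(zeta F E x)\<^sup>2 - g\<^sup>2 * ?e / of_real (P x) = of_real (Z x - 1 / P x) * G x * ?e + of_real (1 / P x) * (G x - G\<^sub>0) * ?e"
      by (simp add: g algebra_simps diff_divide_distrib)
    also have "cmod \<dots> \<le> \<bar>Z x - 1 / P x\<bar> + 1 / P x * cmod (G\<^sub>0 - G x)"
      using P0 by (intro norm_triangle_le add_mono) (simp_all add: norm_mult norm_exp_eq_Re Gn norm_minus_commute norm_divide del: of_real_diff of_real_divide)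
    also have "\<dots> \<le> C / P x ^ 4 + 1 / P x * (C' / P x ^ 3)"
      using a G0[OF x] P0 by (intro add_mono mult_left_mono) auto
    also have "\<dots> = (C + C') / P x ^ 4" by (simp add: add_divide_distrib power_Suc numeral_eq_Suc)
    finally show "cmod ((zeta F E x)\<^sup>2 - g\<^sup>2 * ?e / of_real (sqrt (F * x + E))) \<le> (C + C') / sqrt (F * x + E) ^ 4"
      by (simp add: P_def)
  qed
qed

end

text \<open>Cramer's rule for the system a z + cnj a cnj z and a z' + cnj a cnj z', whose
  determinant is given by the Wronskian.\<close>

lemma coefficient_identity:
  fixes z z' a :: complex
  assumes w: "z' * cnj z - z * cnj z' = 2 * \<i>"
  shows "a = \<i> / 2 * ((a * z + cnj a * cnj z) * cnj z' - (a * z' + cnj a * cnj z') * cnj z)"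
proof -
  have "\<i> / 2 * ((a * z + cnj a * cnj z) * cnj z' - (a * z' + cnj a * cnj z') * cnj z)
      = - (\<i> / 2) * a * (z' * cnj z - z * cnj z')" by (simp add: algebra_simps)
  also have "\<dots> = a" unfolding w by (simp add: complex_eq_iff)
  finally show ?thesis by simp
qed

lemma coefficient_representation:
  fixes z z' a :: complex and r s :: real
  assumes w: "z' * cnj z - z * cnj z' = 2 * \<i>"
    and a: "a = \<i> / 2 * (of_real r * cnj z' - of_real s * cnj z)"
  shows "of_real r = a * z + cnj a * cnj z" "of_real s = a * z' + cnj a * cnj z'"
proof -
  have "a * z + cnj a * cnj z = - (\<i> / 2) * of_real r * (z' * cnj z - z * cnj z')"
    unfolding a by (simp add: algebra_simps)
  also have "\<dots> = of_real r" unfolding w by (simp add: complex_eq_iff)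
  finally show "of_real r = a * z + cnj a * cnj z" by (rule sym)
  have "a * z' + cnj a * cnj z' = - (\<i> / 2) * of_real s * (z' * cnj z - z * cnj z')"
    unfolding a by (simp add: algebra_simps)
  also have "\<dots> = of_real s" unfolding w by (simp add: complex_eq_iff)
  finally show "of_real s = a * z' + cnj a * cnj z'" by (rule sym)
qed

lemma non_integer_between:
  assumes "of_int n - 1 < x" "x < (of_int n :: real)"
  shows "x \<notin> \<int>"
  using assms by (auto elim!: Ints_cases)

section \<open>The coefficients \<open>\<alpha>(n)\<close>\<close>

locale eig_solution =
  fixes F E lam :: real and \<psi> :: "real \<Rightarrow> real"
  assumes F_pos: "0 < F" and sol: "gen_eig_solution F E (\<lambda>_. lam) \<psi>"
begin

abbreviation "z \<equiv> zeta F E"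
abbreviation "z' \<equiv> zeta' F E"

text \<open>Cramer's formula for alpha in terms of the solution and its derivative, meaningful at
  every point. It is constant between consecutive integers, since the Wronskian of two solutions
  is.\<close>

definition coef :: "real \<Rightarrow> complex" where
  "coef x = \<i> / 2 * (of_real (\<psi> x) * cnj (z' x) - of_real (deriv \<psi> x) * cnj (z x))"

text \<open>The midpoint serves as a sample point of the interval. Indexing by integers lets a zero
  be propagated in both directions.\<close>

definition al :: "int \<Rightarrow> complex" where "al n = coef (of_int n - 1/2)"

lemmas wronskian = zeta_wronskian[OF F_pos, of E]

lemma coef_deriv:
  assumes "x \<notin> \<int>"
  shows "(coef has_vector_derivative 0) (at x)"
proof -
  have d: "\<psi> differentiable (at x)" "deriv \<psi> differentiable (at x)" "- deriv (deriv \<psi>) x - F * x * \<psi> x = E * \<psi> x"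
    using sol assms unfolding gen_eig_solution_def by auto
  have d1: "(\<psi> has_real_derivative deriv \<psi> x) (at x)" "(deriv \<psi> has_real_derivative deriv (deriv \<psi>) x) (at x)"
    using d(1,2) by (simp_all add: DERIV_deriv_iff_real_differentiable)
  have d2: "deriv (deriv \<psi>) x = - (F * x + E) * \<psi> x" using d(3) by (simp add: algebra_simps)
  note v = has_vector_derivative_of_real[OF d1(1), where 'a = complex]
    has_vector_derivative_of_real[OF d1(2), where 'a = complex]
    has_vector_derivative_cnj[OF zeta_deriv[OF F_pos]] has_vector_derivative_cnj[OF zeta'_deriv[OF F_pos]]
  have "(coef has_vector_derivative \<i> / 2 *
     ((of_real (\<psi> x) * cnj (- of_real (F * x + E) * z x) + of_real (deriv \<psi> x) * cnj (z' x))
      - (of_real (deriv \<psi> x) * cnj (z' x) + of_real (deriv (deriv \<psi>) x) * cnj (z x)))) (at x)"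
    unfolding coef_def[abs_def]
    by (intro has_vector_derivative_mult_right has_vector_derivative_diff has_vector_derivative_mult v)
  moreover have "\<i> / 2 *
     ((of_real (\<psi> x) * cnj (- of_real (F * x + E) * z x) + of_real (deriv \<psi> x) * cnj (z' x))
      - (of_real (deriv \<psi> x) * cnj (z' x) + of_real (deriv (deriv \<psi>) x) * cnj (z x))) = 0"
    unfolding d2 by (simp add: algebra_simps)
  ultimately show ?thesis by (simp only:)
qed

lemma coef_eq_al:
  assumes "of_int n - 1 < x" "x < of_int n"
  shows "coef x = al n"
proof -
  obtain c where c: "\<And>x. x \<in> {of_int n - 1<..<of_int n} \<Longrightarrow> coef x = c"
  proof (rule has_vector_derivative_zero_constant)
    show "convex {of_int n - 1<..<of_int n :: real}" by (rule convex_real_interval)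
    show "(coef has_vector_derivative 0) (at x within {of_int n - 1<..<of_int n})"
      if "x \<in> {of_int n - 1<..<of_int n}" for x
      by (rule has_vector_derivative_at_within[OF coef_deriv[OF non_integer_between[of n]]]) (use that in simp_all)
  qed (rule that)
  have "coef x = c" by (rule c) (simp add: assms)
  moreover have "coef (of_int n - 1/2) = c" by (rule c) simp
  ultimately show ?thesis by (simp add: al_def)
qed

lemma representation:
  assumes "of_int n - 1 < x" "x < of_int n"
  shows "of_real (\<psi> x) = al n * z x + cnj (al n) * cnj (z x)"
    and "of_real (deriv \<psi> x) = al n * z' x + cnj (al n) * cnj (z' x)"
  using coefficient_representation[OF wronskian coef_def, of x] by (simp_all only: coef_eq_al[OF assms])

lemma z_isCont: "isCont z x" "isCont z' x"
  using has_vector_derivative_continuous[OF zeta_deriv[OF F_pos]]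
    has_vector_derivative_continuous[OF zeta'_deriv[OF F_pos]] by blast+

text \<open>One-sided limits of the two neighbouring representations; continuity of the solution
  makes both agree with its value at the integer.\<close>

lemma psi_at_int:
  "of_real (\<psi> (of_int n)) = al n * z (of_int n) + cnj (al n) * cnj (z (of_int n))"
  "of_real (\<psi> (of_int n)) = al (n + 1) * z (of_int n) + cnj (al (n + 1)) * cnj (z (of_int n))"
proof -
  have cont: "isCont \<psi> x" for x
    using sol unfolding gen_eig_solution_def by (simp add: continuous_on_eq_continuous_at)
  have lt: "of_int n - 1 < (of_int n :: real)" "(of_int n :: real) < of_int n + 1" by simp_all
  have lim: "((\<lambda>x. complex_of_real (\<psi> x) - (a * z x + cnj a * cnj (z x))) \<longlongrightarrow> of_real (\<psi> t) - (a * z t + cnj a * cnj (z t))) (at t)" for a t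
    by (intro tendsto_intros isContD[OF cont] isContD[OF z_isCont(1)])
  have "\<forall>\<^sub>F x in at_left (of_int n). complex_of_real (\<psi> x) - (al n * z x + cnj (al n) * cnj (z x)) = 0"
    using eventually_at_left_real[OF lt(1)] by eventually_elim (simp_all add: representation(1))
  moreover have "((\<lambda>x. complex_of_real (\<psi> x) - (al n * z x + cnj (al n) * cnj (z x))) \<longlongrightarrow> of_real (\<psi> (of_int n)) - (al n * z (of_int n) + cnj (al n) * cnj (z (of_int n)))) (at_left (of_int n))"
    by (rule tendsto_mono[OF at_le[OF subset_UNIV] lim])
  ultimately have "((\<lambda>x. 0) \<longlongrightarrow> of_real (\<psi> (of_int n)) - (al n * z (of_int n) + cnj (al n) * cnj (z (of_int n)))) (at_left (of_int n :: real))"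
    by (rule Lim_transform_eventually[rotated])
  then have "of_real (\<psi> (of_int n)) - (al n * z (of_int n) + cnj (al n) * cnj (z (of_int n))) = 0"
    by (simp add: tendsto_const_iff)
  then show "of_real (\<psi> (of_int n)) = al n * z (of_int n) + cnj (al n) * cnj (z (of_int n))" by (rule eq_iff_diff_eq_0[THEN iffD2])
  have "\<forall>\<^sub>F x in at_right (of_int n). complex_of_real (\<psi> x) - (al (n + 1) * z x + cnj (al (n + 1)) * cnj (z x)) = 0"
    using eventually_at_right_real[OF lt(2)] by eventually_elim (simp_all add: representation(1)[of "n + 1"])
  moreover have "((\<lambda>x. complex_of_real (\<psi> x) - (al (n + 1) * z x + cnj (al (n + 1)) * cnj (z x))) \<longlongrightarrow> of_real (\<psi> (of_int n)) - (al (n + 1) * z (of_int n) + cnj (al (n + 1)) * cnj (z (of_int n)))) (at_right (of_int n))"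
    by (rule tendsto_mono[OF at_le[OF subset_UNIV] lim])
  ultimately have "((\<lambda>x. 0) \<longlongrightarrow> of_real (\<psi> (of_int n)) - (al (n + 1) * z (of_int n) + cnj (al (n + 1)) * cnj (z (of_int n)))) (at_right (of_int n :: real))"
    by (rule Lim_transform_eventually[rotated])
  then have "of_real (\<psi> (of_int n)) - (al (n + 1) * z (of_int n) + cnj (al (n + 1)) * cnj (z (of_int n))) = 0"
    by (simp add: tendsto_const_iff)
  then show "of_real (\<psi> (of_int n)) = al (n + 1) * z (of_int n) + cnj (al (n + 1)) * cnj (z (of_int n))" by (rule eq_iff_diff_eq_0[THEN iffD2])
qed

lemma jump:
  "of_real (lam * \<psi> (of_int n)) = (al (n + 1) - al n) * z' (of_int n) + cnj (al (n + 1) - al n) * cnj (z' (of_int n))"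
proof -
  define N where "N = (of_int n :: real)"
  define v where "v x = al (n + 1) * z' (N + x) + cnj (al (n + 1)) * cnj (z' (N + x)) - (al n * z' (N - x) + cnj (al n) * cnj (z' (N - x)))" for x
  have "((\<lambda>x. complex_of_real (deriv \<psi> (N + x) - deriv \<psi> (N - x))) \<longlongrightarrow> of_real (lam * \<psi> N)) (at_right 0)"
    using sol unfolding gen_eig_solution_def N_def by (intro tendsto_of_real) blast
  moreover have "\<forall>\<^sub>F x in at_right 0. complex_of_real (deriv \<psi> (N + x) - deriv \<psi> (N - x)) = v x"
    using eventually_at_right_real[OF zero_less_one]
  proof eventually_elim
    fix x :: real assume "x \<in> {0<..<1}"
    then show "complex_of_real (deriv \<psi> (N + x) - deriv \<psi> (N - x)) = v x"
      unfolding v_def of_real_diff by (subst representation(2)[of n] representation(2)[of "n + 1"]; simp add: N_def)+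
  qed
  ultimately have 1: "(v \<longlongrightarrow> of_real (lam * \<psi> N)) (at_right 0)"
    by (rule Lim_transform_eventually)
  have c: "((\<lambda>x. z' (N + x)) \<longlongrightarrow> z' N) (at_right 0)" "((\<lambda>x. z' (N - x)) \<longlongrightarrow> z' N) (at_right 0)"
  proof -
    have "((\<lambda>x::real. N + x) \<longlongrightarrow> N + 0) (at_right 0)" "((\<lambda>x::real. N - x) \<longlongrightarrow> N - 0) (at_right 0)"
      by (intro tendsto_intros)+
    then show "((\<lambda>x. z' (N + x)) \<longlongrightarrow> z' N) (at_right 0)" "((\<lambda>x. z' (N - x)) \<longlongrightarrow> z' N) (at_right 0)"
      using isCont_tendsto_compose[OF z_isCont(2)[of N]] by auto
  qed
  have 2: "(v \<longlongrightarrow> al (n + 1) * z' N + cnj (al (n + 1)) * cnj (z' N) - (al n * z' N + cnj (al n) * cnj (z' N))) (at_right 0)"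
    unfolding v_def[abs_def] by (intro tendsto_intros c)
  have "of_real (lam * \<psi> N) = al (n + 1) * z' N + cnj (al (n + 1)) * cnj (z' N) - (al n * z' N + cnj (al n) * cnj (z' N))"
    by (rule tendsto_unique[OF _ 1 2]) simp
  then show ?thesis unfolding N_def by (simp add: algebra_simps)
qed

text \<open>Continuity says that the jump d of alpha satisfies d zeta + cnj d cnj zeta = 0, and the
  derivative condition gives d zeta' + cnj d cnj zeta' = lam psi; Cramer's rule solves for
  d.\<close>

lemma al_diff: "al (n + 1) - al n = - (\<i> * of_real lam / 2) * cnj (z (of_int n)) * of_real (\<psi> (of_int n))"
proof -
  let ?d = "al (n + 1) - al n"
  have 0: "?d * z (of_int n) + cnj ?d * cnj (z (of_int n)) = 0"
    using psi_at_int[of n] by (simp add: algebra_simps)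
  show ?thesis
    by (rule trans[OF coefficient_identity[OF wronskian, of _ "of_int n"]])
      (simp only: 0 jump[of n, symmetric], simp add: algebra_simps)
qed

lemma al_step:
  "al (n + 1) = al n - \<i> * of_real (lam / 2) * (of_real ((cmod (z (of_int n)))\<^sup>2) * al n + cnj ((z (of_int n))\<^sup>2) * cnj (al n))"
proof -
  have "al (n + 1) = al n + (al (n + 1) - al n)" by simp
  also have "\<dots> = al n - \<i> * of_real (lam / 2) * (z (of_int n) * cnj (z (of_int n)) * al n + cnj ((z (of_int n))\<^sup>2) * cnj (al n))"
    unfolding al_diff psi_at_int(1) by (simp add: algebra_simps power2_eq_square)
  finally show ?thesis unfolding complex_norm_square[symmetric] .
qed

text \<open>If alpha vanishes on one interval, so does psi at both its endpoints, and alpha does not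
  jump there. Hence alpha would vanish everywhere, and psi with it.\<close>

lemma al_nonzero:
  assumes "\<psi> x \<noteq> 0"
  shows "al n \<noteq> 0"
proof
  assume n: "al n = 0"
  have all: "al k = 0" for k
  proof (induction k rule: int_induct[where k = n])
    case base
    then show ?case by (rule n)
  next
    case (step1 i)
    then show ?case using al_diff[of i] psi_at_int(1)[of i] by simp
  next
    case (step2 i)
    then show ?case using al_diff[of "i - 1"] psi_at_int(2)[of "i - 1"] by simp
  qed
  have "complex_of_real (\<psi> x) = 0"
  proof (cases "x \<in> \<int>")
    case True
    then show ?thesis using psi_at_int(1) all by (auto elim!: Ints_cases)
  next
    case False
    then have "of_int \<lceil>x\<rceil> \<noteq> x" by (metis Ints_of_int)
    then have "of_int \<lceil>x\<rceil> - 1 < x" "x < of_int \<lceil>x\<rceil>" by linarith+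
    then show ?thesis using representation(1)[of "\<lceil>x\<rceil>" x] all by simp
  qed
  with assms show False by simp
qed

text \<open>Uniqueness on an open interval: the difference d of two candidates gives d zeta + cnj d
  cnj zeta = 0 identically, so the derivative vanishes too, and Cramer's rule yields d = 0.\<close>

lemma pruefer_alpha_eq: "pruefer_alpha F E \<psi> n = al (int n)"
  unfolding pruefer_alpha_def
proof (rule the_equality)
  show "\<forall>x\<in>{real n - 1<..<real n}. complex_of_real (\<psi> x) = al (int n) * z x + cnj (al (int n)) * cnj (z x)"
    using representation(1)[of "int n"] by auto
  fix a assume a: "\<forall>x\<in>{real n - 1<..<real n}. complex_of_real (\<psi> x) = a * z x + cnj a * cnj (z x)"
  define d where "d = a - al (int n)"
  define x where "x = real n - 1/2"
  have 0: "d * z x + cnj d * cnj (z x) = 0" if "x \<in> {real n - 1<..<real n}" for x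
    using representation(1)[of "int n" x] bspec[OF a that] that by (simp add: d_def algebra_simps)
  have "((\<lambda>x. d * z x + cnj d * cnj (z x)) has_vector_derivative d * z' x + cnj d * cnj (z' x)) (at x)"
    by (intro has_vector_derivative_add has_vector_derivative_mult_right has_vector_derivative_cnj zeta_deriv F_pos)
  then have "((\<lambda>x. 0) has_vector_derivative d * z' x + cnj d * cnj (z' x)) (at x)"
    by (rule has_vector_derivative_transform_within_open[of _ _ _ "{real n - 1<..<real n}"])
      (use 0 in \<open>auto simp: x_def\<close>)
  then have 1: "d * z' x + cnj d * cnj (z' x) = 0"
    by (rule vector_derivative_unique_at) (rule has_vector_derivative_const)
  have x: "d * z x + cnj d * cnj (z x) = 0" by (rule 0) (simp add: x_def)
  have "d = \<i> / 2 * ((d * z x + cnj d * cnj (z x)) * cnj (z' x) - (d * z' x + cnj d * cnj (z' x)) * cnj (z x))"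
    by (rule coefficient_identity[OF wronskian])
  also have "\<dots> = 0" unfolding x 1 by simp
  finally have "d = 0" .
  then show "a = al (int n)" by (simp add: d_def)
qed

end

section \<open>Resonance sums and the reduction to the model recursion\<close>

text \<open>Advancing by q acts on the partial sums as the affine map x -> S q + z x. Under either
  hypothesis it has a fixed point s, and the sums rotate about it.\<close>

lemma quasi_periodic_sums_bounded:
  fixes w :: "nat \<Rightarrow> complex"
  assumes q: "1 \<le> q" and w1: "\<And>k. cmod (w k) = 1" and z: "cmod z = 1" and per: "\<And>k. w (k + q) = z * w k"
    and nonres: "z \<noteq> 1 \<or> (\<Sum>k<q. w k) = 0"
  obtains B where "\<And>K L. cmod (\<Sum>k\<in>{K..<L}. w k) \<le> B"
proof -
  define S where "S L = (\<Sum>k<L. w k)" for L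
  \<comment> \<open>For z = 1 the sum over one period is zero and every s is fixed; otherwise s = S
    q / (1 - z).\<close>
  have "\<exists>s. S q = s - z * s"
  proof (cases "z = 1")
    case True
    then show ?thesis using nonres by (auto simp: S_def)
  next
    case False
    then have "1 - z \<noteq> 0" by simp
    then have "S q = (1 - z) * (S q / (1 - z))" by simp
    also have "\<dots> = S q / (1 - z) - z * (S q / (1 - z))" by (simp only: left_diff_distrib mult_1)
    finally show ?thesis by blast
  qed
  then obtain s where s: "S q = s - z * s" by blast
  have S_add: "S (L + q) = S q + z * S L" for L
    by (induction L) (simp_all add: S_def per algebra_simps)
  have bound: "cmod (S L - s) \<le> real q + cmod s" for L
  proof (induction L rule: less_induct)
    case (less L)
    show ?case
    proof (cases "L < q")
      case True
      have "cmod (S L) \<le> (\<Sum>k<L. cmod (w k))" unfolding S_def by (rule norm_sum)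
      then have "cmod (S L) \<le> real q" using True by (simp add: w1)
      then show ?thesis using norm_triangle_ineq4[of "S L" s] by linarith
    next
      case False
      then obtain M where M: "L = M + q" using le_Suc_ex[of q L] by (auto simp: add.commute)
      have "S L - s = z * (S M - s)" unfolding M S_add s by (simp add: algebra_simps)
      then have "cmod (S L - s) = cmod (S M - s)" by (simp add: norm_mult z)
      then show ?thesis using less.IH[of M] q M by simp
    qed
  qed
  show thesis
  proof (rule that)
    fix K L
    show "cmod (\<Sum>k\<in>{K..<L}. w k) \<le> 2 * (real q + cmod s)"
    proof (cases "K \<le> L")
      case True
      have "(\<Sum>k\<in>{K..<L}. w k) = S L - S K"
        unfolding S_def using sum_diff_nat_ivl[of 0 K L w] True by (simp add: atLeast0LessThan)
      also have "\<dots> = (S L - s) - (S K - s)" by simp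
      finally show ?thesis using norm_triangle_ineq4[of "S L - s" "S K - s"] bound[of K] bound[of L] by (simp add: distrib_left)
    qed (use norm_ge_zero[of s] in simp)
  qed
qed

text \<open>For this F the phase of \<open>om k\<close> is 2 pi (p' k^3 - k m) / q with real m. A
  shift of k by q multiplies \<open>om k\<close> by cis (-2 pi m), which equals 1 exactly for
  integral m; with e = E - lam these are the exceptional energies.\<close>

lemma om_bounded:
  fixes p' q :: nat and F e :: real
  assumes p': "1 \<le> p'" and q: "1 \<le> q" and F: "F = pi\<^sup>2 * real q / (3 * real p')"
    and nonres: "\<And>m :: int. 3 * real p' * e / pi\<^sup>2 = of_int m \<Longrightarrow>
      (\<Sum>j = 0..<q. cis (- 2 * pi * (real p' * real j ^ 3 - real j * of_int m) / real q)) = 0"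
  obtains Bd where "\<And>K L. cmod (\<Sum>k\<in>{K..<L}. osc_sum.om F e k) \<le> Bd"
proof -
  have F_pos: "0 < F" using p' q unfolding F by simp
  interpret osc_sum F e by unfold_locales (rule F_pos)
  define m where "m = 3 * real p' * e / pi\<^sup>2"
  have om: "om k = cis (2 * pi * (real p' * real k ^ 3 - real k * m) / real q)" for k
  proof -
    have 1: "2 * pi ^ 3 * real k ^ 3 / (3 * F) = 2 * pi * (real p' * real k ^ 3) / real q"
      unfolding F using p' q by (simp add: field_simps power2_eq_square power3_eq_cube)
    have 2: "2 * pi * real k * e / F = 2 * pi * (real k * m) / real q"
      unfolding F m_def using p' q by (simp add: field_simps power2_eq_square)
    show ?thesis unfolding om_def cis_conv_exp 1 2 by (simp add: algebra_simps diff_divide_distrib)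
  qed
  have per: "om (k + q) = cis (- 2 * pi * m) * om k" for k
  proof -
    \<comment> \<open>The quotient of p' ((k + q)^3 - k^3) by q; being an integer, it drops out of
      the phase.\<close>
    define t where "t = p' * (3 * k\<^sup>2 + 3 * k * q + q\<^sup>2)"
    have "2 * pi * (real p' * real (k + q) ^ 3 - real (k + q) * m) / real q
      = - 2 * pi * m + 2 * pi * (real p' * real k ^ 3 - real k * m) / real q + 2 * pi * real t"
      using q by (simp add: t_def field_simps power2_eq_square power3_eq_cube)
    then show ?thesis
      unfolding om by (simp only: cis_mult[symmetric]) (simp add: cis_multiple_2pi)
  qed
  have "cis (- 2 * pi * m) \<noteq> 1 \<or> (\<Sum>k<q. om k) = 0"
  proof (cases "cis (- 2 * pi * m) = 1")
    case True
    then have "cos (2 * pi * m) = 1" by (simp add: complex_eq_iff)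
    then obtain j :: int where "2 * pi * m = of_int j * 2 * pi" using cos_one_2pi_int by auto
    then have j: "m = of_int j" by simp
    \<comment> \<open>The hypothesis has the opposite sign in the exponent; conjugation leaves the
      vanishing of the sum unchanged.\<close>
    have "cnj (\<Sum>k<q. om k) = (\<Sum>k = 0..<q. cis (- 2 * pi * (real p' * real k ^ 3 - real k * of_int j) / real q))"
      by (simp add: om j cis_cnj atLeast0LessThan)
    also have "\<dots> = 0" using nonres[of j] j by (simp add: m_def)
    finally show ?thesis by (simp only: complex_cnj_zero_iff simp_thms)
  qed simp
  then show thesis
    using quasi_periodic_sums_bounded[of q om "cis (- 2 * pi * m)"] q per cmod_om that by (metis norm_cis)
qed

section \<open>The change of phase that shifts the energy by lam\<close>

lemma sqrt_diff_bound:
  assumes "0 \<le> a" "0 < (b :: real)"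
  shows "\<bar>sqrt a - sqrt b\<bar> \<le> \<bar>a - b\<bar> / sqrt b"
proof -
  have "\<bar>sqrt a - sqrt b\<bar> * sqrt b \<le> \<bar>sqrt a - sqrt b\<bar> * (sqrt a + sqrt b)"
    using assms by (intro mult_left_mono) auto
  also have "\<dots> = \<bar>(sqrt a - sqrt b) * (sqrt a + sqrt b)\<bar>" using assms by (simp add: abs_mult)
  also have "(sqrt a - sqrt b) * (sqrt a + sqrt b) = a - b" using assms by (simp add: algebra_simps)
  finally show ?thesis using assms by (simp add: field_simps)
qed

text \<open>The difference of the square roots is lam divided by their sum, and on a whole cell that
  sum is 2 sqrt a up to O(1 / sqrt a). This makes the derivative of the change of phase nearly
  constant on the cell.\<close>

lemma sqrt_shift_derivative:
  fixes a lam d F :: real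
  assumes F: "0 < F" and a: "0 \<le> a" "1 + F + \<bar>lam\<bar> \<le> sqrt a" and d: "\<bar>d\<bar> \<le> F / 2"
  shows "0 < a + d" "0 < a + d + lam"
    and "\<bar>sqrt (a + d + lam) - sqrt (a + d) - lam / 2 / sqrt a\<bar> \<le> \<bar>lam\<bar> * (F + \<bar>lam\<bar>) / sqrt a ^ 3"
proof -
  define P where "P = sqrt a"
  have "1 + F + \<bar>lam\<bar> \<le> P" using a(2) by (simp only: P_def)
  moreover from this have "1 \<le> P" using F by linarith
  moreover have "a = P\<^sup>2" using a(1) by (simp add: P_def)
  ultimately have P: "1 + F + \<bar>lam\<bar> \<le> P" "1 \<le> P" "a = P\<^sup>2" by blast+
  have "1 * (1 + F + \<bar>lam\<bar>) \<le> P * P" using P F by (intro mult_mono) auto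
  then have aF: "1 + F + \<bar>lam\<bar> \<le> a" by (simp add: P(3) power2_eq_square)
  then show pos: "0 < a + d" "0 < a + d + lam" using d F by (auto simp: abs_if split: if_splits)
  define s t where "s = sqrt (a + d + lam)" and "t = sqrt (a + d)"
  have sa: "\<bar>s - P\<bar> \<le> (F / 2 + \<bar>lam\<bar>) / P" "\<bar>t - P\<bar> \<le> (F / 2) / P"
  proof -
    have "\<bar>s - P\<bar> \<le> \<bar>a + d + lam - a\<bar> / P" "\<bar>t - P\<bar> \<le> \<bar>a + d - a\<bar> / P"
      unfolding s_def t_def P_def using pos aF F by (intro sqrt_diff_bound; simp)+
    moreover have "\<bar>a + d + lam - a\<bar> / P \<le> (F / 2 + \<bar>lam\<bar>) / P" "\<bar>a + d - a\<bar> / P \<le> (F / 2) / P"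
      using d P by (intro divide_right_mono; simp)+
    ultimately show "\<bar>s - P\<bar> \<le> (F / 2 + \<bar>lam\<bar>) / P" "\<bar>t - P\<bar> \<le> (F / 2) / P" by linarith+
  qed
  have half: "P / 2 \<le> s" "P / 2 \<le> t"
  proof -
    have "(P / 2)\<^sup>2 \<le> a + d + lam" "(P / 2)\<^sup>2 \<le> a + d"
    proof -
      have "(1 + F + \<bar>lam\<bar>) * (1 + F + \<bar>lam\<bar>) \<le> P * P" using P F by (intro mult_mono) auto
      moreover have "1 + 2 * F + 2 * \<bar>lam\<bar> \<le> (1 + F + \<bar>lam\<bar>) * (1 + F + \<bar>lam\<bar>)"
        using F by (simp add: algebra_simps)
      ultimately have "1 + 2 * F + 2 * \<bar>lam\<bar> \<le> a" by (simp add: P(3) power2_eq_square)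
      moreover have "- (F / 2) \<le> d" "- \<bar>lam\<bar> \<le> lam" using d by linarith+
      moreover have "(P / 2)\<^sup>2 = a / 4" by (simp add: P(3) power_divide)
      ultimately show "(P / 2)\<^sup>2 \<le> a + d + lam" "(P / 2)\<^sup>2 \<le> a + d" using F by linarith+
    qed
    then show "P / 2 \<le> s" "P / 2 \<le> t" unfolding s_def t_def by (simp_all only: real_le_rsqrt)
  qed
  have P0: "0 < P" using P by linarith
  have st: "(s - t) * (s + t) = lam"
    unfolding s_def t_def using pos by (simp add: algebra_simps)
  have ne: "s + t \<noteq> 0" using half P0 by linarith
  have "s - t = lam / (s + t)" using st ne by (simp add: field_simps)
  moreover have "lam / c - lam / 2 / P = lam * (2 * P - c) / (c * (2 * P))" if "c \<noteq> 0" for c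
    using that P0 by (simp add: field_simps)
  ultimately have "s - t - lam / 2 / P = lam * (2 * P - (s + t)) / ((s + t) * (2 * P))"
    using ne by simp
  also have "\<bar>\<dots>\<bar> = \<bar>lam\<bar> * \<bar>2 * P - (s + t)\<bar> / ((s + t) * (2 * P))"
    using half P0 by (simp add: abs_mult abs_divide)
  also have "\<dots> \<le> \<bar>lam\<bar> * (2 * (F + \<bar>lam\<bar>) / P) / (P * (2 * P))"
  proof (intro frac_le mult_left_mono mult_right_mono mult_nonneg_nonneg)
    have "(F / 2 + \<bar>lam\<bar>) / P + (F / 2) / P \<le> 2 * (F + \<bar>lam\<bar>) / P"
      unfolding add_divide_distrib[symmetric] using P0 F by (intro divide_right_mono) auto
    then show "\<bar>2 * P - (s + t)\<bar> \<le> 2 * (F + \<bar>lam\<bar>) / P" using sa by linarith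
    show "P \<le> s + t" using half by linarith
  qed (use P0 F in auto)
  also have "\<dots> = \<bar>lam\<bar> * (F + \<bar>lam\<bar>) / P ^ 3" using P0 by (simp add: power3_eq_cube field_simps)
  finally show "\<bar>sqrt (a + d + lam) - sqrt (a + d) - lam / 2 / sqrt a\<bar> \<le> \<bar>lam\<bar> * (F + \<bar>lam\<bar>) / sqrt a ^ 3"
    by (simp only: s_def t_def P_def)
qed

lemma mean_value_approx:
  fixes h h' :: "real \<Rightarrow> real"
  assumes "a < b" and d: "\<And>x. a \<le> x \<Longrightarrow> x \<le> b \<Longrightarrow> (h has_real_derivative h' x) (at x)"
    and k: "\<And>x. a \<le> x \<Longrightarrow> x \<le> b \<Longrightarrow> \<bar>h' x - v\<bar> \<le> k"
  shows "\<bar>h b - h a - (b - a) * v\<bar> \<le> (b - a) * k"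
proof -
  obtain c where c: "a < c" "c < b" "h b - h a = (b - a) * h' c"
    using MVT2[OF assms(1), of h h'] d by auto
  have "h b - h a - (b - a) * v = (b - a) * (h' c - v)" unfolding c(3) by (simp add: algebra_simps)
  then have "\<bar>h b - h a - (b - a) * v\<bar> = (b - a) * \<bar>h' c - v\<bar>" using assms(1) by (simp add: abs_mult)
  also have "\<dots> \<le> (b - a) * k" using c k[of c] assms(1) by (intro mult_left_mono) auto
  finally show ?thesis .
qed

lemma iexp_Lipschitz: "cmod (exp (\<i> * of_real s) - exp (\<i> * of_real t)) \<le> \<bar>s - t\<bar>" for s t :: real
proof -
  have "exp (\<i> * of_real s) - exp (\<i> * of_real t) = exp (\<i> * of_real t) * (exp (\<i> * of_real (s - t)) - 1)"
    by (simp add: algebra_simps flip: exp_add)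
  then have "cmod (exp (\<i> * of_real s) - exp (\<i> * of_real t)) = cmod (exp (\<i> * of_real (s - t)) - 1)"
    by (simp only: norm_mult norm_exp_i_times mult_1)
  also have "\<dots> \<le> \<bar>s - t\<bar>" using iexp_approx1[of "s - t" 0] by simp
  finally show ?thesis .
qed

text \<open>The rotation cancels the first-order term: (1 + i X - X^2/2)(1 - i X) = 1 + X^2/2 + i
  X^3/2. This is where the coefficient |A|^2/2 of the model recursion comes from.\<close>

lemma unimodular_step:
  fixes X d Z \<mu> k1 k2 :: real
  assumes X: "\<bar>X\<bar> \<le> 1" and d: "\<bar>d - X\<bar> \<le> k1" and Z: "\<bar>\<mu> * Z - X\<bar> \<le> k2"
  shows "cmod (exp (\<i> * of_real d) * (1 - \<i> * of_real (\<mu> * Z)) - (1 + of_real (X\<^sup>2 / 2))) \<le> k2 + 2 * k1 + \<bar>X\<bar> ^ 3"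
proof -
  define r where "r = exp (\<i> * of_real X) - (1 + \<i> * of_real X - of_real (X\<^sup>2 / 2))"
  have r: "cmod r \<le> \<bar>X\<bar> ^ 3 / 6"
    using iexp_approx1[of X 2] unfolding r_def
    by (simp add: numeral_eq_Suc atMost_Suc algebra_simps power2_eq_square)
  have one: "cmod (1 - \<i> * of_real X) \<le> 2"
    using norm_triangle_ineq4[of 1 "\<i> * of_real X"] X by (simp add: norm_mult)
  have "exp (\<i> * of_real d) * (1 - \<i> * of_real (\<mu> * Z)) - (1 + of_real (X\<^sup>2 / 2))
      = exp (\<i> * of_real d) * (- \<i> * of_real (\<mu> * Z - X)) + ((exp (\<i> * of_real d) - exp (\<i> * of_real X)) * (1 - \<i> * of_real X)
      + (r * (1 - \<i> * of_real X) + \<i> * of_real (X ^ 3 / 2)))"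
    unfolding r_def by (simp add: algebra_simps power2_eq_square power3_eq_cube diff_divide_distrib)
  also have "cmod \<dots> \<le> k2 + (k1 * 2 + (\<bar>X\<bar> ^ 3 / 6 * 2 + \<bar>X\<bar> ^ 3 / 2))"
  proof (intro norm_triangle_le add_mono)
    show "cmod (exp (\<i> * of_real d) * (- \<i> * of_real (\<mu> * Z - X))) \<le> k2"
      using Z by (simp only: norm_mult norm_exp_i_times norm_minus_cancel norm_ii norm_of_real mult_1)
    show "cmod ((exp (\<i> * of_real d) - exp (\<i> * of_real X)) * (1 - \<i> * of_real X)) \<le> k1 * 2"
      unfolding norm_mult using iexp_Lipschitz[of d X] d one by (intro mult_mono) auto
    show "cmod (r * (1 - \<i> * of_real X)) \<le> \<bar>X\<bar> ^ 3 / 6 * 2"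
      unfolding norm_mult using r one by (intro mult_mono) auto
    show "cmod (\<i> * of_real (X ^ 3 / 2)) \<le> \<bar>X\<bar> ^ 3 / 2" unfolding norm_mult norm_of_real by (simp add: power_abs)
  qed
  also have "\<dots> \<le> k2 + 2 * k1 + \<bar>X\<bar> ^ 3" by simp
  finally show ?thesis .
qed

text \<open>The change of phase \<open>\<xi>\<close> is the difference of the WKB phases at E and E
  - lam. Its increment, about lam/(2p), undoes the rotation caused by the diagonal coefficient -i
  lam/2 |zeta|^2. In the off-diagonal coefficient it replaces the phase at energy E by the one at E
  - lam, which is the phase of \<open>b\<close>. The constant g removes the limiting phase of
  zeta.\<close>

lemma alpha_convergence:
  fixes a :: "nat \<Rightarrow> complex"
  assumes res: "osc_res F (E - lam) Bd"
    and step: "\<And>n. a (Suc n) = a n - \<i> * of_real (lam / 2) * (of_real ((cmod (zeta F E (real n)))\<^sup>2) * a n + cnj ((zeta F E (real n))\<^sup>2) * cnj (a n))"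
    and nz: "\<And>n. a n \<noteq> 0"
  shows "convergent (\<lambda>n. ln (cmod (a n)))"
proof -
  interpret osc_res F "E - lam" Bd by (rule res)
  obtain g C X where g: "cmod g = 1" and C: "0 \<le> C"
    and X1: "\<And>x. X \<le> x \<Longrightarrow> 1 \<le> F * x + E"
    and X2: "\<And>x. X \<le> x \<Longrightarrow> \<bar>(cmod (zeta F E x))\<^sup>2 - 1 / sqrt (F * x + E)\<bar> \<le> C / sqrt (F * x + E) ^ 4"
    and X3: "\<And>x. X \<le> x \<Longrightarrow> cmod ((zeta F E x)\<^sup>2 - g\<^sup>2 * exp (2 * \<i> * of_real (Theta F E x)) / of_real (sqrt (F * x + E))) \<le> C / sqrt (F * x + E) ^ 4"
    by (rule zeta_asymp[OF F_pos]) (rule that)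
  define \<mu> where "\<mu> = lam / 2"
  define \<xi> where "\<xi> x = Theta F E x - Theta F (E - lam) x" for x
  \<comment> \<open>Sampling at n - 1/2 places consecutive values symmetrically about n, so their
    sum is 2 \<open>\<xi>\<close> n up to O(p^(-3)); sampling at n would leave a phase error of
    order 1/p in A_n.\<close>
  define y where "y n = exp (\<i> * of_real (\<xi> (real n - 1/2))) * g * a n" for n
  define k1 where "k1 = \<bar>lam\<bar> * (F + \<bar>lam\<bar>)"
  define k3 where "k3 = 16 * C + 2 * \<bar>lam\<bar>"
  define B where "B = (\<bar>\<mu>\<bar> * k3 + 2 * k1 + \<bar>\<mu>\<bar> ^ 3) + \<bar>\<mu>\<bar> * (k3 + k1)"
  have k10: "0 \<le> k1" and k30: "0 \<le> k3" using F_pos C by (simp_all add: k1_def k3_def)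
  have gg: "g * cnj g = 1" using g complex_norm_square[of g] by simp
  obtain N where N: "\<And>n. N \<le> n \<Longrightarrow> 1 + F + \<bar>lam\<bar> \<le> p (real n)" using p_large[of "1 + F + \<bar>lam\<bar>"] by blast
  define n0 where "n0 = max N (nat \<lceil>X\<rceil>)"
  define A where "A = (\<lambda>n. - \<i> * of_real \<mu> * b n)"
  define \<epsilon> where "\<epsilon> n = y (Suc n) - ((1 + of_real ((cmod (A n))\<^sup>2 / 2)) * y n + A n * cnj (y n))" for n
  have cy: "cmod (y n) = cmod (a n)" for n by (simp add: y_def norm_mult g)
  have eps: "cmod (\<epsilon> n) \<le> B / p (real n) ^ 3 * cmod (y n)" if "n0 \<le> n" for n
  proof -
    define q where "q = p (real n)"
    define P where "P = sqrt (F * real n + E)"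
    define v where "v = F * real n + (E - lam)"
    define s where "s = \<mu> / q"
    have Xn: "X \<le> real n" using that by (simp add: n0_def)
    have q: "1 + F + \<bar>lam\<bar> \<le> q" using N[of n] that by (simp add: q_def n0_def)
    have q1: "1 \<le> q" and q0: "0 < q" using q F_pos by linarith+
    have qv: "q = sqrt v" by (simp add: q_def p_def v_def)
    have v: "0 \<le> v" using q0 by (simp add: qv)
    have v2: "v = q\<^sup>2" using v by (simp add: qv)
    have xd: "(\<xi> has_real_derivative sqrt (F * x + E) - sqrt (F * x + (E - lam))) (at x)"
      "\<bar>(sqrt (F * x + E) - sqrt (F * x + (E - lam))) - s\<bar> \<le> k1 / q ^ 3" if "\<bar>x - real n\<bar> \<le> 1/2" for x
    proof -
      have e: "F * x + (E - lam) = v + F * (x - real n)" "F * x + E = v + F * (x - real n) + lam"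
        by (simp_all add: v_def algebra_simps)
      have "F * \<bar>x - real n\<bar> \<le> F * (1/2)" using that F_pos by (intro mult_left_mono) auto
      then have d: "\<bar>F * (x - real n)\<bar> \<le> F / 2" using F_pos by (simp add: abs_mult)
      note S = sqrt_shift_derivative[OF F_pos v q[unfolded qv] d]
      show "(\<xi> has_real_derivative sqrt (F * x + E) - sqrt (F * x + (E - lam))) (at x)"
        unfolding \<xi>_def[abs_def] by (intro DERIV_diff Theta_deriv F_pos) (use S(1,2) e in simp_all)
      show "\<bar>(sqrt (F * x + E) - sqrt (F * x + (E - lam))) - s\<bar> \<le> k1 / q ^ 3"
        using S(3) unfolding e s_def \<mu>_def k1_def qv .
    qed
    define xp x0 xm where "xp = \<xi> (real n + 1/2)" and "x0 = \<xi> (real n)" and "xm = \<xi> (real n - 1/2)"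
    have m1: "\<bar>xp - x0 - 1/2 * s\<bar> \<le> 1/2 * (k1 / q ^ 3)"
      using mean_value_approx[of "real n" "real n + 1/2" \<xi> _ s "k1 / q ^ 3", OF _ xd] unfolding xp_def x0_def by simp
    have m2: "\<bar>x0 - xm - 1/2 * s\<bar> \<le> 1/2 * (k1 / q ^ 3)"
      using mean_value_approx[of "real n - 1/2" "real n" \<xi> _ s "k1 / q ^ 3", OF _ xd] unfolding xm_def x0_def by simp
    have d: "\<bar>(xp - xm) - s\<bar> \<le> k1 / q ^ 3" and sd: "\<bar>(xp + xm - 2 * x0) - 0\<bar> \<le> k1 / q ^ 3"
      using m1 m2 by linarith+
    have Pv: "P = sqrt (v + lam)" by (simp add: P_def v_def algebra_simps)
    have Phalf: "q / 2 \<le> P"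
    proof -
      have "(1 + \<bar>lam\<bar>) * (1 + \<bar>lam\<bar>) \<le> q * q" using q F_pos by (intro mult_mono) auto
      moreover have "2 * \<bar>lam\<bar> \<le> (1 + \<bar>lam\<bar>) * (1 + \<bar>lam\<bar>)" by (simp add: algebra_simps)
      ultimately have "2 * \<bar>lam\<bar> \<le> v" by (simp add: v2 power2_eq_square)
      moreover have "(q / 2)\<^sup>2 = v / 4" by (simp add: v2 power_divide)
      moreover have "- \<bar>lam\<bar> \<le> lam" by linarith
      ultimately have "(q / 2)\<^sup>2 \<le> v + lam" using v by linarith
      then show ?thesis unfolding Pv by (rule real_le_rsqrt)
    qed
    have P0: "0 < P" using Phalf q0 by linarith
    have "\<bar>P - q\<bar> \<le> \<bar>lam\<bar> / q"
      using sqrt_diff_bound[of "v + lam" v] P0 q0 unfolding Pv qv by simp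
    then have Pq: "\<bar>1 / P - 1 / q\<bar> \<le> 2 * \<bar>lam\<bar> / q ^ 3"
    proof -
      assume a: "\<bar>P - q\<bar> \<le> \<bar>lam\<bar> / q"
      have "1 / P - 1 / q = (q - P) / (P * q)" using P0 q0 by (simp add: field_simps)
      then have "\<bar>1 / P - 1 / q\<bar> = \<bar>P - q\<bar> / (P * q)" using P0 q0 by (simp add: abs_mult abs_minus_commute)
      also have "\<dots> \<le> (\<bar>lam\<bar> / q) / (q / 2 * q)"
        using a Phalf q0 by (intro frac_le mult_right_mono) auto
      also have "\<dots> = 2 * \<bar>lam\<bar> / q ^ 3" using q0 by (simp add: power3_eq_cube mult_ac)
      finally show ?thesis .
    qed
    have C3: "C / P ^ 4 \<le> 16 * C / q ^ 3"
    proof -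
      have "C / P ^ 4 \<le> C / (q / 2) ^ 4" using Phalf C q0 by (intro divide_left_mono power_mono) auto
      also have "\<dots> = 16 * C / q ^ 4" by (simp add: power_divide)
      also have "\<dots> \<le> 16 * C / q ^ 3" using q1 C by (intro divide_left_mono power_increasing) auto
      finally show ?thesis .
    qed
    define Z where "Z = (cmod (zeta F E (real n)))\<^sup>2"
    define W where "W = (zeta F E (real n))\<^sup>2"
    define \<omega> where "\<omega> = exp (2 * \<i> * of_real (Theta F E (real n)))"
    have \<omega>: "cmod \<omega> = 1" by (simp add: \<omega>_def norm_exp_eq_Re)
    have Zq: "\<bar>Z - 1 / q\<bar> \<le> k3 / q ^ 3"
    proof -
      have "\<bar>Z - 1 / P\<bar> \<le> C / P ^ 4" using X2[OF Xn] by (simp only: Z_def P_def)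
      then show ?thesis using C3 Pq unfolding k3_def add_divide_distrib by linarith
    qed
    have Wq: "cmod (W - g\<^sup>2 * \<omega> / of_real q) \<le> k3 / q ^ 3"
    proof -
      have "W - g\<^sup>2 * \<omega> / of_real q = (W - g\<^sup>2 * \<omega> / of_real P) + g\<^sup>2 * \<omega> * of_real (1 / P - 1 / q)"
        by (simp add: right_diff_distrib)
      also have "cmod \<dots> \<le> C / P ^ 4 + 2 * \<bar>lam\<bar> / q ^ 3"
      proof (intro norm_triangle_le add_mono)
        show "cmod (W - g\<^sup>2 * \<omega> / of_real P) \<le> C / P ^ 4" using X3[OF Xn] by (simp only: W_def P_def \<omega>_def)
        show "cmod (g\<^sup>2 * \<omega> * of_real (1 / P - 1 / q)) \<le> 2 * \<bar>lam\<bar> / q ^ 3"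
          using Pq by (simp only: norm_mult norm_power g \<omega> norm_of_real power_one mult_1)
      qed
      also have "\<dots> \<le> k3 / q ^ 3" using C3 unfolding k3_def add_divide_distrib by linarith
      finally show ?thesis .
    qed
    have bn: "b n = exp (- \<i> * of_real (4 / (3 * F) * q ^ 3)) / of_real q" by (simp add: b_def q_def)
    have cb: "cmod (b n) = 1 / q" using q0 unfolding bn by (simp add: norm_divide norm_exp_eq_Re)
    have cA: "of_real ((cmod (A n))\<^sup>2 / 2) = (of_real (s\<^sup>2 / 2) :: complex)"
      by (simp add: A_def norm_mult cb s_def power_divide power_mult_distrib)
    have y': "y (Suc n) = exp (\<i> * of_real (xp - xm)) * (1 - \<i> * of_real (\<mu> * Z)) * y n
      + (- \<i> * of_real \<mu>) * (cnj W * g\<^sup>2 * exp (\<i> * of_real (xp + xm))) * cnj (y n)"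
    proof -
      have ca: "cnj (a n) = g * exp (\<i> * of_real xm) * cnj (y n)"
      proof -
        have "exp (\<i> * of_real xm) * cnj (exp (\<i> * of_real xm)) = 1"
          by (simp add: exp_cnj flip: exp_add)
        then have "(g * cnj g) * (exp (\<i> * of_real xm) * cnj (exp (\<i> * of_real xm))) * cnj (a n) = cnj (a n)"
          unfolding gg by simp
        then show ?thesis unfolding y_def xm_def[symmetric] by (simp add: mult_ac)
      qed
      have e1: "exp (\<i> * of_real (xp - xm)) * exp (\<i> * of_real xm) = exp (\<i> * complex_of_real xp)"
        and e2: "exp (\<i> * of_real (xp + xm)) = exp (\<i> * of_real xp) * exp (\<i> * complex_of_real xm)"
        by (simp_all add: algebra_simps flip: exp_add)
      have xS: "\<xi> (real (Suc n) - 1/2) = xp" by (simp add: xp_def algebra_simps)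
      have "y (Suc n) = exp (\<i> * of_real xp) * g * (a n - \<i> * of_real \<mu> * (of_real Z * a n + cnj W * cnj (a n)))"
        unfolding y_def xS step[of n] \<mu>_def Z_def W_def by simp
      also have "\<dots> = exp (\<i> * of_real xp) * g * a n * (1 - \<i> * of_real (\<mu> * Z)) + (- \<i> * of_real \<mu>) * (exp (\<i> * of_real xp) * g * cnj W * cnj (a n))"
        by (simp add: algebra_simps)
      also have "exp (\<i> * of_real xp) * g * a n = exp (\<i> * of_real (xp - xm)) * y n"
        unfolding y_def xm_def[symmetric] e1[symmetric] by (simp add: mult_ac)
      finally show ?thesis unfolding ca e2 by (simp add: mult_ac power2_eq_square)
    qed
    \<comment> \<open>The factors g cancel, and 2 Theta at E minus 2 \<open>\<xi>\<close> n is 2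
      Theta at E - lam, that is 4/(3F) q^3.\<close>
    have c2: "cnj (g\<^sup>2 * \<omega> / of_real q) * g\<^sup>2 * exp (\<i> * of_real (xp + xm)) = exp (\<i> * of_real (xp + xm - 2 * x0)) * b n"
    proof -
      have "2 * x0 = 2 * Theta F E (real n) - 4 / (3 * F) * q ^ 3"
        unfolding x0_def \<xi>_def Theta_def[OF F_pos] q_def p_def by (simp add: algebra_simps)
      then have "\<i> * complex_of_real (xp + xm - 2 * x0) + (- \<i> * of_real (4 / (3 * F) * q ^ 3))
        = cnj (2 * \<i> * of_real (Theta F E (real n))) + \<i> * of_real (xp + xm)"
        by (simp only: of_real_diff of_real_add of_real_mult) (simp add: algebra_simps)
      then have "exp (\<i> * of_real (xp + xm - 2 * x0)) * exp (- \<i> * of_real (4 / (3 * F) * q ^ 3)) = cnj \<omega> * exp (\<i> * of_real (xp + xm))"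
        unfolding \<omega>_def exp_cnj exp_add[symmetric] by (rule arg_cong)
      moreover have "cnj (g\<^sup>2 * \<omega> / of_real q) * g\<^sup>2 * exp (\<i> * of_real (xp + xm)) = (g * cnj g)\<^sup>2 * (cnj \<omega> * exp (\<i> * of_real (xp + xm))) / of_real q"
        by (simp add: power2_eq_square mult_ac)
      ultimately show ?thesis unfolding bn gg by simp
    qed
    have first: "cmod (exp (\<i> * of_real (xp - xm)) * (1 - \<i> * of_real (\<mu> * Z)) - (1 + of_real (s\<^sup>2 / 2))) \<le> (\<bar>\<mu>\<bar> * k3 + 2 * k1 + \<bar>\<mu>\<bar> ^ 3) / q ^ 3"
    proof -
      have "\<bar>\<mu>\<bar> \<le> q" using q F_pos unfolding \<mu>_def by linarith
      then have s1: "\<bar>s\<bar> \<le> 1" using q0 by (simp add: s_def)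
      have "\<mu> * Z - s = \<mu> * (Z - 1 / q)" by (simp add: s_def algebra_simps)
      then have "\<bar>\<mu> * Z - s\<bar> = \<bar>\<mu>\<bar> * \<bar>Z - 1 / q\<bar>" by (simp add: abs_mult)
      also have "\<dots> \<le> \<bar>\<mu>\<bar> * (k3 / q ^ 3)" using Zq by (intro mult_left_mono) auto
      finally have "\<bar>\<mu> * Z - s\<bar> \<le> \<bar>\<mu>\<bar> * (k3 / q ^ 3)" .
      from unimodular_step[OF s1 d this] have "cmod (exp (\<i> * of_real (xp - xm)) * (1 - \<i> * of_real (\<mu> * Z)) - (1 + of_real (s\<^sup>2 / 2))) \<le> \<bar>\<mu>\<bar> * (k3 / q ^ 3) + 2 * (k1 / q ^ 3) + \<bar>s\<bar> ^ 3" .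
      also have "\<bar>s\<bar> ^ 3 = \<bar>\<mu>\<bar> ^ 3 / q ^ 3" using q0 by (simp add: s_def power_divide)
      finally show ?thesis by (simp add: add_divide_distrib)
    qed
    have second: "cmod ((- \<i> * of_real \<mu>) * (cnj W * g\<^sup>2 * exp (\<i> * of_real (xp + xm))) - A n) \<le> \<bar>\<mu>\<bar> * (k3 + k1) / q ^ 3"
    proof -
      have "(- \<i> * of_real \<mu>) * (cnj W * g\<^sup>2 * exp (\<i> * of_real (xp + xm))) - A n
        = (- \<i> * of_real \<mu>) * (cnj (W - g\<^sup>2 * \<omega> / of_real q) * g\<^sup>2 * exp (\<i> * of_real (xp + xm))
          + (cnj (g\<^sup>2 * \<omega> / of_real q) * g\<^sup>2 * exp (\<i> * of_real (xp + xm)) - b n))"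
        by (simp add: A_def algebra_simps)
      also have "\<dots> = (- \<i> * of_real \<mu>) * (cnj (W - g\<^sup>2 * \<omega> / of_real q) * g\<^sup>2 * exp (\<i> * of_real (xp + xm))
          + (exp (\<i> * of_real (xp + xm - 2 * x0)) - exp (\<i> * of_real 0)) * b n)"
        unfolding c2 by (simp add: algebra_simps)
      also have "cmod \<dots> \<le> \<bar>\<mu>\<bar> * (k3 / q ^ 3 + k1 / q ^ 3)"
        unfolding norm_mult[of "- \<i> * of_real \<mu>"]
      proof (intro mult_mono norm_triangle_le add_mono)
        show "cmod (cnj (W - g\<^sup>2 * \<omega> / of_real q) * g\<^sup>2 * exp (\<i> * of_real (xp + xm))) \<le> k3 / q ^ 3"
          using Wq by (simp only: norm_mult norm_power g norm_exp_i_times complex_mod_cnj power_one mult_1_right)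
        have "cmod ((exp (\<i> * of_real (xp + xm - 2 * x0)) - exp (\<i> * of_real 0)) * b n) \<le> k1 / q ^ 3 * 1"
          unfolding norm_mult
        proof (intro mult_mono)
          show "cmod (exp (\<i> * of_real (xp + xm - 2 * x0)) - exp (\<i> * of_real 0)) \<le> k1 / q ^ 3"
            using iexp_Lipschitz[of "xp + xm - 2 * x0" 0] sd by linarith
          show "cmod (b n) \<le> 1" using q1 by (simp add: cb)
        qed (use k10 q0 in auto)
        then show "cmod ((exp (\<i> * of_real (xp + xm - 2 * x0)) - exp (\<i> * of_real 0)) * b n) \<le> k1 / q ^ 3" by simp
      qed (auto simp: norm_mult)
      also have "\<dots> = \<bar>\<mu>\<bar> * (k3 + k1) / q ^ 3" by (simp add: add_divide_distrib distrib_left)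
      finally show ?thesis .
    qed
    have "\<epsilon> n = (exp (\<i> * of_real (xp - xm)) * (1 - \<i> * of_real (\<mu> * Z)) - (1 + of_real (s\<^sup>2 / 2))) * y n
      + ((- \<i> * of_real \<mu>) * (cnj W * g\<^sup>2 * exp (\<i> * of_real (xp + xm))) - A n) * cnj (y n)"
      unfolding \<epsilon>_def y' cA by (simp only: left_diff_distrib) simp
    also have "cmod \<dots> \<le> (\<bar>\<mu>\<bar> * k3 + 2 * k1 + \<bar>\<mu>\<bar> ^ 3) / q ^ 3 * cmod (y n) + \<bar>\<mu>\<bar> * (k3 + k1) / q ^ 3 * cmod (y n)"
    proof (intro norm_triangle_le add_mono)
      show "cmod ((exp (\<i> * of_real (xp - xm)) * (1 - \<i> * of_real (\<mu> * Z)) - (1 + of_real (s\<^sup>2 / 2))) * y n) \<le> (\<bar>\<mu>\<bar> * k3 + 2 * k1 + \<bar>\<mu>\<bar> ^ 3) / q ^ 3 * cmod (y n)"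
        unfolding norm_mult[of _ "y n"] by (rule mult_right_mono[OF first]) simp
      show "cmod (((- \<i> * of_real \<mu>) * (cnj W * g\<^sup>2 * exp (\<i> * of_real (xp + xm))) - A n) * cnj (y n)) \<le> \<bar>\<mu>\<bar> * (k3 + k1) / q ^ 3 * cmod (y n)"
        unfolding norm_mult[of _ "cnj (y n)"] complex_mod_cnj by (rule mult_right_mono[OF second]) simp
    qed
    also have "\<dots> = B / q ^ 3 * cmod (y n)" unfolding B_def add_divide_distrib[of _ "\<bar>\<mu>\<bar> * (k3 + k1)"] by (simp add: distrib_right)
    finally show ?thesis by (simp only: q_def)
  qed
  have "convergent (\<lambda>n. ln (cmod (y n)))"
  proof (rule osc_convergence)
    show "y (Suc n) = (1 + of_real ((cmod (- \<i> * of_real \<mu> * b n))\<^sup>2 / 2)) * y n + - \<i> * of_real \<mu> * b n * cnj (y n) + \<epsilon> n"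
      if "n0 \<le> n" for n
      by (simp add: \<epsilon>_def A_def)
    show "cmod (\<epsilon> n) \<le> B / p (real n) ^ 3 * cmod (y n)" if "n0 \<le> n" for n by (rule eps[OF that])
    show "y n \<noteq> 0" if "n0 \<le> n" for n using cy[of n] nz[of n] by auto
  qed
  then show ?thesis by (simp only: cy)
qed

theorem theorem7p2:
  fixes lam F E :: real and p q :: nat and \<psi> :: "real \<Rightarrow> real"
  assumes "p \<ge> 1" and "q \<ge> 1"
    and "F = pi^2 * real q / (3 * real p)"
    and "gen_eig_solution F E (\<lambda>_. lam) \<psi>"
    and "\<exists>x. \<psi> x \<noteq> 0"
    and "E \<notin> {pi^2 / (3 * real p) * of_int m + lam | m :: int. True}
         \<or> (\<exists>m :: int. E = pi^2 / (3 * real p) * of_int m + lam \<and>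
              (\<Sum>j = 0..<q. cis (- 2 * pi * (real p * real j ^ 3 - real j * of_int m) / real q)) = 0)"
  shows "\<exists>L :: real. (\<lambda>n. ln (pruefer_R F E \<psi> n)) \<longlonglongrightarrow> L"
proof -
  have F_pos: "0 < F" using assms(1-3) by simp
  interpret eig_solution F E lam \<psi> by unfold_locales (fact F_pos assms(4))+
  have E_eq: "E = pi\<^sup>2 / (3 * real p) * of_int m + lam \<longleftrightarrow> 3 * real p * (E - lam) / pi\<^sup>2 = of_int m" for m :: int
    using assms(1) by (auto simp: field_simps)
  obtain Bd where Bd: "\<And>K L. cmod (\<Sum>k\<in>{K..<L}. osc_sum.om F (E - lam) k) \<le> Bd"
  proof (rule om_bounded[OF assms(1-3)])
    fix m :: int
    assume m: "3 * real p * (E - lam) / pi\<^sup>2 = of_int m"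
    then have "E = pi\<^sup>2 / (3 * real p) * of_int m + lam" by (simp only: E_eq)
    then obtain m' :: int where m': "E = pi\<^sup>2 / (3 * real p) * of_int m' + lam"
      "(\<Sum>j = 0..<q. cis (- 2 * pi * (real p * real j ^ 3 - real j * of_int m') / real q)) = 0"
      using assms(6) by blast
    \<comment> \<open>The energy determines m, so the vanishing sum of the hypothesis is the one
      required here.\<close>
    from m'(1) have "m' = m" using m unfolding E_eq by simp
    with m'(2) show "(\<Sum>j = 0..<q. cis (- 2 * pi * (real p * real j ^ 3 - real j * of_int m) / real q)) = 0"
      by simp
  qed (rule that)
  have res: "osc_res F (E - lam) Bd"
    using F_pos Bd by (simp add: osc_res_def osc_res_axioms_def osc_sum_def osc_def)
  obtain x where x: "\<psi> x \<noteq> 0" using assms(5) ..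
  have "convergent (\<lambda>n. ln (cmod (al (int n))))"
  proof (rule alpha_convergence[OF res])
    show "al (int (Suc n)) = al (int n) - \<i> * of_real (lam / 2) *
      (of_real ((cmod (zeta F E (real n)))\<^sup>2) * al (int n) + cnj ((zeta F E (real n))\<^sup>2) * cnj (al (int n)))" for n
      using al_step[of "int n"] by (simp only: of_nat_Suc add.commute[of 1] of_int_of_nat_eq)
    show "al (int n) \<noteq> 0" for n by (rule al_nonzero[OF x])
  qed
  then obtain L where L: "(\<lambda>n. ln (cmod (al (int n)))) \<longlonglongrightarrow> L" unfolding convergent_def ..
  have "ln (pruefer_R F E \<psi> n) = ln 2 + ln (cmod (al (int n)))" for n
    using al_nonzero[OF x, of "int n"] by (simp add: pruefer_R_def pruefer_alpha_eq ln_mult)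
  with tendsto_add[OF tendsto_const[of "ln 2"] L] show ?thesis by auto
qed

end
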